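(* Let $\lambda>0$ and let $F$ be a real entire function of exponential type at most $2\pi$ such that $G_\lambda(x)\le F(x)$ for all real $x$. Then $$\lambda^{-1/2}\,\theta_3\bigl(0,i\lambda^{-1}\bigr)\ \le\ \int_{-\infty}^{\infty}F(x)\,dx,$$ and there is equality if and only if $F(z)=M_\lambda(z)$.
   Context: An entire function $F$ is of exponential type at most $2\pi\delta$ if for every $\epsilon>0$ there is a constant $C>0$ with $|F(z)|\le C e^{(2\pi\delta+\epsilon)|z|}$ for all $z\in\mathbb{C}$. A real entire function is an entire function whose restriction to $\mathbb{R}$ is real valued. For $\lambda>0$, $G_\lambda(z)=e^{-\pi\lambda z^2}$, and $M_\lambda$ is the entire function (of exponential type $2\pi$) $$M_\lambda(z)=\Bigl(\frac{\sin\pi z}{\pi}\Bigr)^2\Bigl\{\sum_{m=-\infty}^{\infty}\frac{G_\lambda(m)}{(z-m)^2}+\sum_{n=-\infty}^{\infty}\frac{G_\lambda'(n)}{z-n}\Bigr\}$$ (with removable singularities filled in). With $e(z)=e^{2\pi i z}$, $\Im\tau>0$ and $q=e^{\pi i\tau}$, $\theta_3(v,\tau)=\sum_{n=-\infty}^{\infty}q^{n^2}e(nv)$. Since $F\ge G_\lambda>0$, $\int F$ is well defined in $(0,\infty]$. *)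

theory Defs
  imports "HOL-Complex_Analysis.Complex_Analysis"
begin

definition real_entire :: "(complex \<Rightarrow> complex) \<Rightarrow> bool" where
  "real_entire F \<longleftrightarrow> F holomorphic_on UNIV \<and> (\<forall>x::real. F (of_real x) \<in> \<real>)"

definition exp_type_at_most :: "real \<Rightarrow> (complex \<Rightarrow> complex) \<Rightarrow> bool" where
  "exp_type_at_most \<tau> F \<longleftrightarrow>
     (\<forall>\<epsilon>>0. \<exists>C>0. \<forall>z. norm (F z) \<le> C * exp ((\<tau> + \<epsilon>) * norm z))"

definition gaussian :: "real \<Rightarrow> complex \<Rightarrow> complex" where
  "gaussian lam z = exp (- of_real (pi * lam) * z\<^sup>2)"

text \<open>
  The interpolation formula makes sense only off the integers, where its
  singularities are removable; \<^const>\<open>remove_sings\<close> replaces the values at the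
  integers by the limits there.  The bilateral series converge absolutely, so they
  are unordered sums over the integers.
\<close>

definition gaussian_majorant :: "real \<Rightarrow> complex \<Rightarrow> complex" where
  "gaussian_majorant lam = remove_sings (\<lambda>z.
     (sin (of_real pi * z) / of_real pi)\<^sup>2 *
     ((\<Sum>\<^sub>\<infinity>m::int. gaussian lam (of_int m) / (z - of_int m)\<^sup>2) +
      (\<Sum>\<^sub>\<infinity>n::int. deriv (gaussian lam) (of_int n) / (z - of_int n))))"

text \<open>Meaningful for \<open>Im \<tau> > 0\<close>, where the series converges absolutely.\<close>

definition theta3 :: "complex \<Rightarrow> complex \<Rightarrow> complex" where
  "theta3 v \<tau> =
     (\<Sum>\<^sub>\<infinity>n::int. exp (of_real pi * \<i> * \<tau>) powi (n\<^sup>2) * exp (2 * of_real pi * \<i> * (of_int n * v)))"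

text \<open>On the imaginary axis the theta constant is real, so taking its real part loses nothing.\<close>

lemma theta3_0_imag_axis_real: "theta3 0 (\<i> * of_real y) \<in> \<real>"
proof -
  have "exp (of_real pi * \<i> * (\<i> * of_real y)) = (of_real (exp (- pi * y)) :: complex)"
    by (simp add: exp_of_real [symmetric] algebra_simps)
  hence eq: "theta3 0 (\<i> * of_real y) =
      (\<Sum>\<^sub>\<infinity>n::int. of_real (exp (- pi * y) powi (n\<^sup>2)))"
    unfolding theta3_def by simp
  have "cnj (theta3 0 (\<i> * of_real y)) = theta3 0 (\<i> * of_real y)"
    unfolding eq infsum_cnj [symmetric] by simp
  thus ?thesis by (simp only: Reals_cnj_iff)
qed

end

theory Submission
  imports Defs "HOL-Real_Asymp.Real_Asymp" "HOL-Probability.Sinc_Integral"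
    "HOL-Probability.Characteristic_Functions"
begin

text \<open>
  Let \<open>G\<close> be the Gaussian, \<open>F \<ge> G\<close> on the real line, and let \<open>F\<close> have exponential type at most
  \<open>2 \<pi>\<close>.  The idea is that such a function is sampled exactly by the integers: heuristically
  \<open>\<integral>F = \<Sum>F(n)\<close>, hence \<open>\<integral>F \<ge> \<Sum>G(n)\<close>, and the last sum is \<open>\<lambda> powr (-1/2) * \<theta>\<^sub>3(0, i/\<lambda>)\<close> by Poisson
  summation.  Equality forces \<open>F(n) = G(n)\<close> at every integer; since \<open>F - G\<close> has a minimum there, also
  \<open>F'(n) = G'(n)\<close>, and these Hermite data at the integers determine \<open>F\<close>.

  \<^bold>\<open>Quadrature.\<close>  A primitive \<open>P\<close> of an integrable \<open>F\<close> is bounded on the real line, so the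
  Phragmen-Lindelof principle (\<open>exp_type_bounded_on_reals\<close>) gives \<open>|P(x + iy)| \<le> C exp (2 \<pi> |y|)\<close>.
  For \<open>r < 1\<close> the function \<open>P(r z)\<close> grows strictly slower than \<open>(sin \<pi>z)\<^sup>2\<close> away from the real axis, and
  the residue theorem applied to \<open>P(r z) (\<pi> / sin \<pi>z)\<^sup>2\<close> on growing rectangles
  yields \<open>\<Sum>r F(r n) = P(\<infinity>) - P(-\<infinity>) = \<integral>F\<close> (\<open>sum_deriv_tendsto\<close>, \<open>dilated_quadrature\<close>).  Working with the
  primitive is what makes everything elementary: it is bounded as soon as \<open>F\<close> is integrable,
  and it has limits at both ends.  Letting \<open>r\<close> tend to 1 gives \<open>\<Sum>F(n) \<le> \<integral>F\<close> when \<open>F \<ge> 0\<close>, and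
  equality when \<open>F(x) = O(1 / (1 + x\<^sup>2))\<close>.

  \<^bold>\<open>Theta.\<close>  Dirichlet's convergence argument at the single point 0, applied to
  the entire function \<open>\<Sum>G(z + n)\<close>, gives the Poisson summation formula for the Gaussian
  (\<open>theta_transformation\<close>).

  \<^bold>\<open>Uniqueness.\<close>  The majorant is a locally uniformly convergent series of entire functions with the
  values and derivatives of \<open>G\<close> at the integers, it is \<open>O(exp (2 \<pi> |Im z|))\<close>, and it decays like
  \<open>1 / (1 + x\<^sup>2)\<close> on the real line.  In the equality case \<open>F\<close> minus the majorant
  vanishes doubly at the integers; divided by \<open>(sin \<pi>z)\<^sup>2\<close> it is a bounded entire function, hence
  constant, and integrability on the real line makes the constant 0 (\<open>integrable_double_zeros_eq_0\<close>).
  Conversely, the decay of the majorant gives exact quadrature for it, so its integral is \<open>\<Sum>G(n)\<close>.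
\<close>

section \<open>Functions of exponential type bounded on the real line\<close>

text \<open>
  The factor \<open>exp (- \<delta> s\<^sup>3)\<close> beats the growth \<open>exp (A |s|\<^sup>2)\<close> as long as \<open>Re (s\<^sup>3)\<close> is comparable to
  \<open>|s|\<^sup>3\<close>, which is what the bound on the slope \<open>\<kappa>\<close> ensures.  The maximum principle on a large
  triangle then bounds the damped function by its values on the two edges, and \<open>\<delta>\<close> tends to 0.
\<close>
lemma sector_phragmen_lindelof:
  fixes g :: "complex \<Rightarrow> complex"
  assumes hol: "g holomorphic_on UNIV"
    and \<kappa>: "0 \<le> \<kappa>" "3 * \<kappa>\<^sup>2 < 1"
    and growth: "\<And>s. \<bar>Im s\<bar> \<le> \<kappa> * Re s \<Longrightarrow> norm (g s) \<le> C * exp (A * (norm s)\<^sup>2)"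
    and edge: "\<And>s. \<bar>Im s\<bar> = \<kappa> * Re s \<Longrightarrow> norm (g s) \<le> B"
    and "0 < B" "0 \<le> A" "0 \<le> C"
    and s: "\<bar>Im s\<bar> \<le> \<kappa> * Re s" "0 \<le> Re s"
  shows "norm (g s) \<le> B"
proof -
  have cube: "Re (s ^ 3) \<ge> (1 - 3 * \<kappa>\<^sup>2) * Re s ^ 3" if "\<bar>Im s\<bar> \<le> \<kappa> * Re s" "0 \<le> Re s" for s
  proof -
    have "(Im s)\<^sup>2 \<le> (\<kappa> * Re s)\<^sup>2"
      using that by (metis abs_ge_zero power2_abs power_mono)
    then have "3 * Re s * (Im s)\<^sup>2 \<le> 3 * Re s * (\<kappa> * Re s)\<^sup>2"
      using that by (intro mult_left_mono) auto
    moreover have "Re (s ^ 3) = Re s ^ 3 - 3 * Re s * (Im s)\<^sup>2"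
      by (simp add: power3_eq_cube power2_eq_square algebra_simps)
    ultimately show ?thesis by (simp add: power2_eq_square power3_eq_cube algebra_simps)
  qed
  have bound: "norm (g s) \<le> B * norm (exp (of_real \<delta> * s ^ 3))" if \<delta>: "\<delta> > 0" for \<delta> :: real
  proof -
    define h where "h = (\<lambda>s. g s * exp (- of_real \<delta> * s ^ 3))"
    define c where "c = \<delta> * (1 - 3 * \<kappa>\<^sup>2)"
    have c: "c > 0" using \<delta> \<kappa> by (simp add: c_def)
    have hn: "norm (h s) = norm (g s) * exp (- \<delta> * Re (s ^ 3))" for s
      by (simp add: h_def norm_mult)
    have hle: "norm (h s) \<le> norm (g s) * exp (- (c * Re s ^ 3))"
      if "\<bar>Im s\<bar> \<le> \<kappa> * Re s" "0 \<le> Re s" for s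
    proof -
      have "\<delta> * Re (s ^ 3) \<ge> \<delta> * ((1 - 3 * \<kappa>\<^sup>2) * Re s ^ 3)"
        using cube[OF that] \<delta> by (intro mult_left_mono) auto
      then show ?thesis unfolding hn c_def
        by (intro mult_left_mono) (auto simp: algebra_simps)
    qed
    have "((\<lambda>R. C * exp (A * ((1 + \<kappa>\<^sup>2) * R\<^sup>2) - c * R ^ 3)) \<longlongrightarrow> 0) at_top"
      using c by real_asymp
    then have "eventually (\<lambda>R. C * exp (A * ((1 + \<kappa>\<^sup>2) * R\<^sup>2) - c * R ^ 3) < B \<and> R > Re s) at_top"
      using \<open>0 < B\<close> by (intro eventually_conj order_tendstoD(2) eventually_gt_at_top)
    then obtain R where R: "C * exp (A * ((1 + \<kappa>\<^sup>2) * R\<^sup>2) - c * R ^ 3) < B" "R > Re s"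
      by (auto simp: eventually_at_top_linorder)
    define S where "S = {s. \<bar>Im s\<bar> \<le> \<kappa> * Re s \<and> 0 \<le> Re s \<and> Re s \<le> R}"
    have "closed S"
      unfolding S_def by (intro closed_Collect_conj closed_Collect_le continuous_intros)
    have "open {s. \<bar>Im s\<bar> < \<kappa> * Re s \<and> 0 < Re s \<and> Re s < R}" (is "open ?I")
      by (intro open_Collect_conj open_Collect_less continuous_intros)
    then have "?I \<subseteq> interior S"
      by (intro interior_maximal) (auto simp: S_def)
    then have fr: "s \<in> S \<and> s \<notin> ?I" if "s \<in> frontier S" for s
      using that \<open>closed S\<close> by (auto simp: frontier_def)
    have "bounded S"
    proof (rule boundedI)
      fix s assume "s \<in> S"
      then show "norm s \<le> R + \<kappa> * R"
        using cmod_le[of s] \<kappa> mult_left_mono[of "Re s" R \<kappa>] by (auto simp: S_def)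
    qed
    have "norm (h s) \<le> B"
    proof (rule maximum_modulus_frontier[where f = h and \<xi> = s])
      show "h holomorphic_on interior S"
        unfolding h_def by (intro holomorphic_intros holomorphic_on_subset[OF hol]) auto
      show "continuous_on (closure S) h"
        unfolding h_def
        by (intro continuous_intros holomorphic_on_imp_continuous_on holomorphic_on_subset[OF hol]) auto
      show "bounded S" by fact
      show "s \<in> S" using s R by (auto simp: S_def)
      fix s assume "s \<in> frontier S"
      from fr[OF this] consider "\<bar>Im s\<bar> = \<kappa> * Re s" "0 \<le> Re s"
        | "Re s = R" "\<bar>Im s\<bar> \<le> \<kappa> * Re s" "0 \<le> Re s"
        using \<kappa> by (auto simp: S_def not_less)
      then show "norm (h s) \<le> B"
      proof cases
        case 1
        have "norm (h s) \<le> norm (g s) * exp (- (c * Re s ^ 3))"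
          using 1 by (intro hle) auto
        also have "\<dots> \<le> B * 1"
          using 1 c edge \<open>0 < B\<close> by (intro mult_mono) auto
        finally show ?thesis by simp
      next
        case 2
        have "(Im s)\<^sup>2 \<le> (\<kappa> * R)\<^sup>2" using 2 by (metis abs_ge_zero power2_abs power_mono)
        then have sq: "(norm s)\<^sup>2 \<le> (1 + \<kappa>\<^sup>2) * R\<^sup>2"
          using 2 by (simp add: cmod_power2 algebra_simps power_mult_distrib)
        have "norm (h s) \<le> norm (g s) * exp (- (c * R ^ 3))"
          using hle[of s] 2 by auto
        also have "\<dots> \<le> C * exp (A * ((1 + \<kappa>\<^sup>2) * R\<^sup>2)) * exp (- (c * R ^ 3))"
        proof (intro mult_right_mono)
          have "norm (g s) \<le> C * exp (A * (norm s)\<^sup>2)" using 2 by (intro growth) auto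
          also have "\<dots> \<le> C * exp (A * ((1 + \<kappa>\<^sup>2) * R\<^sup>2))"
            using \<open>0 \<le> A\<close> \<open>0 \<le> C\<close> sq by (intro mult_left_mono) (auto intro: mult_left_mono)
          finally show "norm (g s) \<le> \<dots>" .
        qed auto
        also have "\<dots> = C * exp (A * ((1 + \<kappa>\<^sup>2) * R\<^sup>2) - c * R ^ 3)"
          by (simp add: exp_diff exp_minus field_simps)
        also have "\<dots> \<le> B" using R by simp
        finally show ?thesis .
      qed
    qed
    moreover have "g s = h s * exp (of_real \<delta> * s ^ 3)"
      by (simp add: h_def exp_minus)
    then have "norm (g s) = norm (h s) * norm (exp (of_real \<delta> * s ^ 3))"
      by (simp only: norm_mult)
    ultimately show ?thesis by (metis mult_right_mono norm_ge_zero)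
  qed
  have "((\<lambda>\<delta>::real. B * norm (exp (of_real \<delta> * s ^ 3))) \<longlongrightarrow> B * norm (exp (of_real 0 * s ^ 3))) (at_right 0)"
    by (intro tendsto_intros)
  moreover have "eventually (\<lambda>\<delta>::real. norm (g s) \<le> B * norm (exp (of_real \<delta> * s ^ 3))) (at_right 0)"
    using bound by (auto simp: eventually_at_right_less intro: eventually_mono[OF eventually_at_right_less])
  ultimately have "norm (g s) \<le> B * norm (exp (of_real 0 * s ^ 3))"
    by (intro tendsto_lowerbound) auto
  then show ?thesis by simp
qed

text \<open>
  The substitution \<open>z = \<omega> s\<^sup>2\<close> with \<open>\<omega> = exp (i \<pi> / 4)\<close> turns the first quadrant into the
  sector \<open>|arg s| \<le> \<pi> / 8\<close>, whose slope is \<open>tan (\<pi> / 8) = \<surd>2 - 1\<close>, and exponential growth into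
  growth of order 2.  Squaring replaces the fractional power of \<open>z\<close> in the usual damping factor.
\<close>
lemma quadrant_phragmen_lindelof:
  fixes f :: "complex \<Rightarrow> complex"
  assumes hol: "f holomorphic_on UNIV"
    and growth: "\<And>z. norm (f z) \<le> C * exp (A * norm z)"
    and axes: "\<And>t. 0 \<le> t \<Longrightarrow> norm (f (of_real t)) \<le> B" "\<And>t. 0 \<le> t \<Longrightarrow> norm (f (\<i> * of_real t)) \<le> B"
    and "0 < B" "0 \<le> A"
    and z: "0 \<le> Re z" "0 \<le> Im z"
  shows "norm (f z) \<le> B"
proof -
  define \<omega> where "\<omega> = (1 + \<i>) / of_real (sqrt 2)"
  define \<kappa> where "\<kappa> = sqrt 2 - 1"
  have \<kappa>2: "\<kappa>\<^sup>2 = 1 - 2 * \<kappa>" by (simp add: \<kappa>_def power2_eq_square algebra_simps)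
  have \<kappa>_gt: "0.4 < \<kappa>"
    using real_less_rsqrt[of "1.4" 2] by (simp add: \<kappa>_def power2_eq_square)
  have \<omega>: "norm \<omega> = 1" by (simp add: \<omega>_def norm_divide cmod_def power_divide)
  have rot: "(1 + \<i>) * \<omega> = \<i> * of_real (sqrt 2)" "(1 - \<i>) * \<omega> = of_real (sqrt 2)"
    by (simp_all add: \<omega>_def complex_eq_iff real_div_sqrt)
  have "C \<ge> 0" using growth[of 0] order_trans[OF norm_ge_zero[of "f 0"]] by simp
  define w where "w = z / \<omega>"
  define s where "s = csqrt w"
  have "\<omega> \<noteq> 0" using \<omega> by auto
  have s2: "s\<^sup>2 = w" by (simp add: s_def)
  have zs: "z = \<omega> * s\<^sup>2" using \<open>\<omega> \<noteq> 0\<close> by (simp add: s_def w_def)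
  have "\<omega> * cnj \<omega> = 1"
    using \<omega> complex_norm_square[of \<omega>] by simp
  then have "w = z * cnj \<omega>"
    using \<open>\<omega> \<noteq> 0\<close> by (simp add: w_def field_simps)
  then have "Re w = (Re z + Im z) / sqrt 2" "Im w = (Im z - Re z) / sqrt 2"
    by (simp_all add: \<omega>_def add_divide_distrib diff_divide_distrib)
  then have "\<bar>Im w\<bar> \<le> Re w"
    using divide_right_mono[of "\<bar>Im z - Re z\<bar>" "Re z + Im z" "sqrt 2"] z by simp
  then have "\<bar>2 * Re s * Im s\<bar> \<le> (Re s)\<^sup>2 - (Im s)\<^sup>2"
    using arg_cong[OF s2, of Re] arg_cong[OF s2, of Im] by (simp add: power2_eq_square mult_ac)
  have "Re s \<ge> 0" unfolding s_def by (rule Re_csqrt)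
  have sec: "\<bar>Im s\<bar> \<le> \<kappa> * Re s"
  proof -
    have "2 * Re s * \<bar>Im s\<bar> \<le> (Re s)\<^sup>2 - \<bar>Im s\<bar>\<^sup>2"
      using \<open>\<bar>2 * Re s * Im s\<bar> \<le> _\<close> \<open>Re s \<ge> 0\<close> by (simp add: abs_mult)
    then have "(\<bar>Im s\<bar> + Re s)\<^sup>2 \<le> (sqrt 2 * Re s)\<^sup>2"
      by (simp add: power2_eq_square algebra_simps)
    then have "\<bar>Im s\<bar> + Re s \<le> sqrt 2 * Re s"
      by (rule power2_le_imp_le) (use \<open>Re s \<ge> 0\<close> in auto)
    then show ?thesis by (simp add: \<kappa>_def algebra_simps)
  qed
  have "norm (f (\<omega> * s\<^sup>2)) \<le> B"
  proof (rule sector_phragmen_lindelof[where g = "\<lambda>s. f (\<omega> * s\<^sup>2)" and \<kappa> = \<kappa> and A = A and C = C])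
    show "(\<lambda>s. f (\<omega> * s\<^sup>2)) holomorphic_on UNIV"
      by (intro holomorphic_on_compose_gen[OF _ hol, unfolded o_def] holomorphic_intros) auto
    show "0 \<le> \<kappa>" "3 * \<kappa>\<^sup>2 < 1" using \<kappa>_gt by (simp_all add: \<kappa>2)
    show "norm (f (\<omega> * s\<^sup>2)) \<le> C * exp (A * (norm s)\<^sup>2)" for s
      using growth[of "\<omega> * s\<^sup>2"] \<omega> by (simp add: norm_mult norm_power)
    show "norm (f (\<omega> * s\<^sup>2)) \<le> B" if "\<bar>Im s\<bar> = \<kappa> * Re s" for s
    proof -
      define a where "a = Re s"
      have sq: "a * a - \<kappa> * a * (\<kappa> * a) = 2 * \<kappa> * (a * a)"
        using arg_cong[OF \<kappa>2, of "\<lambda>t. (1 - t) * (a * a)"] by (simp add: power2_eq_square algebra_simps)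
      have "a \<ge> 0" using that \<kappa>_gt zero_le_mult_iff[of \<kappa> "Re s"] by (auto simp: a_def)
      have "Im s = \<kappa> * a \<or> Im s = - (\<kappa> * a)"
        using that unfolding a_def by linarith
      then consider "s = Complex a (\<kappa> * a)" | "s = Complex a (- (\<kappa> * a))"
        unfolding a_def by (metis complex.collapse)
      then show ?thesis
      proof cases
        case 1
        have "s\<^sup>2 = of_real (2 * \<kappa> * a\<^sup>2) * (1 + \<i>)"
          unfolding 1 using sq by (simp add: complex_eq_iff power2_eq_square)
        then have "\<omega> * s\<^sup>2 = \<i> * of_real (sqrt 2 * (2 * \<kappa> * a\<^sup>2))"
          using arg_cong[OF rot(1), of "\<lambda>u. of_real (2 * \<kappa> * a\<^sup>2) * u"]
          by (simp add: mult_ac)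
        then show ?thesis using axes(2)[of "sqrt 2 * (2 * \<kappa> * a\<^sup>2)"] \<kappa>_gt by simp
      next
        case 2
        have "s\<^sup>2 = of_real (2 * \<kappa> * a\<^sup>2) * (1 - \<i>)"
          unfolding 2 using sq by (simp add: complex_eq_iff power2_eq_square)
        then have "\<omega> * s\<^sup>2 = of_real (sqrt 2 * (2 * \<kappa> * a\<^sup>2))"
          using arg_cong[OF rot(2), of "\<lambda>u. of_real (2 * \<kappa> * a\<^sup>2) * u"]
          by (simp add: mult_ac)
        then show ?thesis using axes(1)[of "sqrt 2 * (2 * \<kappa> * a\<^sup>2)"] \<kappa>_gt by simp
      qed
    qed
  qed (use assms \<open>C \<ge> 0\<close> sec \<open>Re s \<ge> 0\<close> in auto)
  then show ?thesis by (simp add: zs)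
qed

text \<open>
  Once the function is known to be bounded, dividing by \<open>1 - i \<delta> z\<close> is enough damping: this factor
  has modulus at least 1 in the upper half plane and tends to infinity.
\<close>
lemma half_plane_phragmen_lindelof:
  fixes f :: "complex \<Rightarrow> complex"
  assumes hol: "f holomorphic_on UNIV"
    and bnd: "\<And>z. 0 \<le> Im z \<Longrightarrow> norm (f z) \<le> B"
    and real: "\<And>x::real. norm (f (of_real x)) \<le> M" and "0 < M"
    and z: "0 \<le> Im z"
  shows "norm (f z) \<le> M"
proof -
  have bound: "norm (f z) \<le> M * norm (1 - \<i> * of_real \<delta> * z)" if \<delta>: "\<delta> > 0" for \<delta> :: real
  proof -
    define h where "h = (\<lambda>z. f z / (1 - \<i> * of_real \<delta> * z))"
    have ge1: "norm (1 - \<i> * of_real \<delta> * z) \<ge> 1" if "Im z \<ge> 0" for z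
    proof -
      have "Re (1 - \<i> * of_real \<delta> * z) \<ge> 1" using that \<delta> by simp
      then show ?thesis using complex_Re_le_cmod[of "1 - \<i> * of_real \<delta> * z"] by linarith
    qed
    \<comment> \<open>Chosen so that \<open>|1 - i \<delta> w| \<ge> \<delta> R - 1 \<ge> |B| / M\<close> on the arc \<open>|w| = R\<close>.\<close>
    define R where "R = norm z + (\<bar>B\<bar> / M + 1) / \<delta>"
    have R: "norm z \<le> R" "\<delta> * R - 1 \<ge> \<bar>B\<bar> / M"
      using \<delta> \<open>0 < M\<close> by (auto simp: R_def field_simps)
    define S where "S = {z. 0 \<le> Im z \<and> norm z \<le> R}"
    have "closed S"
      unfolding S_def by (intro closed_Collect_conj closed_Collect_le continuous_intros)
    have "open {z::complex. 0 < Im z \<and> norm z < R}" (is "open ?I")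
      by (intro open_Collect_conj open_Collect_less continuous_intros)
    then have "?I \<subseteq> interior S"
      by (intro interior_maximal) (auto simp: S_def)
    then have fr: "s \<in> S \<and> s \<notin> ?I" if "s \<in> frontier S" for s
      using that \<open>closed S\<close> by (auto simp: frontier_def)
    have nz: "1 - \<i> * of_real \<delta> * z \<noteq> 0" if "z \<in> S" for z
      using ge1[of z] that by (auto simp: S_def)
    have "norm (h z) \<le> M"
    proof (rule maximum_modulus_frontier[where f = h and \<xi> = z])
      show "h holomorphic_on interior S"
        unfolding h_def using nz interior_subset[of S]
        by (intro holomorphic_intros holomorphic_on_subset[OF hol]) blast+
      show "continuous_on (closure S) h"
        unfolding h_def using nz \<open>closed S\<close>
        by (intro continuous_intros holomorphic_on_imp_continuous_on holomorphic_on_subset[OF hol]) auto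
      show "bounded S" by (rule boundedI[where B = R]) (auto simp: S_def)
      show "z \<in> S" using z R by (auto simp: S_def)
      fix s assume "s \<in> frontier S"
      from fr[OF this] consider "Im s = 0" | "norm s = R" "Im s \<ge> 0"
        by (auto simp: S_def not_less)
      then show "norm (h s) \<le> M"
      proof cases
        case 1
        then have "s = of_real (Re s)" by (simp add: complex_eq_iff)
        then have "norm (f s) \<le> M" using real[of "Re s"] by simp
        moreover have "norm (h s) \<le> norm (f s) / 1"
          unfolding h_def norm_divide using ge1[of s] 1 by (intro divide_left_mono) auto
        ultimately show ?thesis by simp
      next
        case 2
        have "norm (\<i> * of_real \<delta> * s) - norm (1::complex) \<le> norm (1 - \<i> * of_real \<delta> * s)"
          using norm_triangle_ineq2[of "\<i> * of_real \<delta> * s" 1] by (simp add: norm_minus_commute)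
        then have "\<bar>B\<bar> / M \<le> norm (1 - \<i> * of_real \<delta> * s)"
          using R 2 \<delta> by (simp add: norm_mult)
        then have "norm (f s) \<le> M * norm (1 - \<i> * of_real \<delta> * s)"
          using bnd[of s] 2 \<open>0 < M\<close> by (simp add: field_simps)
        moreover have "norm (1 - \<i> * of_real \<delta> * s) > 0"
          using ge1[of s] 2 by linarith
        ultimately show ?thesis
          unfolding h_def norm_divide by (subst pos_divide_le_eq)
      qed
    qed
    moreover have "norm (1 - \<i> * of_real \<delta> * z) > 0"
      using ge1[OF z] by linarith
    ultimately show ?thesis
      unfolding h_def norm_divide by (subst (asm) pos_divide_le_eq)
  qed
  have "((\<lambda>\<delta>::real. M * norm (1 - \<i> * of_real \<delta> * z)) \<longlongrightarrow> M * norm (1 - \<i> * of_real 0 * z)) (at_right 0)"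
    by (intro tendsto_intros)
  moreover have "eventually (\<lambda>\<delta>::real. norm (f z) \<le> M * norm (1 - \<i> * of_real \<delta> * z)) (at_right 0)"
    using bound by (auto intro: eventually_mono[OF eventually_at_right_less])
  ultimately have "norm (f z) \<le> M * norm (1 - \<i> * of_real 0 * z)"
    by (intro tendsto_lowerbound) auto
  then show ?thesis by simp
qed

text \<open>
  Multiplication by \<open>exp (i (\<tau> + \<epsilon>) z)\<close> leaves the modulus on the real axis unchanged and makes the
  function bounded on the positive imaginary axis, so both quadrants give some bound in the upper
  half plane; the half-plane principle then improves it to the bound on the real axis.
\<close>
lemma exp_type_bounded_upper:
  assumes hol: "f holomorphic_on UNIV" and type: "exp_type_at_most \<tau> f" and "0 \<le> \<tau>"
    and real: "\<And>x::real. norm (f (of_real x)) \<le> M" and "0 < M"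
    and z: "0 \<le> Im z"
  shows "norm (f z) \<le> M * exp (\<tau> * Im z)"
proof -
  have bound: "norm (f z) \<le> M * exp ((\<tau> + \<epsilon>) * Im z)" if \<epsilon>: "\<epsilon> > 0" for \<epsilon>
  proof -
    from type \<epsilon> obtain C where C: "C > 0" "\<And>z. norm (f z) \<le> C * exp ((\<tau> + \<epsilon>) * norm z)"
      unfolding exp_type_at_most_def by blast
    define g where "g = (\<lambda>z. f z * exp (\<i> * of_real (\<tau> + \<epsilon>) * z))"
    have ng: "norm (g z) = norm (f z) * exp (- ((\<tau> + \<epsilon>) * Im z))" for z
      by (simp add: g_def norm_mult algebra_simps)
    have holg: "g holomorphic_on UNIV"
      unfolding g_def by (intro holomorphic_intros hol)
    have holg': "(\<lambda>z. g (\<i> * z)) holomorphic_on UNIV"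
      by (intro holomorphic_on_compose_gen[OF _ holg, unfolded o_def] holomorphic_intros) auto
    define B where "B = max M C"
    \<comment> \<open>A crude growth bound of order 1 is all that the quadrant principle asks for.\<close>
    have growth: "norm (g z) \<le> C * exp (2 * (\<tau> + \<epsilon>) * norm z)" for z
    proof -
      have "norm (g z) \<le> (C * exp ((\<tau> + \<epsilon>) * norm z)) * exp ((\<tau> + \<epsilon>) * norm z)"
        unfolding ng using C \<epsilon> \<open>0 \<le> \<tau>\<close> abs_Im_le_cmod[of z]
          mult_left_mono[of "- Im z" "norm z" "\<tau> + \<epsilon>"]
        by (intro mult_mono) auto
      then show ?thesis by (simp add: mult_exp_exp algebra_simps)
    qed
    have gr: "norm (g (of_real x)) \<le> M" for x :: real
      using real[of x] by (simp add: ng)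
    have gi: "norm (g (\<i> * of_real t)) \<le> C" if "t \<ge> 0" for t
    proof -
      have "norm (g (\<i> * of_real t)) \<le> C * exp ((\<tau> + \<epsilon>) * t) * exp (- ((\<tau> + \<epsilon>) * t))"
        using C(2)[of "\<i> * of_real t"] that by (simp add: ng norm_mult)
      also have "\<dots> = C" by (simp add: exp_minus)
      finally show ?thesis .
    qed
    have "norm (g z) \<le> B" if "Im z \<ge> 0" for z
    proof (cases "Re z \<ge> 0")
      case True
      show ?thesis
        by (rule quadrant_phragmen_lindelof[OF holg growth])
          (use True that gr gi \<epsilon> \<open>0 < M\<close> \<open>0 \<le> \<tau>\<close> in \<open>auto simp: B_def le_max_iff_disj\<close>)
    next
      case False
      have "norm (g (\<i> * (- \<i> * z))) \<le> B"
      proof (rule quadrant_phragmen_lindelof[OF holg', where z = "- \<i> * z"])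
        show "norm (g (\<i> * z)) \<le> C * exp (2 * (\<tau> + \<epsilon>) * norm z)" for z
          using growth[of "\<i> * z"] by (simp add: norm_mult)
        show "norm (g (\<i> * (\<i> * complex_of_real t))) \<le> B" for t
          using gr[of "-t"] by (simp add: B_def flip: mult.assoc)
      qed (use False that gr gi \<epsilon> \<open>0 < M\<close> \<open>0 \<le> \<tau>\<close> in \<open>auto simp: B_def le_max_iff_disj\<close>)
      then show ?thesis by (simp flip: mult.assoc)
    qed
    then have "norm (g z) \<le> M"
      by (rule half_plane_phragmen_lindelof[OF holg _ gr \<open>0 < M\<close> z])
    then have "norm (f z) \<le> M / exp (- ((\<tau> + \<epsilon>) * Im z))"
      unfolding ng by (subst pos_le_divide_eq) auto
    then show ?thesis by (simp only: exp_minus divide_inverse inverse_inverse_eq)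
  qed
  have "((\<lambda>\<epsilon>. M * exp ((\<tau> + \<epsilon>) * Im z)) \<longlongrightarrow> M * exp ((\<tau> + 0) * Im z)) (at_right 0)"
    by (intro tendsto_intros)
  moreover have "eventually (\<lambda>\<epsilon>. norm (f z) \<le> M * exp ((\<tau> + \<epsilon>) * Im z)) (at_right 0)"
    using bound by (auto intro: eventually_mono[OF eventually_at_right_less])
  ultimately have "norm (f z) \<le> M * exp ((\<tau> + 0) * Im z)"
    by (intro tendsto_lowerbound) auto
  then show ?thesis by simp
qed

theorem exp_type_bounded_on_reals:
  assumes hol: "f holomorphic_on UNIV" and type: "exp_type_at_most \<tau> f" and "0 \<le> \<tau>"
    and real: "\<And>x::real. norm (f (of_real x)) \<le> M" and "0 < M"
  shows "norm (f z) \<le> M * exp (\<tau> * \<bar>Im z\<bar>)"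
proof (cases "Im z \<ge> 0")
  case True
  then show ?thesis using exp_type_bounded_upper[OF assms] by simp
next
  case False
  have "norm (f (- (- z))) \<le> M * exp (\<tau> * Im (- z))"
  proof (rule exp_type_bounded_upper)
    show "(\<lambda>z. f (- z)) holomorphic_on UNIV"
      by (intro holomorphic_on_compose_gen[OF _ hol, unfolded o_def] holomorphic_intros) auto
    show "exp_type_at_most \<tau> (\<lambda>z. f (- z))"
      using type unfolding exp_type_at_most_def by (metis norm_minus_cancel)
    show "norm (f (- of_real x)) \<le> M" for x :: real
      using real[of "-x"] by simp
  qed (use assms False in auto)
  then show ?thesis using False by simp
qed

section \<open>The normalised sinc function\<close>

lemma sin_pi_eq_0_imp_int:
  fixes z :: complex
  assumes "sin (of_real pi * z) = 0"
  shows "\<exists>n. z = of_int n"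
proof -
  obtain n :: int where "of_real pi * z = of_real (of_int n * pi)"
    using assms by (auto simp: sin_eq_0)
  then have "z = of_int n" by (simp add: field_simps)
  then show ?thesis ..
qed

lemma sin_pi_shift_squared:
  fixes z :: complex
  shows "(sin (of_real pi * (z - of_int n)))\<^sup>2 = (sin (of_real pi * z))\<^sup>2"
proof -
  have "sin (of_real pi * (z - of_int n)) = sin (of_real pi * z - of_int n * of_real pi)"
    by (simp add: algebra_simps)
  also have "\<dots> = sin (of_real pi * z) * cos (of_int n * of_real pi)"
    using sin_eq_0[of "of_int n * of_real pi"] by (auto simp: sin_diff)
  finally have "(sin (of_real pi * (z - of_int n)))\<^sup>2
      = (sin (of_real pi * z))\<^sup>2 * (cos (of_int n * of_real pi))\<^sup>2"
    by (simp add: power_mult_distrib)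
  moreover have "(cos (of_int n * of_real pi :: complex))\<^sup>2 = 1"
    using sin_eq_0[of "of_int n * of_real pi"] by (auto simp: cos_squared_eq)
  ultimately show ?thesis by simp
qed

lemma norm_sin_pi_le: "norm (sin (of_real pi * z)) \<le> exp (pi * \<bar>Im z\<bar>)"
  using cmod_sin_le_exp[of 1 "of_real pi * z"] by (simp add: abs_mult)

lemma norm_sin_pi_ge:
  assumes "1 \<le> \<bar>Im z\<bar> \<or> cos (2 * pi * Re z) = -1"
  shows "exp (2 * pi * \<bar>Im z\<bar>) / 8 \<le> (norm (sin (of_real pi * z)))\<^sup>2"
proof -
  define y where "y = 2 * pi * Im z"
  have eq: "(norm (sin (of_real pi * z)))\<^sup>2 = (exp y + exp (- y) - 2 * cos (2 * pi * Re z)) / 4"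
    by (simp add: norm_sin_squared y_def exp_minus mult_ac)
  have sum: "exp y + exp (- y) \<ge> exp \<bar>y\<bar>"
    by (cases "y \<ge> 0") auto
  have "exp \<bar>y\<bar> / 8 \<le> (exp y + exp (- y) - 2 * cos (2 * pi * Re z)) / 4"
    using assms
  proof
    assume "1 \<le> \<bar>Im z\<bar>"
    then have "\<bar>y\<bar> \<ge> 2 * pi * 1"
      by (simp add: y_def abs_mult)
    then have "\<bar>y\<bar> \<ge> 4"
      using pi_gt3 by linarith
    then have "exp \<bar>y\<bar> \<ge> 4" using exp_ge_add_one_self[of "\<bar>y\<bar>"] by linarith
    then show ?thesis using sum cos_le_one[of "2 * pi * Re z"]
      by (simp add: divide_simps del: cos_le_one abs_le_iff)
  next
    assume "cos (2 * pi * Re z) = -1"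
    then show ?thesis using sum exp_gt_zero[of "\<bar>y\<bar>"]
      by (simp add: divide_simps del: abs_le_iff exp_gt_zero)
  qed
  then show ?thesis by (simp add: eq y_def abs_mult)
qed

text \<open>
  Normalised so that the zeros are the nonzero integers.
\<close>
definition csinc :: "complex \<Rightarrow> complex" where
  "csinc z = (if z = 0 then 1 else sin (of_real pi * z) / (of_real pi * z))"

lemma csinc_0 [simp]: "csinc 0 = 1"
  by (simp add: csinc_def)

lemma sin_pi_eq_csinc: "sin (of_real pi * z) = of_real pi * z * csinc z"
  by (simp add: csinc_def)

lemma csinc_of_int: "n \<noteq> 0 \<Longrightarrow> csinc (of_int n) = 0"
  using sin_eq_0[of "of_real pi * of_int n"] by (auto simp: csinc_def)

lemma csinc_nonzero:
  assumes "z \<in> ball 0 1"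
  shows "csinc z \<noteq> 0"
proof
  assume "csinc z = 0"
  then have "sin (of_real pi * z) = 0" "z \<noteq> 0" by (auto simp: sin_pi_eq_csinc)
  then obtain n where z: "z = of_int n" using sin_pi_eq_0_imp_int by blast
  then have "\<bar>real_of_int n\<bar> < 1" using assms by simp
  then have "n = 0" by linarith
  with z \<open>z \<noteq> 0\<close> show False by simp
qed

lemma csinc_minus: "csinc (- z) = csinc z"
  by (simp add: csinc_def)

lemma holomorphic_csinc: "csinc holomorphic_on UNIV"
proof -
  let ?f = "\<lambda>z::complex. sin (of_real pi * z) / of_real pi"
  have "(?f has_field_derivative 1) (at 0)"
    by (auto intro!: derivative_eq_intros)
  then have "deriv ?f 0 = 1" by (rule DERIV_imp_deriv)
  then have "csinc = (\<lambda>z. if z = 0 then deriv ?f 0 else (?f z - ?f 0) / (z - 0))"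
    by (auto simp: csinc_def fun_eq_iff)
  moreover have "(\<lambda>z. if z = 0 then deriv ?f 0 else (?f z - ?f 0) / (z - 0)) holomorphic_on UNIV"
    by (intro pole_lemma_open holomorphic_intros) auto
  ultimately show ?thesis by simp
qed

lemma holomorphic_csinc' [holomorphic_intros]:
  "g holomorphic_on S \<Longrightarrow> (\<lambda>z. csinc (g z)) holomorphic_on S"
  using holomorphic_on_compose_gen[OF _ holomorphic_csinc, of g S] by (simp add: o_def)

lemma DERIV_csinc_0: "(csinc has_field_derivative 0) (at 0)"
proof -
  have D: "(csinc has_field_derivative deriv csinc z) (at z)" for z
    by (rule holomorphic_derivI[OF holomorphic_csinc]) auto
  have "((\<lambda>z. csinc (- z)) has_field_derivative deriv csinc 0 * (-1)) (at 0)"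
    by (rule DERIV_chain2[of csinc]) (auto intro!: derivative_eq_intros D)
  then have "(csinc has_field_derivative - deriv csinc 0) (at 0)"
    by (simp add: csinc_minus)
  with D[of 0] have "deriv csinc 0 = - deriv csinc 0"
    by (rule DERIV_unique)
  then have "deriv csinc 0 = 0" by simp
  with D[of 0] show ?thesis by simp
qed

lemma csinc_bound:
  obtains C where "C > 0" "\<And>z. norm (csinc z) \<le> C * exp (pi * \<bar>Im z\<bar>)"
proof -
  have "compact (csinc ` cball 0 1)"
    by (intro compact_continuous_image holomorphic_on_imp_continuous_on
        holomorphic_on_subset[OF holomorphic_csinc]) auto
  then obtain C where C: "\<And>z. norm z \<le> 1 \<Longrightarrow> norm (csinc z) \<le> C"
    by (metis bounded_iff compact_imp_bounded image_eqI mem_cball_0)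
  define K where "K = max C 1"
  have "norm (csinc z) \<le> K * exp (pi * \<bar>Im z\<bar>)" for z
  proof (cases "norm z \<le> 1")
    case True
    have "norm (csinc z) \<le> K * 1" using C[OF True] by (simp add: K_def)
    also have "\<dots> \<le> K * exp (pi * \<bar>Im z\<bar>)" by (intro mult_left_mono) (auto simp: K_def)
    finally show ?thesis .
  next
    case False
    have "norm (csinc z) * 1 \<le> norm (csinc z) * norm (of_real pi * z)"
      using False pi_gt3 mult_mono[of 1 pi 1 "norm z"] by (intro mult_left_mono) (auto simp: norm_mult)
    also have "\<dots> = norm (sin (of_real pi * z))"
      by (subst sin_pi_eq_csinc) (simp add: norm_mult mult.commute)
    also have "\<dots> \<le> 1 * exp (pi * \<bar>Im z\<bar>)" using norm_sin_pi_le by simp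
    also have "\<dots> \<le> K * exp (pi * \<bar>Im z\<bar>)" by (intro mult_right_mono) (auto simp: K_def)
    finally show ?thesis by simp
  qed
  then show ?thesis by (intro that[of K]) (auto simp: K_def)
qed

section \<open>Primitives and limits along horizontal lines\<close>

text \<open>
  The primitive that vanishes at 0 has the same exponential type, because \<open>|P(z)| \<le> |z| max |F|\<close> and a
  factor \<open>|z|\<close> is absorbed by the \<open>\<epsilon>\<close> in the definition of the type.  On the real line it is bounded
  by the integral of \<open>|F|\<close>, so Phragmen-Lindelof applies to it.
\<close>
lemma integrable_exp_type_primitive:
  fixes F :: "complex \<Rightarrow> complex"
  assumes hol: "F holomorphic_on UNIV" and type: "exp_type_at_most \<tau> F" and \<tau>: "0 \<le> \<tau>"
    and int: "integrable lborel (\<lambda>x. F (of_real x))"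
  obtains P C a b where
    "\<And>z. (P has_field_derivative F z) (at z)"
    "C > 0" "\<And>z. norm (P z) \<le> C * exp (\<tau> * \<bar>Im z\<bar>)"
    "((\<lambda>x::real. P (of_real x)) \<longlongrightarrow> a) at_top" "((\<lambda>x::real. P (of_real x)) \<longlongrightarrow> b) at_bot"
    "a - b = (LINT x|lborel. F (of_real x))"
proof -
  obtain P0 where P0: "\<And>z. (P0 has_field_derivative F z) (at z)"
    using holomorphic_convex_primitive'[OF _ _ hol] by auto
  define P where "P = (\<lambda>z. P0 z - P0 0)"
  have P: "(P has_field_derivative F z) (at z)" for z
    unfolding P_def using P0[of z] by (auto intro!: derivative_eq_intros)
  have [simp]: "P 0 = 0" by (simp add: P_def)
  have holP: "P holomorphic_on UNIV"
    using P by (auto simp: holomorphic_on_def field_differentiable_def)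
  have typeP: "exp_type_at_most \<tau> P"
    unfolding exp_type_at_most_def
  proof (intro allI impI)
    fix \<epsilon> :: real assume "\<epsilon> > 0"
    then have "\<epsilon> / 2 > 0" by simp
    with type obtain C where C: "C > 0" "\<And>z. norm (F z) \<le> C * exp ((\<tau> + \<epsilon> / 2) * norm z)"
      unfolding exp_type_at_most_def by blast
    have "norm (P z) \<le> (C * 2 / \<epsilon>) * exp ((\<tau> + \<epsilon>) * norm z)" for z
    proof -
      have "norm (P z - P 0) \<le> (C * exp ((\<tau> + \<epsilon> / 2) * norm z)) * norm (z - 0)"
      proof (rule field_differentiable_bound[where S = "cball 0 (norm z)"])
        show "(P has_field_derivative F w) (at w within cball 0 (norm z))" for w
          using P by (rule has_field_derivative_at_within)
        fix w :: complex assume "w \<in> cball 0 (norm z)"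
        then have "C * exp ((\<tau> + \<epsilon> / 2) * norm w) \<le> C * exp ((\<tau> + \<epsilon> / 2) * norm z)"
          using C \<tau> \<open>\<epsilon> > 0\<close> by (auto intro!: mult_left_mono)
        with C(2)[of w] show "norm (F w) \<le> C * exp ((\<tau> + \<epsilon> / 2) * norm z)" by linarith
      qed auto
      also have "\<dots> \<le> (C * exp ((\<tau> + \<epsilon> / 2) * norm z)) * (2 / \<epsilon> * exp (\<epsilon> / 2 * norm z))"
      proof (intro mult_left_mono)
        have "\<epsilon> / 2 * norm z \<le> exp (\<epsilon> / 2 * norm z)"
          using exp_ge_add_one_self[of "\<epsilon> / 2 * norm z"] by linarith
        then show "norm (z - 0) \<le> 2 / \<epsilon> * exp (\<epsilon> / 2 * norm z)"
          using \<open>\<epsilon> > 0\<close> by (simp add: field_simps)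
      qed (use C in auto)
      also have "\<dots> = (C * 2 / \<epsilon>) * (exp ((\<tau> + \<epsilon> / 2) * norm z) * exp (\<epsilon> / 2 * norm z))"
        by simp
      also have "exp ((\<tau> + \<epsilon> / 2) * norm z) * exp (\<epsilon> / 2 * norm z) = exp ((\<tau> + \<epsilon>) * norm z)"
        by (simp add: mult_exp_exp algebra_simps)
      finally show ?thesis by simp
    qed
    with C \<open>\<epsilon> > 0\<close> show "\<exists>C>0. \<forall>z. norm (P z) \<le> C * exp ((\<tau> + \<epsilon>) * norm z)"
      by (intro exI[of _ "C * 2 / \<epsilon>"]) auto
  qed
  let ?f = "\<lambda>x::real. F (of_real x)"
  have contF: "continuous_on A ?f" for A
    by (intro continuous_on_compose2[OF holomorphic_on_imp_continuous_on[OF hol]] continuous_intros) auto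
  have FTC: "(LINT x:{u..v}|lborel. ?f x) = P (of_real v) - P (of_real u)" if "u \<le> v" for u v
    unfolding set_lebesgue_integral_def
  proof (rule integral_FTC_atLeastAtMost[OF that _ contF])
    show "((\<lambda>x. P (of_real x)) has_vector_derivative ?f x) (at x within {u..v})" for x
      using has_vector_derivative_real_field[OF P[of "of_real x"]] by (simp add: has_vector_derivative_at_within)
  qed
  have sint: "set_integrable lborel A ?f" if "A \<in> sets lborel" for A
    unfolding set_integrable_def by (rule integrable_mult_indicator[OF that int])
  define M where "M = (LINT x|lborel. norm (?f x)) + 1"
  have "(LINT x|lborel. norm (?f x)) \<ge> 0" by (rule integral_nonneg_AE) auto
  then have M: "M > 0" unfolding M_def by linarith
  have sle: "norm (LINT x:A|lborel. ?f x) \<le> M" if "A \<in> sets lborel" for A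
  proof -
    have "norm (LINT x:A|lborel. ?f x) \<le> (LINT x|lborel. norm (indicator A x *\<^sub>R ?f x))"
      unfolding set_lebesgue_integral_def by (rule integral_norm_bound)
    also have "\<dots> \<le> (LINT x|lborel. norm (?f x))"
      using sint[OF that] unfolding set_integrable_def
      by (intro integral_mono integrable_norm int) (auto simp: indicator_def)
    finally show ?thesis by (simp add: M_def)
  qed
  have real: "norm (P (of_real x)) \<le> M" for x :: real
  proof (cases "x \<ge> 0")
    case True
    then show ?thesis using sle[of "{0..x}"] by (simp add: FTC)
  next
    case False
    then show ?thesis using sle[of "{x..0}"] by (simp add: FTC)
  qed
  \<comment> \<open>The limits of the primitive at the two ends; \<open>P(0) = 0\<close> fixes the sign of the second.\<close>
  define a where "a = (LINT x:{0..}|lborel. ?f x)"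
  define b where "b = - (LINT x:{..0}|lborel. ?f x)"
  show ?thesis
  proof (rule that[of P M a b])
    show "norm (P z) \<le> M * exp (\<tau> * \<bar>Im z\<bar>)" for z
      by (rule exp_type_bounded_on_reals[OF holP typeP \<tau> real M])
    have "((\<lambda>x. LINT t:{0..x}|lborel. ?f t) \<longlongrightarrow> a) at_top"
      unfolding a_def by (rule tendsto_set_lebesgue_integral_at_top) (auto intro: sint)
    then show "((\<lambda>x::real. P (of_real x)) \<longlongrightarrow> a) at_top"
      by (rule Lim_transform_eventually)
        (rule eventually_mono[OF eventually_ge_at_top[of 0]], simp add: FTC)
    have "((\<lambda>x. - (LINT t:{x..0}|lborel. ?f t)) \<longlongrightarrow> b) at_bot"
      unfolding b_def by (intro tendsto_minus tendsto_set_lebesgue_integral_at_bot) (auto intro: sint)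
    then show "((\<lambda>x::real. P (of_real x)) \<longlongrightarrow> b) at_bot"
      by (rule Lim_transform_eventually)
        (rule eventually_mono[OF eventually_le_at_bot[of 0]], simp add: FTC)
    have "(LINT x|lborel. ?f x) = (LINT x:{0..} \<union> {..<0}|lborel. ?f x)"
    proof -
      have "{0..} \<union> {..<0} = (UNIV :: real set)" by auto
      then show ?thesis by (simp only: set_lebesgue_integral_def) simp
    qed
    also have "\<dots> = a + (LINT x:{..<0}|lborel. ?f x)"
      unfolding a_def by (rule set_integral_Un) (auto intro: sint)
    also have "(LINT x:{..<0}|lborel. ?f x) = (LINT x:{..0}|lborel. ?f x)"
    proof (rule set_integral_cong_set)
      have "set_borel_measurable lborel A ?f" if "A \<in> sets lborel" for A
        using sint[OF that] unfolding set_borel_measurable_def set_integrable_def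
        by (rule borel_measurable_integrable)
      then show "set_borel_measurable lborel {..0} ?f" "set_borel_measurable lborel {..<0} ?f"
        by auto
      show "AE x in lborel. (x \<in> {..0::real}) = (x \<in> {..<0})"
        using AE_lborel_singleton[of "0::real"] by (auto elim!: eventually_mono)
    qed
    finally show "a - b = (LINT x|lborel. ?f x)" by (simp add: b_def)
  qed (use P M in auto)
qed

text \<open>
  Cauchy's inequality on discs of radius 1.
\<close>
lemma bounded_primitive_imp_bounded:
  assumes P: "\<And>z. (P has_field_derivative F z) (at z)"
    and bnd: "\<And>z. norm (P z) \<le> C * exp (\<tau> * \<bar>Im z\<bar>)" and "0 \<le> \<tau>" "0 \<le> C"
  shows "norm (F z) \<le> C * exp \<tau> * exp (\<tau> * \<bar>Im z\<bar>)"
proof -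
  have holP: "P holomorphic_on UNIV"
    using P by (auto simp: holomorphic_on_def field_differentiable_def)
  have "norm ((deriv ^^ 1) P z) \<le> fact 1 * (C * exp (\<tau> * (\<bar>Im z\<bar> + 1))) / 1 ^ 1"
  proof (rule Cauchy_inequality)
    show "P holomorphic_on ball z 1" "continuous_on (cball z 1) P"
      using holP by (auto intro: holomorphic_on_subset holomorphic_on_imp_continuous_on)
    fix w assume "norm (z - w) = 1"
    then have "\<bar>Im w\<bar> \<le> \<bar>Im z\<bar> + 1" using abs_Im_le_cmod[of "z - w"] by simp
    then have "C * exp (\<tau> * \<bar>Im w\<bar>) \<le> C * exp (\<tau> * (\<bar>Im z\<bar> + 1))"
      using assms by (auto intro!: mult_left_mono)
    with bnd[of w] show "norm (P w) \<le> C * exp (\<tau> * (\<bar>Im z\<bar> + 1))" by linarith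
  qed auto
  then show ?thesis
    using DERIV_imp_deriv[OF P[of z]] by (simp add: algebra_simps exp_add)
qed

text \<open>
  A normal families argument: if the claim failed along a subsequence of translates, Montel's theorem
  would give a locally uniform limit of a further subsequence; this limit is entire and equals \<open>l\<close> on the
  real line, so it is constant.
\<close>
lemma tendsto_along_horizontal_line:
  assumes hol: "f holomorphic_on UNIV"
    and bnd: "\<And>z. norm (f z) \<le> C * exp (\<tau> * \<bar>Im z\<bar>)" and "0 \<le> \<tau>" "0 \<le> C"
    and lim: "((\<lambda>x::real. f (of_real x)) \<longlongrightarrow> l) at_top"
  shows "(\<lambda>n. f (of_nat n + z)) \<longlonglongrightarrow> l"
proof (rule ccontr)
  assume "\<not> ?thesis"
  then obtain e where e: "e > 0" "\<not> (\<forall>\<^sub>F n in sequentially. dist (f (of_nat n + z)) l < e)"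
    by (auto simp: tendsto_iff)
  then have "infinite {n. dist (f (of_nat n + z)) l \<ge> e}"
    unfolding eventually_sequentially infinite_nat_iff_unbounded_le
    by (auto simp: not_less)
  then obtain r :: "nat \<Rightarrow> nat" where r: "strict_mono r" "\<And>n. dist (f (of_nat (r n) + z)) l \<ge> e"
    using infinite_enumerate by blast
  define \<F> where "\<F> = (\<lambda>n w. f (of_nat (r n) + w))"
  have hol\<F>: "\<F> n holomorphic_on UNIV" for n
    unfolding \<F>_def
    by (intro holomorphic_on_compose_gen[OF _ hol, unfolded o_def] holomorphic_intros) auto
  obtain g s where g: "g holomorphic_on UNIV" and s: "strict_mono s"
    and conv: "\<And>w. (\<lambda>n. \<F> (s n) w) \<longlonglongrightarrow> g w"
  proof (rule Montel[of UNIV "range \<F>" \<F>])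
    fix K :: "complex set" assume "compact K"
    then obtain B where B: "\<And>w. w \<in> K \<Longrightarrow> norm w \<le> B"
      using compact_imp_bounded bounded_iff by metis
    show "\<exists>B. \<forall>h\<in>range \<F>. \<forall>w\<in>K. norm (h w) \<le> B"
    proof (intro exI ballI)
      fix h w assume "h \<in> range \<F>" "w \<in> K"
      then obtain n where h: "h = \<F> n" by auto
      have "\<bar>Im w\<bar> \<le> B" using B[OF \<open>w \<in> K\<close>] abs_Im_le_cmod[of w] by linarith
      then have "C * exp (\<tau> * \<bar>Im w\<bar>) \<le> C * exp (\<tau> * B)"
        using assms by (auto intro!: mult_left_mono)
      then show "norm (h w) \<le> C * exp (\<tau> * B)"
        using bnd[of "of_nat (r n) + w"] by (simp add: h \<F>_def)
    qed
  qed (use hol\<F> in auto)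
  have "g w - l = 0" for w
  proof (rule analytic_continuation[of "\<lambda>w. g w - l" UNIV "range of_real" 0])
    show "(\<lambda>w. g w - l) holomorphic_on UNIV" using g by (intro holomorphic_intros)
    show "(0::complex) islimpt range of_real"
    proof (unfold islimpt_approachable, intro allI impI)
      fix e :: real assume "e > 0"
      then show "\<exists>x'\<in>range of_real. x' \<noteq> (0::complex) \<and> dist x' 0 < e"
        by (intro bexI[OF _ rangeI[of of_real "e / 2"]]) auto
    qed
    fix w :: complex assume "w \<in> range of_real"
    then obtain x where w: "w = of_real x" by auto
    have "filterlim (\<lambda>n. real (r (s n)) + x) at_top sequentially"
    proof -
      have "strict_mono (r \<circ> s)" using r s by (simp add: strict_mono_o)
      then have "filterlim (\<lambda>n. (r \<circ> s) n) at_top sequentially"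
        by (rule filterlim_subseq)
      then have "filterlim (\<lambda>n. real (r (s n))) at_top sequentially"
        by (intro filterlim_compose[OF filterlim_real_sequentially]) (simp add: o_def)
      then have "filterlim (\<lambda>n. x + real (r (s n))) at_top sequentially"
        by (rule filterlim_tendsto_add_at_top[OF tendsto_const])
      then show ?thesis by (simp add: add.commute)
    qed
    from filterlim_compose[OF lim this] have "(\<lambda>n. \<F> (s n) w) \<longlonglongrightarrow> l"
      by (simp add: \<F>_def w)
    with conv[of w] show "g w - l = 0" using LIMSEQ_unique by fastforce
  qed auto
  then have "(\<lambda>n. \<F> (s n) z) \<longlonglongrightarrow> l" using conv[of z] by simp
  then have "\<forall>\<^sub>F n in sequentially. dist (\<F> (s n) z) l < e"
    using e(1) by (rule tendstoD)
  then obtain n where "dist (\<F> (s n) z) l < e" by (auto simp: eventually_sequentially)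
  with r(2)[of "s n"] show False by (simp add: \<F>_def)
qed

section \<open>Residues at the integers\<close>

lemma integrable_inverse_1_plus_square_lborel:
  "integrable lborel (\<lambda>x::real. inverse (1 + x\<^sup>2))"
  using integrable_inverse_1_plus_square by (simp add: set_integrable_def)

lemma integrable_exp_neg_abs:
  fixes a :: real
  assumes "a > 0"
  shows "integrable lborel (\<lambda>x. exp (- a * \<bar>x\<bar>))"
proof (rule Bochner_Integration.integrable_bound)
  show "integrable lborel (\<lambda>x. (1 + 2 / a\<^sup>2) * inverse (1 + x\<^sup>2))"
    by (intro integrable_mult_right integrable_inverse_1_plus_square_lborel)
  show "AE x in lborel. norm (exp (- a * \<bar>x\<bar>)) \<le> norm ((1 + 2 / a\<^sup>2) * inverse (1 + x\<^sup>2))"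
  proof (rule AE_I2)
    fix x :: real
    have "1 + a * \<bar>x\<bar> + (a * \<bar>x\<bar>)\<^sup>2 / 2 \<le> exp (a * \<bar>x\<bar>)"
      using assms by (intro exp_lower_Taylor_quadratic) auto
    then have le: "1 + a\<^sup>2 * x\<^sup>2 / 2 \<le> exp (a * \<bar>x\<bar>)"
      using assms by (simp add: power_mult_distrib) (smt (verit) mult_nonneg_nonneg)
    have pos: "1 + a\<^sup>2 * x\<^sup>2 / 2 > 0" by (simp add: add_pos_nonneg)
    have "(1 + x\<^sup>2) \<le> (1 + 2 / a\<^sup>2) * (1 + a\<^sup>2 * x\<^sup>2 / 2)"
      using assms by (simp add: field_simps)
    then have "inverse (1 + a\<^sup>2 * x\<^sup>2 / 2) \<le> (1 + 2 / a\<^sup>2) * inverse (1 + x\<^sup>2)"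
      using pos by (simp add: divide_simps add_pos_nonneg split: if_splits)
    moreover have "exp (- a * \<bar>x\<bar>) \<le> inverse (1 + a\<^sup>2 * x\<^sup>2 / 2)"
      using le pos by (simp add: exp_minus le_imp_inverse_le)
    ultimately show "norm (exp (- a * \<bar>x\<bar>)) \<le> norm ((1 + 2 / a\<^sup>2) * inverse (1 + x\<^sup>2))"
      by simp
  qed
qed auto

text \<open>
  Near \<open>n\<close> the function is \<open>f(w) / csinc (w - n)\<^sup>2\<close> over \<open>(w - n)\<^sup>2\<close>.  The residue at this double pole
  is the derivative of the numerator, and \<open>csinc\<close> contributes nothing because its derivative vanishes at 0.
\<close>
lemma residue_over_sin_squared:
  assumes hol: "f holomorphic_on UNIV"
  shows "residue (\<lambda>w. f w * (of_real pi / sin (of_real pi * w))\<^sup>2) (of_int n) = deriv f (of_int n)"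
proof -
  define A where "A = {w. csinc (w - of_int n) \<noteq> 0}"
  define g where "g = (\<lambda>w. f w / (csinc (w - of_int n))\<^sup>2)"
  have "open A"
    unfolding A_def
    by (intro open_Collect_neq continuous_on_compose2[OF holomorphic_on_imp_continuous_on[OF holomorphic_csinc]] continuous_intros) auto
  have holg: "g holomorphic_on A"
    unfolding g_def by (intro holomorphic_intros holomorphic_on_subset[OF hol]) (auto simp: A_def)
  have "(of_real pi / sin (of_real pi * w))\<^sup>2 = 1 / ((csinc (w - of_int n))\<^sup>2 * (w - of_int n)\<^sup>2)" for w
  proof -
    have "(sin (of_real pi * w))\<^sup>2 = (of_real pi * (w - of_int n) * csinc (w - of_int n))\<^sup>2"
      by (metis sin_pi_shift_squared sin_pi_eq_csinc)
    then show ?thesis by (simp add: power_divide power_mult_distrib mult_ac)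
  qed
  then have eq: "(\<lambda>w. f w * (of_real pi / sin (of_real pi * w))\<^sup>2) = (\<lambda>w. g w / (w - of_int n) ^ Suc 1)"
    by (simp add: g_def fun_eq_iff power2_eq_square)
  have "residue (\<lambda>w. g w / (w - of_int n) ^ Suc 1) (of_int n) = (deriv ^^ 1) g (of_int n) / fact 1"
    by (rule residue_holomorphic_over_power[OF \<open>open A\<close> _ holg]) (simp add: A_def)
  moreover have "deriv g (of_int n) = deriv f (of_int n)"
  proof (rule DERIV_imp_deriv)
    have "(f has_field_derivative deriv f (of_int n)) (at (of_int n))"
      by (rule holomorphic_derivI[OF hol]) auto
    moreover have "((\<lambda>w. csinc (w - of_int n)) has_field_derivative 0 * 1) (at (of_int n))"
      by (rule DERIV_chain2[of csinc]) (auto intro!: derivative_eq_intros DERIV_csinc_0)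
    ultimately show "(g has_field_derivative deriv f (of_int n)) (at (of_int n))"
      unfolding g_def by (auto intro!: derivative_eq_intros)
  qed
  ultimately show ?thesis unfolding eq by simp
qed

lemma sin_pi_half_integer_squared:
  "(sin (of_real pi * Complex (of_int k + 1 / 2) y))\<^sup>2 = of_real ((cosh (pi * y))\<^sup>2)"
proof -
  have "Complex (of_int k + 1 / 2) y - of_int k = Complex (1 / 2) y"
    by (simp add: complex_eq_iff)
  then have "(sin (of_real pi * Complex (of_int k + 1 / 2) y))\<^sup>2 = (sin (of_real pi * Complex (1 / 2) y))\<^sup>2"
    by (metis sin_pi_shift_squared)
  also have "of_real pi * Complex (1 / 2) y = of_real (pi / 2) + \<i> * of_real (pi * y)"
    by (simp add: complex_eq_iff)
  also have "sin \<dots> = cosh (of_real (pi * y))"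
    by (simp add: sin_add cosh_conv_cos flip: cos_of_real sin_of_real)
  also have "cosh (of_real (pi * y)) = (of_real (cosh (pi * y)) :: complex)"
    by (simp add: cosh_field_def exp_of_real del: of_real_mult flip: of_real_minus)
  finally show ?thesis by simp
qed

lemma inverse_cosh_squared_le: "1 / (cosh (pi * y))\<^sup>2 \<le> 8 * exp (- (2 * pi) * \<bar>y\<bar>)"
proof -
  have "exp (2 * pi * \<bar>y\<bar>) / 8 \<le> (norm (sin (of_real pi * Complex (of_int 0 + 1 / 2) y)))\<^sup>2"
    using norm_sin_pi_ge[of "Complex (of_int 0 + 1 / 2) y"] by simp
  also have "\<dots> = (cosh (pi * y))\<^sup>2"
    unfolding norm_power [symmetric] sin_pi_half_integer_squared norm_of_real by simp
  finally have "exp (2 * pi * \<bar>y\<bar>) / 8 \<le> (cosh (pi * y))\<^sup>2" .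
  moreover have "(cosh (pi * y))\<^sup>2 > 0" by (simp add: cosh_real_pos)
  ultimately show ?thesis
    by (simp add: exp_minus divide_simps mult_ac)
qed

lemma sum_deriv_eq_contour_integral:
  fixes N :: nat
  assumes hol: "f holomorphic_on UNIV" and "T > 0"
  defines "a \<equiv> Complex (- real N - 1 / 2) (- T)" and "b \<equiv> Complex (real N + 1 / 2) T"
  shows "contour_integral (rectpath a b) (\<lambda>w. f w * (of_real pi / sin (of_real pi * w))\<^sup>2)
    = 2 * pi * \<i> * (\<Sum>n=-int N..int N. deriv f (of_int n))"
proof -
  define pts where "pts = (of_int ` {-int N..int N} :: complex set)"
  define S where "S = {z. Re z < real N + 1} \<inter> {z. Re z > - real N - 1}"
  let ?h = "\<lambda>w. f w * (of_real pi / sin (of_real pi * w))\<^sup>2"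
  have S: "open S" "convex S"
    unfolding S_def
    by (intro open_Int open_halfspace_Re_lt open_halfspace_Re_gt convex_Int
          convex_halfspace_Re_lt convex_halfspace_Re_gt)+
  have less: "Re a < Re b" "Im a < Im b"
    using \<open>T > 0\<close> by (auto simp: a_def b_def)
  have cbox: "cbox a b \<subseteq> S"
    by (auto simp: in_cbox_complex_iff a_def b_def S_def)
  have pts_box: "pts \<subseteq> box a b"
    using \<open>T > 0\<close> by (auto simp: pts_def in_box_complex_iff a_def b_def)
  have "contour_integral (rectpath a b) ?h
      = 2 * pi * \<i> * (\<Sum>p\<in>pts. winding_number (rectpath a b) p * residue ?h p)"
  proof (rule Residue_theorem[of S])
    show "connected S" using S by (simp add: convex_connected)
    show "?h holomorphic_on S - pts"
    proof (intro holomorphic_intros holomorphic_on_subset[OF hol])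
      fix z assume z: "z \<in> S - pts"
      show "sin (of_real pi * z) \<noteq> 0"
      proof
        assume "sin (of_real pi * z) = 0"
        then obtain n where "z = of_int n" using sin_pi_eq_0_imp_int by blast
        moreover from this have "n \<in> {-int N..int N}" using z by (auto simp: S_def)
        ultimately show False using z by (auto simp: pts_def)
      qed
    qed auto
    have "path_image (rectpath a b) \<inter> box a b = {}"
      using less by (intro path_image_rectpath_inter_box) auto
    moreover have "path_image (rectpath a b) \<subseteq> cbox a b"
      using less by (intro path_image_rectpath_subset_cbox) auto
    ultimately show "path_image (rectpath a b) \<subseteq> S - pts"
      using cbox pts_box by blast
    show "\<forall>z. z \<notin> S \<longrightarrow> winding_number (rectpath a b) z = 0"
      using less cbox by (auto intro!: winding_number_rectpath_outside)
  qed (use S in \<open>auto simp: pts_def\<close>)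
  also have "(\<Sum>p\<in>pts. winding_number (rectpath a b) p * residue ?h p)
      = (\<Sum>p\<in>pts. residue ?h p)"
    using pts_box by (intro sum.cong) (auto simp: winding_number_rectpath)
  also have "\<dots> = (\<Sum>n=-int N..int N. residue ?h (of_int n))"
    unfolding pts_def by (rule sum.reindex_cong[where l = of_int]) (auto simp: inj_on_def)
  also have "\<dots> = (\<Sum>n=-int N..int N. deriv f (of_int n))"
    by (simp only: residue_over_sin_squared[OF hol])
  finally show ?thesis .
qed

text \<open>
  On the vertical sides, at half-integers, \<open>(sin \<pi>w)\<^sup>2\<close> is the positive function \<open>(cosh \<pi>y)\<^sup>2\<close>; the horizontal sides
  contribute the error term.
\<close>
lemma sum_deriv_eq_vertical_integrals:
  assumes hol: "f holomorphic_on UNIV"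
    and bnd: "\<And>z. norm (f z) \<le> C * exp (\<tau> * \<bar>Im z\<bar>)" and "0 \<le> C" and T: "T \<ge> 1"
  shows "norm (2 * pi * \<i> * (\<Sum>n=-int N..int N. deriv f (of_int n))
      - \<i> * (LINT y:{-T..T}|lborel. of_real (pi\<^sup>2 / (cosh (pi * y))\<^sup>2) *
            (f (Complex (real N + 1 / 2) y) - f (Complex (- real N - 1 / 2) y))))
    \<le> 2 * (8 * pi\<^sup>2 * C * exp (\<tau> * T - 2 * pi * T) * (2 * real N + 1))"
proof -
  define x where "x = real N + 1 / 2"
  define h where "h = (\<lambda>w. f w * (of_real pi / sin (of_real pi * w))\<^sup>2)"
  define a1 where "a1 = Complex (- x) (- T)"
  define a2 where "a2 = Complex x (- T)"
  define a3 where "a3 = Complex x T"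
  define a4 where "a4 = Complex (- x) T"
  define B where "B = 8 * pi\<^sup>2 * C * exp (\<tau> * T - 2 * pi * T)"
  have "B \<ge> 0" using \<open>0 \<le> C\<close> by (simp add: B_def)
  have mx: "- x = real_of_int (- int N - 1) + 1 / 2" and px: "x = real_of_int (int N) + 1 / 2"
    by (simp_all add: x_def)
  have side: "h (Complex u y) = of_real (pi\<^sup>2 / (cosh (pi * y))\<^sup>2) * f (Complex u y)"
    if "u = x \<or> u = - x" for u y
  proof -
    have "\<exists>k. u = of_int k + 1 / 2" using that mx px by metis
    then obtain k where "u = of_int k + 1 / 2" by blast
    then show ?thesis
      using sin_pi_half_integer_squared[of k y] by (simp add: h_def power_divide)
  qed
  have sin_nz: "sin (of_real pi * z) \<noteq> 0" if "\<bar>Im z\<bar> = T \<or> \<bar>Re z\<bar> = x" for z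
  proof -
    have "(norm (sin (of_real pi * z)))\<^sup>2 > 0"
      using that
    proof
      assume "\<bar>Im z\<bar> = T"
      then show ?thesis using T norm_sin_pi_ge[of z]
        by (metis divide_pos_pos exp_gt_zero less_le_trans zero_less_numeral)
    next
      assume "\<bar>Re z\<bar> = x"
      then have "Re z = x \<or> Re z = - x" by linarith
      then have "\<exists>k. Re z = of_int k + 1 / 2" using mx px by metis
      then obtain k where "Re z = of_int k + 1 / 2" by blast
      then have "z = Complex (of_int k + 1 / 2) (Im z)" by (simp add: complex_eq_iff)
      then have "(sin (of_real pi * z))\<^sup>2 = of_real ((cosh (pi * Im z))\<^sup>2)"
        by (metis sin_pi_half_integer_squared)
      then show ?thesis by (auto simp: cosh_real_nonzero)
    qed
    then show ?thesis by auto
  qed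
  have conth: "continuous_on A h" if "\<And>z. z \<in> A \<Longrightarrow> \<bar>Im z\<bar> = T \<or> \<bar>Re z\<bar> = x" for A
    unfolding h_def using sin_nz that
    by (intro continuous_intros holomorphic_on_imp_continuous_on holomorphic_on_subset[OF hol]) auto
  have segs: "\<And>z. z \<in> closed_segment a1 a2 \<Longrightarrow> Im z = - T" "\<And>z. z \<in> closed_segment a3 a4 \<Longrightarrow> Im z = T"
    "\<And>z. z \<in> closed_segment a2 a3 \<Longrightarrow> Re z = x" "\<And>z. z \<in> closed_segment a1 a4 \<Longrightarrow> Re z = - x"
    using T by (auto simp: a1_def a2_def a3_def a4_def closed_segment_same_Re closed_segment_same_Im)
  have seg4: "closed_segment a4 a1 = closed_segment a1 a4" by (rule closed_segment_commute)
  have cont: "continuous_on (closed_segment a1 a2) h" "continuous_on (closed_segment a2 a3) h"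
    "continuous_on (closed_segment a3 a4) h" "continuous_on (closed_segment a4 a1) h"
    using T by (auto intro!: conth dest!: segs simp: seg4 x_def)
  note cint = contour_integrable_continuous_linepath[OF cont(1)] contour_integrable_continuous_linepath[OF cont(2)]
     contour_integrable_continuous_linepath[OF cont(3)] contour_integrable_continuous_linepath[OF cont(4)]
  have "contour_integral (rectpath a1 a3) h = contour_integral (linepath a1 a2) h
      + (contour_integral (linepath a2 a3) h + (contour_integral (linepath a3 a4) h + contour_integral (linepath a4 a1) h))"
  proof -
    have "rectpath a1 a3 = linepath a1 a2 +++ linepath a2 a3 +++ linepath a3 a4 +++ linepath a4 a1"
      by (simp add: rectpath_def Let_def a1_def a2_def a3_def a4_def)
    then show ?thesis
      by (simp add: contour_integral_join cint contour_integrable_joinI)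
  qed
  also have "contour_integral (rectpath a1 a3) h = 2 * pi * \<i> * (\<Sum>n=-int N..int N. deriv f (of_int n))"
    using sum_deriv_eq_contour_integral[OF hol, of T N] T by (simp add: a1_def a3_def h_def x_def)
  finally have total: "2 * pi * \<i> * (\<Sum>n=-int N..int N. deriv f (of_int n))
      = contour_integral (linepath a1 a2) h
      + (contour_integral (linepath a2 a3) h + (contour_integral (linepath a3 a4) h + contour_integral (linepath a4 a1) h))" .

  let ?k = "\<lambda>y. of_real (pi\<^sup>2 / (cosh (pi * y))\<^sup>2) :: complex"
  have contk: "continuous_on {-T..T} (\<lambda>y. ?k y * f (Complex u y))" for u
    by (intro continuous_intros continuous_on_compose2[OF holomorphic_on_imp_continuous_on[OF hol]])
       (auto simp: cosh_real_nonzero)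
  have kint: "set_integrable lborel {-T..T} (\<lambda>y. ?k y * f (Complex u y))" for u
    by (rule borel_integrable_atLeastAtMost'[OF contk])
  have vert: "\<i> * integral {-T..T} (\<lambda>y. h (Complex u y)) = \<i> * (LINT y:{-T..T}|lborel. ?k y * f (Complex u y))"
    if "u = x \<or> u = - x" for u
    by (simp only: side[OF that] set_borel_integral_eq_integral(2)[OF kint])
  have right: "contour_integral (linepath a2 a3) h = \<i> * (LINT y:{-T..T}|lborel. ?k y * f (Complex x y))"
    using contour_integral_linepath_same_Re[of a2 x a3 "-T" T h] T vert[of x] by (simp add: a2_def a3_def)
  have left: "contour_integral (linepath a4 a1) h = - (\<i> * (LINT y:{-T..T}|lborel. ?k y * f (Complex (- x) y)))"
    using contour_integral_linepath_same_Re[of a1 "-x" a4 "-T" T h] T vert[of "-x"]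
      contour_integral_reverse_linepath[OF cont(4)]
    by (simp add: a1_def a4_def)
  have diff: "(LINT y:{-T..T}|lborel. ?k y * (f (Complex x y) - f (Complex (- x) y)))
     = (LINT y:{-T..T}|lborel. ?k y * f (Complex x y)) - (LINT y:{-T..T}|lborel. ?k y * f (Complex (- x) y))"
    by (simp only: right_diff_distrib set_integral_diff(2)[OF kint kint])
  have hB: "norm (h z) \<le> B" if "\<bar>Im z\<bar> = T" for z
  proof -
    have "exp (2 * pi * T) / 8 \<le> (norm (sin (of_real pi * z)))\<^sup>2"
      using norm_sin_pi_ge[of z] that T by auto
    then have "pi\<^sup>2 / (norm (sin (of_real pi * z)))\<^sup>2 \<le> pi\<^sup>2 / (exp (2 * pi * T) / 8)"
      using less_le_trans[of 0 "exp (2 * pi * T) / 8"] by (intro divide_left_mono mult_pos_pos) auto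
    then have "norm ((of_real pi / sin (of_real pi * z))\<^sup>2) \<le> pi\<^sup>2 / (exp (2 * pi * T) / 8)"
      by (simp add: norm_divide norm_power power_divide)
    then have "norm (h z) \<le> (C * exp (\<tau> * T)) * (pi\<^sup>2 / (exp (2 * pi * T) / 8))"
      unfolding h_def norm_mult using bnd[of z] that \<open>0 \<le> C\<close> by (intro mult_mono) auto
    also have "\<dots> = B" by (simp add: B_def exp_diff)
    finally show ?thesis .
  qed
  have bottom: "norm (contour_integral (linepath a1 a2) h) \<le> B * norm (a2 - a1)"
    using T by (intro contour_integral_bound_linepath cint \<open>B \<ge> 0\<close> hB) (auto dest!: segs)
  have top: "norm (contour_integral (linepath a3 a4) h) \<le> B * norm (a4 - a3)"
    using T by (intro contour_integral_bound_linepath cint \<open>B \<ge> 0\<close> hB) (auto dest!: segs)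
  have "a2 - a1 = of_real (2 * x)" "a4 - a3 = - of_real (2 * x)"
    by (simp_all add: a1_def a2_def a3_def a4_def complex_eq_iff)
  then have "norm (a2 - a1) = 2 * x" "norm (a4 - a3) = 2 * x"
    by (simp_all add: x_def del: of_real_mult of_real_add)
  then have "norm (contour_integral (linepath a1 a2) h + contour_integral (linepath a3 a4) h) \<le> 2 * (B * (2 * x))"
    using bottom top norm_triangle_ineq[of "contour_integral (linepath a1 a2) h" "contour_integral (linepath a3 a4) h"]
    by simp
  moreover have "2 * pi * \<i> * (\<Sum>n=-int N..int N. deriv f (of_int n))
      - \<i> * (LINT y:{-T..T}|lborel. ?k y * (f (Complex x y) - f (Complex (- x) y)))
    = contour_integral (linepath a1 a2) h + contour_integral (linepath a3 a4) h"
    unfolding total right left diff by (simp add: algebra_simps)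
  ultimately show ?thesis
    by (simp add: x_def B_def algebra_simps)
qed

text \<open>
  Strict inequality \<open>\<tau> < 2 \<pi>\<close> makes the horizontal sides vanish in the limit and dominates the
  vertical ones.  On the vertical sides \<open>f\<close> tends to its limits at the two ends of the real line, and the weight
  \<open>\<pi>\<^sup>2 / (cosh \<pi>y)\<^sup>2\<close> has total mass \<open>2 \<pi>\<close>.
\<close>
theorem sum_deriv_tendsto:
  assumes hol: "f holomorphic_on UNIV"
    and bnd: "\<And>z. norm (f z) \<le> C * exp (\<tau> * \<bar>Im z\<bar>)" and "0 \<le> C"
    and \<tau>: "0 \<le> \<tau>" "\<tau> < 2 * pi"
    and top: "((\<lambda>x::real. f (of_real x)) \<longlongrightarrow> a) at_top"
    and bot: "((\<lambda>x::real. f (of_real x)) \<longlongrightarrow> b) at_bot"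
  shows "(\<lambda>N::nat. \<Sum>n=-int N..int N. deriv f (of_int n)) \<longlonglongrightarrow> a - b"
proof -
  define k where "k = (\<lambda>y. pi\<^sup>2 / (cosh (pi * y))\<^sup>2)"
  define d where "d = (\<lambda>N y. f (Complex (real N + 1 / 2) y) - f (Complex (- real N - 1 / 2) y))"
  have k0: "k y \<ge> 0" for y by (simp add: k_def)
  \<comment> \<open>The weight decays like \<open>exp (- 2 \<pi> |y|)\<close> while \<open>f\<close> grows at most like \<open>exp (\<tau> |y|)\<close>.\<close>
  have kle: "k y \<le> 8 * pi\<^sup>2 * exp (- (2 * pi) * \<bar>y\<bar>)" for y
    using mult_left_mono[OF inverse_cosh_squared_le, of "pi\<^sup>2" y] by (simp add: k_def mult_ac)
  have contk: "continuous_on A k" for A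
    unfolding k_def by (intro continuous_intros) (auto simp: cosh_real_nonzero)
  have measf: "(\<lambda>y. f (Complex u y)) \<in> borel_measurable borel" for u
    by (intro borel_measurable_continuous_onI continuous_on_compose2[OF holomorphic_on_imp_continuous_on[OF hol]]
        continuous_intros) auto
  have measd: "d N \<in> borel_measurable borel" for N
    unfolding d_def by (intro borel_measurable_diff measf)
  have measdk: "k \<in> borel_measurable borel"
    by (intro borel_measurable_continuous_onI contk)
  have limd: "(\<lambda>N. d N y) \<longlonglongrightarrow> a - b" for y
  proof -
    have "(\<lambda>n. f (of_nat n + Complex (1 / 2) y)) \<longlonglongrightarrow> a"
      by (rule tendsto_along_horizontal_line[OF hol bnd \<tau>(1) \<open>0 \<le> C\<close> top])
    moreover have "(\<lambda>n. f (- (of_nat n + Complex (1 / 2) (- y)))) \<longlonglongrightarrow> b"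
    proof (rule tendsto_along_horizontal_line[where f = "\<lambda>z. f (- z)" and C = C and \<tau> = \<tau>])
      show "(\<lambda>z. f (- z)) holomorphic_on UNIV"
        by (intro holomorphic_on_compose_gen[OF _ hol, unfolded o_def] holomorphic_intros) auto
      show "norm (f (- z)) \<le> C * exp (\<tau> * \<bar>Im z\<bar>)" for z
        using bnd[of "- z"] by simp
      show "((\<lambda>x::real. f (- of_real x)) \<longlongrightarrow> b) at_top"
        using filterlim_compose[OF bot filterlim_uminus_at_bot_at_top] by simp
    qed (use \<tau> \<open>0 \<le> C\<close> in auto)
    ultimately have "(\<lambda>n. f (of_nat n + Complex (1 / 2) y) - f (- (of_nat n + Complex (1 / 2) (- y)))) \<longlonglongrightarrow> a - b"
      by (rule tendsto_diff)
    moreover have "of_nat n + Complex (1 / 2) y = Complex (real n + 1 / 2) y"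
      "- (of_nat n + Complex (1 / 2) (- y)) = Complex (- real n - 1 / 2) y" for n
      by (simp_all add: complex_eq_iff)
    ultimately show ?thesis by (simp add: d_def)
  qed
  have dle: "norm (d N y) \<le> 2 * C * exp (\<tau> * \<bar>y\<bar>)" for N y
    using norm_triangle_ineq4[of "f (Complex (real N + 1 / 2) y)" "f (Complex (- real N - 1 / 2) y)"]
      bnd[of "Complex (real N + 1 / 2) y"] bnd[of "Complex (- real N - 1 / 2) y"]
    by (simp add: d_def)
  have ind: "(\<lambda>N. indicator {- real N..real N} y :: real) \<longlonglongrightarrow> 1" for y :: real
  proof (rule tendsto_eventually)
    show "\<forall>\<^sub>F N in sequentially. indicator {- real N..real N} y = (1 :: real)"
      using eventually_ge_at_top[of "nat \<lceil>\<bar>y\<bar>\<rceil>"]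
      by eventually_elim (auto simp: indicator_def nat_le_iff ceiling_le_iff abs_le_iff)
  qed
  have expk: "k y * exp (\<tau> * \<bar>y\<bar>) \<le> 8 * pi\<^sup>2 * exp (- (2 * pi - \<tau>) * \<bar>y\<bar>)" for y
    using mult_right_mono[OF kle, of "exp (\<tau> * \<bar>y\<bar>)" y]
    by (simp add: mult.assoc mult_exp_exp algebra_simps)
  let ?w = "\<lambda>c y. c * (8 * pi\<^sup>2 * exp (- (2 * pi - \<tau>) * \<bar>y\<bar>))"
  have wint: "integrable lborel (?w c)" for c
    using \<tau> by (intro integrable_mult_right integrable_exp_neg_abs) auto

  have lim1: "(\<lambda>N. LINT y|lborel. indicator {- real N..real N} y *\<^sub>R (of_real (k y) * d N y))
      \<longlonglongrightarrow> (LINT y|lborel. 1 *\<^sub>R (of_real (k y) * (a - b)))"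
  proof (rule integral_dominated_convergence[where w = "?w (2 * C)"])
    show "AE y in lborel. (\<lambda>N. indicator {- real N..real N} y *\<^sub>R (of_real (k y) * d N y))
      \<longlonglongrightarrow> 1 *\<^sub>R (of_real (k y) * (a - b))"
      by (intro AE_I2 tendsto_intros ind limd)
    show "AE y in lborel. norm (indicator {- real N..real N} y *\<^sub>R (of_real (k y) * d N y)) \<le> ?w (2 * C) y" for N
    proof (rule AE_I2)
      fix y :: real
      have "norm (indicator {- real N..real N} y *\<^sub>R (of_real (k y) * d N y)) \<le> 1 * (k y * norm (d N y))"
        unfolding norm_scaleR norm_mult norm_of_real using k0[of y]
        by (intro mult_mono) (auto simp: indicator_def)
      also have "\<dots> \<le> k y * (2 * C * exp (\<tau> * \<bar>y\<bar>))"
        using mult_left_mono[OF dle[of N y] k0[of y]] by simp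
      also have "\<dots> = 2 * C * (k y * exp (\<tau> * \<bar>y\<bar>))" by simp
      also have "\<dots> \<le> ?w (2 * C) y"
        using \<open>0 \<le> C\<close> by (intro mult_left_mono expk) auto
      finally show "norm (indicator {- real N..real N} y *\<^sub>R (of_real (k y) * d N y)) \<le> ?w (2 * C) y" .
    qed
  qed (use wint measd measdk in \<open>auto intro!: borel_measurable_scaleR borel_measurable_times borel_measurable_of_real\<close>)

  have kint: "integrable lborel k"
  proof (rule Bochner_Integration.integrable_bound[OF wint[of 1]])
    show "AE y in lborel. norm (k y) \<le> norm (?w 1 y)"
    proof (rule AE_I2)
      fix y :: real
      have "k y * 1 \<le> k y * exp (\<tau> * \<bar>y\<bar>)" using \<tau> k0 by (intro mult_left_mono) auto
      then show "norm (k y) \<le> norm (?w 1 y)" using expk[of y] k0[of y] by simp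
    qed
  qed (use measdk in auto)
  have "(\<lambda>N. LINT y|lborel. indicator {- real N..real N} y *\<^sub>R k y) \<longlonglongrightarrow> (LINT y|lborel. 1 *\<^sub>R k y)"
  proof (rule integral_dominated_convergence[where w = k])
    show "AE y in lborel. (\<lambda>N. indicator {- real N..real N} y *\<^sub>R k y) \<longlonglongrightarrow> 1 *\<^sub>R k y"
      by (intro AE_I2 tendsto_intros ind)
  qed (use kint measdk k0 in \<open>auto simp: indicator_def\<close>)
  \<comment> \<open>The total mass of the weight, from its primitive \<open>\<pi> tanh \<pi>y\<close>.\<close>
  moreover have "(LINT y|lborel. indicator {- real N..real N} y *\<^sub>R k y) = 2 * pi * tanh (pi * real N)" for N
  proof -
    have "(LINT y|lborel. indicator {- real N..real N} y *\<^sub>R k y) = pi * tanh (pi * real N) - pi * tanh (pi * - real N)"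
    proof (rule integral_FTC_atLeastAtMost[OF _ _ contk])
      fix y :: real
      have "1 - (tanh (pi * y))\<^sup>2 = 1 / (cosh (pi * y))\<^sup>2"
      proof -
        have "1 - (tanh (pi * y))\<^sup>2 = ((cosh (pi * y))\<^sup>2 - (sinh (pi * y))\<^sup>2) / (cosh (pi * y))\<^sup>2"
          by (simp add: tanh_def power_divide diff_divide_distrib cosh_real_nonzero)
        then show ?thesis using cosh_square_eq[of "pi * y"] by simp
      qed
      then have "((\<lambda>y. pi * tanh (pi * y)) has_real_derivative k y) (at y)"
        by (auto intro!: derivative_eq_intros simp: k_def cosh_real_nonzero power2_eq_square)
      then show "((\<lambda>y. pi * tanh (pi * y)) has_vector_derivative k y) (at y within {- real N..real N})"
        by (simp add: has_real_derivative_iff_has_vector_derivative has_vector_derivative_at_within)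
    qed auto
    then show ?thesis by simp
  qed
  moreover have "(\<lambda>N. 2 * pi * tanh (pi * real N)) \<longlonglongrightarrow> 2 * pi * 1"
  proof (intro tendsto_intros filterlim_compose[OF tanh_real_at_top])
    show "filterlim (\<lambda>N. pi * real N) at_top sequentially" by real_asymp
  qed
  ultimately have intk: "(LINT y|lborel. k y) = 2 * pi"
    using LIMSEQ_unique by (auto simp: )

  let ?S = "\<lambda>N. \<Sum>n=-int N..int N. deriv f (of_int n)"
  let ?V = "\<lambda>N. \<i> * (LINT y|lborel. indicator {- real N..real N} y *\<^sub>R (of_real (k y) * d N y))"
  have eqI: "(LINT y|lborel. 1 *\<^sub>R (of_real (k y) * (a - b))) = of_real (2 * pi) * (a - b)"
  proof -
    have "(LINT y|lborel. 1 *\<^sub>R (of_real (k y) * (a - b))) = of_real (LINT y|lborel. k y) * (a - b)"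
      by simp
    then show ?thesis by (simp only: intk)
  qed
  have limV: "?V \<longlonglongrightarrow> \<i> * (2 * pi * (a - b))"
    using tendsto_mult_left[OF lim1, of \<i>] unfolding eqI .
  have "(\<lambda>N. 2 * pi * \<i> * ?S N - ?V N) \<longlonglongrightarrow> 0"
  proof (rule Lim_null_comparison)
    let ?e = "\<lambda>N. 2 * (8 * pi\<^sup>2 * C * exp (\<tau> * real N - 2 * pi * real N) * (2 * real N + 1))"
    show "\<forall>\<^sub>F N in sequentially. norm (2 * pi * \<i> * ?S N - ?V N) \<le> ?e N"
      using eventually_ge_at_top[of 1]
    proof eventually_elim
      case (elim N)
      have "real N \<ge> 1" using elim by simp
      from sum_deriv_eq_vertical_integrals[OF hol bnd \<open>0 \<le> C\<close> this, of N]
      show ?case by (simp only: d_def k_def set_lebesgue_integral_def)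
    qed
    define c where "c = 2 * pi - \<tau>"
    have "c > 0" using \<tau> by (simp add: c_def)
    then have "(\<lambda>N. 2 * (8 * pi\<^sup>2 * C * exp (- c * real N) * (2 * real N + 1))) \<longlonglongrightarrow> 0"
      by real_asymp
    then show "?e \<longlonglongrightarrow> 0" by (simp add: c_def algebra_simps)
  qed
  from tendsto_add[OF this limV] have "(\<lambda>N. 2 * pi * \<i> * ?S N) \<longlonglongrightarrow> \<i> * (2 * pi * (a - b))"
    by simp
  then have lim: "(\<lambda>N. inverse (2 * pi * \<i>) * (2 * pi * \<i> * ?S N)) \<longlonglongrightarrow> inverse (2 * pi * \<i>) * (\<i> * (2 * pi * (a - b)))"
    by (rule tendsto_mult_left)
  have assoc: "\<i> * (2 * pi * (a - b)) = 2 * pi * \<i> * (a - b)" by simp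
  have cancel: "inverse (2 * pi * \<i>) * (2 * pi * \<i> * u) = u" for u :: complex
    by (subst mult.assoc [symmetric], subst left_inverse) auto
  show ?thesis using lim unfolding assoc cancel .
qed

section \<open>Quadrature at the integers\<close>

lemma sum_symmetric_Suc:
  fixes c :: "int \<Rightarrow> 'a :: comm_monoid_add"
  shows "(\<Sum>n=-int (Suc N)..int (Suc N). c n)
    = (\<Sum>n=-int N..int N. c n) + (c (int (Suc N)) + c (- int (Suc N)))"
proof -
  have "{-int (Suc N)..int (Suc N)} = insert (- int (Suc N)) (insert (int (Suc N)) {-int N..int N})"
    by auto
  then show ?thesis by (simp add: add_ac)
qed

lemma symmetric_partial_sums:
  fixes c :: "int \<Rightarrow> 'a :: comm_monoid_add"
  shows "(\<Sum>n=-int N..int N. c n) = (\<Sum>k\<le>N. if k = 0 then c 0 else c (int k) + c (- int k))"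
  by (induction N) (simp_all only: sum_symmetric_Suc sum.atMost_Suc, simp_all)

lemma filterlim_symmetric_intervals:
  "filterlim (\<lambda>N::nat. {-int N..int N}) (finite_subsets_at_top UNIV) sequentially"
  unfolding filterlim_finite_subsets_at_top
proof (intro allI impI)
  fix X :: "int set" assume "finite X \<and> X \<subseteq> UNIV"
  then have fin: "finite X" by simp
  define m where "m = nat (Max (insert 0 (abs ` X)))"
  have "\<bar>x\<bar> \<le> int N" if "x \<in> X" "N \<ge> m" for x N
  proof -
    have "\<bar>x\<bar> \<le> Max (insert 0 (abs ` X))" using that fin by (intro Max_ge) auto
    then show ?thesis using that by (simp add: m_def)
  qed
  then have "X \<subseteq> {-int N..int N}" if "N \<ge> m" for N
    using that by (force simp: abs_le_iff)
  then show "\<forall>\<^sub>F N in sequentially. finite {-int N..int N} \<and> X \<subseteq> {-int N..int N} \<and> {-int N..int N} \<subseteq> UNIV"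
    by (auto simp: eventually_sequentially)
qed

lemma has_sum_imp_symmetric_limit:
  fixes c :: "int \<Rightarrow> 'a :: {comm_monoid_add, topological_space}"
  assumes "(c has_sum s) UNIV"
  shows "(\<lambda>N::nat. \<Sum>n=-int N..int N. c n) \<longlonglongrightarrow> s"
  using assms filterlim_symmetric_intervals unfolding has_sum_def by (rule filterlim_compose)

text \<open>
  Dilation by \<open>r < 1\<close> lowers the type of the primitive strictly below \<open>2 \<pi>\<close>, the type of \<open>(sin \<pi>z)\<^sup>2\<close>.
\<close>
lemma dilated_quadrature:
  fixes F :: "complex \<Rightarrow> complex"
  assumes hol: "F holomorphic_on UNIV" and type: "exp_type_at_most (2 * pi) F"
    and int: "integrable lborel (\<lambda>x. F (of_real x))"
    and r: "0 < r" "r < 1"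
  shows "(\<lambda>N::nat. \<Sum>n=-int N..int N. of_real r * F (of_real (r * of_int n)))
           \<longlonglongrightarrow> (LINT x|lborel. F (of_real x))"
proof -
  obtain P C a b where P: "\<And>z. (P has_field_derivative F z) (at z)"
    "C > 0" "\<And>z. norm (P z) \<le> C * exp (2 * pi * \<bar>Im z\<bar>)"
    "((\<lambda>x::real. P (of_real x)) \<longlongrightarrow> a) at_top" "((\<lambda>x::real. P (of_real x)) \<longlongrightarrow> b) at_bot"
    "a - b = (LINT x|lborel. F (of_real x))"
    by (rule integrable_exp_type_primitive[OF hol type _ int]) auto
  define f where "f = (\<lambda>z. P (of_real r * z))"
  have D: "(f has_field_derivative of_real r * F (of_real r * z)) (at z)" for z
  proof -
    have "(f has_field_derivative F (of_real r * z) * of_real r) (at z)"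
      unfolding f_def by (rule DERIV_chain2[OF P(1) DERIV_cmult_Id])
    then show ?thesis by (simp only: mult.commute)
  qed
  have "(\<lambda>N::nat. \<Sum>n=-int N..int N. deriv f (of_int n)) \<longlonglongrightarrow> a - b"
  proof (rule sum_deriv_tendsto[where C = C and \<tau> = "2 * pi * r"])
    show "f holomorphic_on UNIV"
      using D by (auto simp: holomorphic_on_def field_differentiable_def)
    show "norm (f z) \<le> C * exp (2 * pi * r * \<bar>Im z\<bar>)" for z
      using P(3)[of "of_real r * z"] r by (simp add: f_def abs_mult mult_ac)
    have "filterlim (\<lambda>x. r * x) at_top at_top" "filterlim (\<lambda>x. r * x) at_bot at_bot"
      using r by real_asymp+
    from filterlim_compose[OF P(4) this(1)] filterlim_compose[OF P(5) this(2)]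
    show "((\<lambda>x. f (of_real x)) \<longlongrightarrow> a) at_top" "((\<lambda>x. f (of_real x)) \<longlongrightarrow> b) at_bot"
      by (simp_all add: f_def)
  qed (use P r in auto)
  moreover have "deriv f (of_int n) = of_real r * F (of_real (r * of_int n))" for n
    using DERIV_imp_deriv[OF D[of "of_int n"]] by simp
  ultimately show ?thesis by (simp add: P(6))
qed

text \<open>
  For nonnegative \<open>F\<close> each finite part of the dilated quadrature sum is at most the integral, and only then is
  \<open>r\<close> sent to 1, in a finite sum.
\<close>
lemma sum_le_integral:
  fixes F :: "complex \<Rightarrow> complex"
  assumes hol: "F holomorphic_on UNIV" and type: "exp_type_at_most (2 * pi) F"
    and int: "integrable lborel (\<lambda>x. F (of_real x))"
    and pos: "\<And>x::real. 0 \<le> Re (F (of_real x))"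
  shows "(\<Sum>n=-int N..int N. Re (F (of_int n))) \<le> (LINT x|lborel. Re (F (of_real x)))"
proof -
  have le: "(\<Sum>n=-int N..int N. r * Re (F (of_real (r * of_int n)))) \<le> (LINT x|lborel. Re (F (of_real x)))"
    if r: "0 < r" "r < 1" for r
  proof (rule incseq_le)
    let ?s = "\<lambda>N::nat. \<Sum>n=-int N..int N. r * Re (F (of_real (r * of_int n)))"
    show "incseq ?s"
      using r by (intro incseq_SucI sum_mono2 mult_nonneg_nonneg pos) auto
    have "(\<lambda>N::nat. Re (\<Sum>n=-int N..int N. of_real r * F (of_real (r * of_int n)))) \<longlonglongrightarrow> Re (LINT x|lborel. F (of_real x))"
      by (intro tendsto_Re dilated_quadrature assms r)
    then show "?s \<longlonglongrightarrow> (LINT x|lborel. Re (F (of_real x)))"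
      using int by (simp add: Re_sum)
  qed
  have "((\<lambda>r. \<Sum>n=-int N..int N. r * Re (F (of_real (r * of_int n)))) \<longlongrightarrow>
      (\<Sum>n=-int N..int N. 1 * Re (F (of_real (1 * of_int n))))) (at_left 1)"
  proof (intro tendsto_intros)
    fix n :: int
    have "isCont F (of_real (1 * of_int n))"
      using hol by (metis continuous_on_eq_continuous_at holomorphic_on_imp_continuous_on iso_tuple_UNIV_I open_UNIV)
    then show "((\<lambda>r. F (of_real (r * of_int n))) \<longlongrightarrow> F (of_real (1 * of_int n))) (at_left 1)"
      by (rule isCont_tendsto_compose) (intro tendsto_intros)
  qed
  moreover have "\<forall>\<^sub>F r in at_left 1. (\<Sum>n=-int N..int N. r * Re (F (of_real (r * of_int n)))) \<le> (LINT x|lborel. Re (F (of_real x)))"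
    by (rule eventually_mono[OF eventually_at_left_real[OF zero_less_one]]) (rule le; simp)
  ultimately have "(\<Sum>n=-int N..int N. 1 * Re (F (of_real (1 * of_int n)))) \<le> (LINT x|lborel. Re (F (of_real x)))"
    by (intro tendsto_upperbound) auto
  then show ?thesis by simp
qed

lemma summable_inverse_1_plus_square: "summable (\<lambda>k::nat. inverse (1 + (real k)\<^sup>2))"
proof (rule summable_comparison_test_bigo)
  show "summable (\<lambda>k. norm (inverse ((real k)\<^sup>2)))"
    using inverse_power_summable[of 2, where 'a = real] by simp
  show "(\<lambda>k::nat. inverse (1 + (real k)\<^sup>2)) \<in> O(\<lambda>k. inverse ((real k)\<^sup>2))"
    by real_asymp
qed

text \<open>
  The decay hypothesis dominates the dilated quadrature sums uniformly in \<open>r \<ge> 1/2\<close>, so the limit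
  \<open>r \<rightarrow> 1\<close> may be taken term by term.
\<close>
lemma integral_eq_sum_of_decay:
  fixes F :: "complex \<Rightarrow> complex"
  assumes hol: "F holomorphic_on UNIV" and type: "exp_type_at_most (2 * pi) F"
    and int: "integrable lborel (\<lambda>x. F (of_real x))"
    and decay: "\<And>x::real. norm (F (of_real x)) \<le> K * inverse (1 + x\<^sup>2)"
  shows "(\<lambda>N::nat. \<Sum>n=-int N..int N. F (of_int n)) \<longlonglongrightarrow> (LINT x|lborel. F (of_real x))"
proof -
  define r where "r = (\<lambda>j. 1 - 1 / (real j + 2))"
  have r: "1 / 2 \<le> r j" "r j < 1" for j by (auto simp: r_def field_simps)
  have rlim: "r \<longlonglongrightarrow> 1" unfolding r_def by real_asymp
  have "K \<ge> 0" using decay[of 0] order_trans[OF norm_ge_zero] by fastforce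
  define t where "t = (\<lambda>j n. of_real (r j) * F (of_real (r j * of_int n)))"
  define A where "A = (\<lambda>k j. if k = 0 then t j 0 else t j (int k) + t j (- int k))"
  define B where "B = (\<lambda>k::nat. if k = 0 then F 0 else F (of_int (int k)) + F (of_int (- int k)))"
  have tlim: "(\<lambda>j. t j n) \<longlonglongrightarrow> F (of_int n)" for n
  proof -
    have "isCont F (of_real (1 * of_int n))"
      using hol by (metis continuous_on_eq_continuous_at holomorphic_on_imp_continuous_on iso_tuple_UNIV_I open_UNIV)
    then have "(\<lambda>j. F (of_real (r j * of_int n))) \<longlonglongrightarrow> F (of_real (1 * of_int n))"
      by (rule isCont_tendsto_compose) (intro tendsto_intros rlim)
    then have "(\<lambda>j. t j n) \<longlonglongrightarrow> of_real 1 * F (of_real (1 * of_int n))"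
      unfolding t_def by (intro tendsto_intros rlim)
    then show ?thesis by simp
  qed
  have tle: "norm (t j n) \<le> 4 * K * inverse (1 + (real_of_int n)\<^sup>2)" for j n
  proof -
    have "norm (t j n) = r j * norm (F (of_real (r j * of_int n)))"
      using r[of j] by (simp add: t_def norm_mult)
    also have "\<dots> \<le> 1 * (K * inverse (1 + (r j * of_int n)\<^sup>2))"
      using r[of j] decay[of "r j * of_int n"] by (intro mult_mono) auto
    also have "\<dots> \<le> K * (4 * inverse (1 + (real_of_int n)\<^sup>2))"
    proof -
      have "(1 / 2)\<^sup>2 * (real_of_int n)\<^sup>2 \<le> (r j)\<^sup>2 * (real_of_int n)\<^sup>2"
        using r[of j] by (intro mult_right_mono power_mono) auto
      then have "(1 + (real_of_int n)\<^sup>2) / 4 \<le> 1 + (r j * of_int n)\<^sup>2"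
        by (simp add: power_mult_distrib power_divide)
      then have "inverse (1 + (r j * of_int n)\<^sup>2) \<le> inverse ((1 + (real_of_int n)\<^sup>2) / 4)"
        by (rule le_imp_inverse_le) (simp add: add_pos_nonneg)
      also have "\<dots> = 4 * inverse (1 + (real_of_int n)\<^sup>2)"
        by (subst inverse_divide) (rule divide_inverse)
      finally show ?thesis using \<open>K \<ge> 0\<close> unfolding mult_1 by (rule mult_left_mono)
    qed
    finally show ?thesis by simp
  qed
  have sumA: "(\<lambda>k. A k j) sums (LINT x|lborel. F (of_real x))" for j
  proof -
    have "0 < r j" using r[of j] by simp
    from dilated_quadrature[OF hol type int this r(2)]
    show ?thesis
      unfolding sums_def_le A_def t_def symmetric_partial_sums by simp
  qed
  have "(\<lambda>j. suminf (\<lambda>k. A k j)) \<longlonglongrightarrow> suminf B" and sB: "summable B"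
  proof -
    have Alim: "(\<lambda>j. A k j) \<longlonglongrightarrow> B k" for k
      unfolding A_def B_def using tlim[of 0] tlim[of "int k"] tlim[of "- int k"]
      by (auto intro!: tendsto_add)
    have Ale: "norm (A k j) \<le> 8 * K * inverse (1 + (real k)\<^sup>2)" for k j
    proof (cases "k = 0")
      case True
      then show ?thesis using tle[of j 0] \<open>K \<ge> 0\<close> by (simp add: A_def)
    next
      case False
      then show ?thesis using tle[of j "int k"] tle[of j "- int k"] norm_triangle_ineq[of "t j (int k)" "t j (- int k)"]
        by (simp add: A_def)
    qed
    have "eventually (\<lambda>n. summable (\<lambda>k. norm (A k n))) sequentially \<and>
        summable (\<lambda>n. norm (B n)) \<and> ((\<lambda>n. suminf (\<lambda>k. A k n)) \<longlonglongrightarrow> suminf B)"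
    proof (rule tannerys_theorem)
      show "\<forall>\<^sub>F (k, n) in at_top \<times>\<^sub>F sequentially. norm (A k n) \<le> 8 * K * inverse (1 + (real k)\<^sup>2)"
        using Ale by (intro always_eventually) auto
      show "summable (\<lambda>k. 8 * K * inverse (1 + (real k)\<^sup>2))"
        by (intro summable_mult summable_inverse_1_plus_square)
    qed (use Alim in auto)
    then show "(\<lambda>j. suminf (\<lambda>k. A k j)) \<longlonglongrightarrow> suminf B" "summable B"
      by (auto dest: summable_norm_cancel)
  qed
  moreover have "suminf (\<lambda>k. A k j) = (LINT x|lborel. F (of_real x))" for j
    using sumA sums_unique by metis
  ultimately have "(\<lambda>j. (LINT x|lborel. F (of_real x))) \<longlonglongrightarrow> suminf B" by simp
  then have "suminf B = (LINT x|lborel. F (of_real x))"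
    by (simp add: LIMSEQ_const_iff)
  with sB have "B sums (LINT x|lborel. F (of_real x))"
    by (simp add: sums_iff)
  then show ?thesis
    unfolding sums_def_le symmetric_partial_sums B_def of_int_0 .
qed

section \<open>Gaussian sums, sums of entire functions, and oscillating integrals\<close>

lemma summable_on_int_of_abs:
  fixes f :: "nat \<Rightarrow> real"
  assumes "summable f" "\<And>k. f k \<ge> 0"
  shows "(\<lambda>n::int. f (nat \<bar>n\<bar>)) summable_on UNIV"
proof -
  have f: "f summable_on UNIV" by (rule summable_nonneg_imp_summable_on[OF assms])
  have "(\<lambda>n::int. f (nat \<bar>n\<bar>)) summable_on range int"
    using f by (subst summable_on_reindex) (auto simp: o_def)
  moreover have "(\<lambda>n::int. f (nat \<bar>n\<bar>)) summable_on range (\<lambda>k. - int k)"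
    using f by (subst summable_on_reindex) (auto simp: o_def inj_on_def)
  ultimately have "(\<lambda>n::int. f (nat \<bar>n\<bar>)) summable_on (range int \<union> range (\<lambda>k. - int k))"
    by (rule summable_on_union)
  moreover have "n \<in> range int \<union> range (\<lambda>k. - int k)" for n
    by (cases n rule: int_cases2) auto
  then have "range int \<union> range (\<lambda>k. - int k) = UNIV" by blast
  ultimately show ?thesis by simp
qed

lemma exp_neg_square_le:
  fixes c x :: real
  assumes "c > 0"
  shows "exp (- c * x\<^sup>2) \<le> (1 + 1 / c) * inverse (1 + x\<^sup>2)"
proof -
  have pos: "1 + c * x\<^sup>2 > 0" "1 + x\<^sup>2 > 0" using assms by (auto intro: add_pos_nonneg)
  have "1 + x\<^sup>2 \<le> (1 + 1 / c) * (1 + c * x\<^sup>2)"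
    using assms by (simp add: field_simps)
  also have "\<dots> \<le> (1 + 1 / c) * exp (c * x\<^sup>2)"
    using exp_ge_add_one_self[of "c * x\<^sup>2"] assms by (intro mult_left_mono) auto
  finally have "(1 + x\<^sup>2) * exp (- c * x\<^sup>2) \<le> ((1 + 1 / c) * exp (c * x\<^sup>2)) * exp (- c * x\<^sup>2)"
    by (rule mult_right_mono) simp
  also have "\<dots> = 1 + 1 / c" by (simp add: exp_minus)
  finally show ?thesis using pos by (simp add: divide_inverse [symmetric] pos_le_divide_eq mult.commute)
qed

lemma summable_on_cubic_gaussian:
  assumes "c > 0"
  shows "(\<lambda>n::int. (1 + \<bar>real_of_int n\<bar> ^ 3) * exp (- c * (real_of_int n)\<^sup>2)) summable_on UNIV"
proof -
  \<comment> \<open>The exponential is split into three equal factors, each bounded by \<open>A / (1 + x\<^sup>2)\<close>: two of them absorb the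
    cubic polynomial and the third gives summability.\<close>
  define A where "A = 1 + 1 / (c / 3)"
  have bound: "(1 + \<bar>x\<bar> ^ 3) * exp (- c * x\<^sup>2) \<le> A ^ 3 * inverse (1 + x\<^sup>2)" for x :: real
  proof -
    have pos: "1 + x\<^sup>2 > 0" by (simp add: add_pos_nonneg)
    have "\<bar>x\<bar> ^ 3 \<le> \<bar>x\<bar> ^ 2 + \<bar>x\<bar> ^ 4"
      using power_decreasing[of 2 3 "\<bar>x\<bar>"] power_increasing[of 3 4 "\<bar>x\<bar>"]
      by (cases "\<bar>x\<bar> \<le> 1") (auto intro: add_increasing add_increasing2)
    moreover have "(1 + x\<^sup>2)\<^sup>2 = 1 + 2 * \<bar>x\<bar> ^ 2 + \<bar>x\<bar> ^ 4"
      by (simp add: power2_eq_square power4_eq_xxxx algebra_simps)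
    ultimately have cubic: "1 + \<bar>x\<bar> ^ 3 \<le> (1 + x\<^sup>2)\<^sup>2"
      using zero_le_power2[of "\<bar>x\<bar>"] by linarith
    have "exp (- c * x\<^sup>2) = exp (- (c / 3) * x\<^sup>2) ^ 3"
      by (subst exp_of_nat_mult [symmetric]) simp
    also have "\<dots> \<le> (A * inverse (1 + x\<^sup>2)) ^ 3"
      unfolding A_def using assms by (intro power_mono exp_neg_square_le) auto
    finally have "(1 + \<bar>x\<bar> ^ 3) * exp (- c * x\<^sup>2) \<le> (1 + x\<^sup>2)\<^sup>2 * (A * inverse (1 + x\<^sup>2)) ^ 3"
      using cubic by (intro mult_mono) auto
    also have "\<dots> = A ^ 3 * inverse (1 + x\<^sup>2)"
    proof -
      have "u\<^sup>2 * (A * inverse u) ^ 3 = A ^ 3 * inverse u" if "u > 0" for u :: real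
        using that by (simp add: power2_eq_square power3_eq_cube field_simps)
      with pos show ?thesis by blast
    qed
    finally show ?thesis .
  qed
  have "A \<ge> 0" using assms by (simp add: A_def)
  then have "(\<lambda>n::int. A ^ 3 * inverse (1 + (real (nat \<bar>n\<bar>))\<^sup>2)) summable_on UNIV"
    by (intro summable_on_int_of_abs[of "\<lambda>k. A ^ 3 * inverse (1 + (real k)\<^sup>2)"]
        summable_mult summable_inverse_1_plus_square) simp
  then have "(\<lambda>n::int. A ^ 3 * inverse (1 + (real_of_int n)\<^sup>2)) summable_on UNIV" by simp
  then show ?thesis
    by (rule summable_on_comparison_test) (use bound in auto)
qed

text \<open>
  The Weierstrass M-test on every disc; derivatives of locally uniform limits converge as well.
\<close>
lemma entire_infsum:
  fixes f :: "'i \<Rightarrow> complex \<Rightarrow> complex"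
  assumes hol: "\<And>i. f i holomorphic_on UNIV"
    and dom: "\<And>R. R > 0 \<Longrightarrow> \<exists>M. M summable_on UNIV \<and> (\<forall>i z. norm z \<le> R \<longrightarrow> norm (f i z) \<le> M i)"
  shows "(\<lambda>z. \<Sum>\<^sub>\<infinity>i. f i z) holomorphic_on UNIV"
    and "((\<lambda>i. deriv (f i) z) has_sum deriv (\<lambda>z. \<Sum>\<^sub>\<infinity>i. f i z) z) UNIV"
proof -
  let ?S = "\<lambda>z. \<Sum>\<^sub>\<infinity>i. f i z"
  have *: "?S field_differentiable (at w) \<and> ((\<lambda>i. deriv (f i) w) has_sum deriv ?S w) UNIV" for w
  proof -
    define R where "R = norm w + 1"
    have "R > 0" using norm_ge_zero[of w] unfolding R_def by linarith
    with dom obtain M where M: "M summable_on UNIV" "\<And>i z. norm z \<le> R \<Longrightarrow> norm (f i z) \<le> M i" by blast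
    obtain g' where g': "\<And>w. w \<in> ball 0 R \<Longrightarrow> (?S has_field_derivative g' w) (at w) \<and>
        ((\<lambda>X. \<Sum>i\<in>X. deriv (f i) w) \<longlongrightarrow> g' w) (finite_subsets_at_top UNIV)"
    proof (rule has_complex_derivative_uniform_limit)
      show "uniform_limit (cball 0 R) (\<lambda>X z. \<Sum>i\<in>X. f i z) ?S (finite_subsets_at_top UNIV)"
        by (rule Weierstrass_m_test_general[OF _ M(1)]) (use M(2) in auto)
      show "\<forall>\<^sub>F X in finite_subsets_at_top UNIV. continuous_on (cball 0 R) (\<lambda>z. \<Sum>i\<in>X. f i z) \<and>
        (\<forall>w\<in>ball 0 R. ((\<lambda>z. \<Sum>i\<in>X. f i z) has_field_derivative (\<Sum>i\<in>X. deriv (f i) w)) (at w))"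
      proof (intro always_eventually allI conjI ballI)
        show "continuous_on (cball 0 R) (\<lambda>z. \<Sum>i\<in>X. f i z)" for X
          by (intro continuous_on_sum holomorphic_on_imp_continuous_on holomorphic_on_subset[OF hol]) auto
        show "((\<lambda>z. \<Sum>i\<in>X. f i z) has_field_derivative (\<Sum>i\<in>X. deriv (f i) w)) (at w)" for X w
          by (intro DERIV_sum holomorphic_derivI[OF hol]) auto
      qed
    qed (use \<open>R > 0\<close> in auto)
    have "w \<in> ball 0 R" by (simp add: R_def)
    note D = g'[OF this]
    then have "deriv ?S w = g' w" by (intro DERIV_imp_deriv) simp
    with D show ?thesis by (auto simp: has_sum_def field_differentiable_def)
  qed
  show "?S holomorphic_on UNIV"
    using * by (auto simp: holomorphic_on_def)
  show "((\<lambda>i. deriv (f i) z) has_sum deriv ?S z) UNIV"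
    using * by blast
qed

lemma has_integral_complex_FTC:
  fixes h H :: "complex \<Rightarrow> complex"
  assumes D: "\<And>z. (H has_field_derivative h z) (at z)" and "a \<le> b"
  shows "((\<lambda>x. h (of_real x)) has_integral (H (of_real b) - H (of_real a))) {a..b}"
  by (rule fundamental_theorem_of_calculus[OF \<open>a \<le> b\<close>])
     (use has_vector_derivative_real_field[OF D] in \<open>auto intro: has_vector_derivative_at_within\<close>)

text \<open>
  For a holomorphic amplitude one integration by parts is enough and gives the rate \<open>1 / K\<close>.
\<close>
lemma riemann_lebesgue_sin:
  assumes hol: "g holomorphic_on S" "open S" and sub: "of_real ` {a..b} \<subseteq> S" and "a \<le> b"
  shows "(\<lambda>K::nat. integral {a..b} (\<lambda>x. g (of_real x) * sin (of_real ((2 * real K + 1) * pi * x)))) \<longlonglongrightarrow> 0"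
proof -
  define m where "m = (\<lambda>K::nat. (2 * real K + 1) * pi)"
  have m: "m K > 0" for K by (simp add: m_def add_nonneg_pos)
  have contg': "continuous_on {a..b} (\<lambda>x. deriv g (of_real x))"
    by (rule continuous_on_compose2[OF holomorphic_on_imp_continuous_on[OF holomorphic_deriv[OF hol]]])
       (use sub in \<open>auto intro!: continuous_intros\<close>)
  have contg: "continuous_on {a..b} (\<lambda>x. g (of_real x))"
    by (rule continuous_on_compose2[OF holomorphic_on_imp_continuous_on[OF hol(1)]])
       (use sub in \<open>auto intro!: continuous_intros\<close>)
  obtain B where B: "\<And>x. x \<in> {a..b} \<Longrightarrow> norm (deriv g (of_real x)) \<le> B"
    using compact_imp_bounded[OF compact_continuous_image[OF contg' compact_Icc]]
    unfolding bounded_iff by blast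
  let ?E = "\<lambda>K x. g (of_real x) * of_real (- cos (m K * x) / m K)"
  let ?I = "\<lambda>K. integral {a..b} (\<lambda>x. deriv g (of_real x) * of_real (cos (m K * x) / m K))"
  have parts: "integral {a..b} (\<lambda>x. g (of_real x) * sin (of_real (m K * x))) = ?E K b - ?E K a + ?I K" for K
  proof -
    have "((\<lambda>x. g (of_real x) * of_real (sin (m K * x)) - deriv g (of_real x) * of_real (cos (m K * x) / m K))
        has_integral (?E K b - ?E K a)) {a..b}"
    proof (rule fundamental_theorem_of_calculus[OF \<open>a \<le> b\<close>])
      fix x assume x: "x \<in> {a..b}"
      have "(g has_field_derivative deriv g (of_real x)) (at (of_real x))"
        using sub x by (intro holomorphic_derivI[OF hol]) auto
      then have 1: "((\<lambda>x. g (of_real x)) has_vector_derivative deriv g (of_real x)) (at x within {a..b})"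
        by (rule has_vector_derivative_real_field)
      have "((\<lambda>x. - cos (m K * x) / m K) has_real_derivative sin (m K * x)) (at x within {a..b})"
        using m[of K] by (auto intro!: derivative_eq_intros)
      then have 2: "((\<lambda>x. of_real (- cos (m K * x) / m K) :: complex) has_vector_derivative of_real (sin (m K * x))) (at x within {a..b})"
        by (intro has_vector_derivative_of_real) (simp add: has_real_derivative_iff_has_vector_derivative)
      from has_vector_derivative_mult[OF 1 2]
      show "(?E K has_vector_derivative g (of_real x) * of_real (sin (m K * x)) - deriv g (of_real x) * of_real (cos (m K * x) / m K)) (at x within {a..b})"
        by (simp add: algebra_simps)
    qed
    moreover have "(\<lambda>x. deriv g (of_real x) * of_real (cos (m K * x) / m K)) integrable_on {a..b}"
      using m[of K] by (intro integrable_continuous_real continuous_intros contg') auto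
    ultimately have "((\<lambda>x. (g (of_real x) * of_real (sin (m K * x)) - deriv g (of_real x) * of_real (cos (m K * x) / m K))
         + deriv g (of_real x) * of_real (cos (m K * x) / m K))
        has_integral (?E K b - ?E K a) + ?I K) {a..b}"
      by (intro has_integral_add integrable_integral)
    then show ?thesis by (intro integral_unique) (simp only: sin_of_real diff_add_cancel)
  qed
  have bound: "norm (integral {a..b} (\<lambda>x. g (of_real x) * sin (of_real (m K * x))))
      \<le> (norm (g (of_real a)) + norm (g (of_real b)) + B * (b - a)) / m K" for K
  proof -
    have E: "norm (?E K x) \<le> norm (g (of_real x)) / m K" for x
    proof -
      have "norm (?E K x) = norm (g (of_real x)) * (\<bar>cos (m K * x)\<bar> / m K)"
        using m[of K] by (simp add: norm_mult del: of_real_divide of_real_minus)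
      also have "\<dots> \<le> norm (g (of_real x)) * (1 / m K)"
        using m[of K] by (intro mult_left_mono divide_right_mono) auto
      finally show ?thesis by simp
    qed
    have "norm (?I K) \<le> B / m K * (b - a)"
    proof (rule integral_bound[OF \<open>a \<le> b\<close>])
      show "continuous_on {a..b} (\<lambda>x. deriv g (of_real x) * of_real (cos (m K * x) / m K))"
        using m[of K] by (intro continuous_intros contg') auto
      fix x assume "x \<in> {a..b}"
      have "norm (deriv g (of_real x) * of_real (cos (m K * x) / m K)) = norm (deriv g (of_real x)) * (\<bar>cos (m K * x)\<bar> / m K)"
        using m[of K] by (simp add: norm_mult del: of_real_divide)
      also have "\<dots> \<le> B * (1 / m K)"
        using m[of K] B[OF \<open>x \<in> {a..b}\<close>] order_trans[OF norm_ge_zero B[OF \<open>x \<in> {a..b}\<close>]]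
        by (intro mult_mono divide_right_mono) auto
      finally show "norm (deriv g (of_real x) * of_real (cos (m K * x) / m K)) \<le> B / m K" by simp
    qed
    then have "norm (?E K b - ?E K a + ?I K) \<le> norm (g (of_real b)) / m K + norm (g (of_real a)) / m K + B / m K * (b - a)"
      using E[of b] E[of a] norm_triangle_ineq[of "?E K b - ?E K a" "?I K"] norm_triangle_ineq4[of "?E K b" "?E K a"]
      by linarith
    then show ?thesis unfolding parts by (simp add: add_divide_distrib)
  qed
  have "(\<lambda>K. (norm (g (of_real a)) + norm (g (of_real b)) + B * (b - a)) / m K) \<longlonglongrightarrow> 0"
    unfolding m_def by real_asymp
  from Lim_null_comparison[OF always_eventually[OF allI[OF bound]] this]
  show ?thesis by (simp only: m_def)
qed

section \<open>The transformation formula for the theta constant\<close>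

text \<open>
  The exponential \<open>e(k z)\<close> in the notation of analytic number theory.
\<close>
definition char_exp :: "int \<Rightarrow> complex \<Rightarrow> complex" where
  "char_exp k z = exp (2 * of_real pi * \<i> * of_int k * z)"

lemma DERIV_char_exp [derivative_intros]:
  "(g has_field_derivative g') (at z within A) \<Longrightarrow>
    ((\<lambda>z. char_exp k (g z)) has_field_derivative (2 * of_real pi * \<i> * of_int k * char_exp k (g z) * g')) (at z within A)"
  unfolding char_exp_def by (auto intro!: derivative_eq_intros)

lemma char_exp_of_real_shift: "char_exp k (z + of_int n) = char_exp k z"
proof -
  have "char_exp k (z + of_int n) = char_exp k z * exp ((2 * of_int (k * n) * of_real pi) * \<i>)"
    by (simp add: char_exp_def algebra_simps flip: exp_add)
  also have "exp ((2 * of_int (k * n) * of_real pi) * \<i>) = 1"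
    using exp_integer_2pi[of "real_of_int (k * n)"] by simp
  finally show ?thesis by simp
qed

lemma norm_char_exp_of_real [simp]: "norm (char_exp k (of_real x)) = 1"
  by (simp add: char_exp_def)

lemma dirichlet_kernel:
  "(\<Sum>k=-int K..int K. char_exp k z) * sin (of_real pi * z) = sin (of_real ((2 * real K + 1) * pi) * z)"
proof (induction K)
  case (Suc K)
  define w where "w = 2 * of_real ((real K + 1) * pi) * z"
  have "(\<Sum>k=-int (Suc K)..int (Suc K). char_exp k z)
      = (\<Sum>k=-int K..int K. char_exp k z) + (char_exp (int (Suc K)) z + char_exp (- int (Suc K)) z)"
    by (rule sum_symmetric_Suc)
  also have "char_exp (int (Suc K)) z + char_exp (- int (Suc K)) z = exp (\<i> * w) + exp (- (\<i> * w))"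
    by (simp add: char_exp_def w_def algebra_simps)
  also have "\<dots> = 2 * cos w"
    by (simp add: cos_exp_eq)
  finally have "(\<Sum>k=-int (Suc K)..int (Suc K). char_exp k z) * sin (of_real pi * z)
      = sin (of_real ((2 * real K + 1) * pi) * z) + 2 * cos w * sin (of_real pi * z)"
    by (simp only: distrib_right Suc)
  also have "of_real ((2 * real K + 1) * pi) * z = w - of_real pi * z"
    by (simp add: w_def algebra_simps)
  also have "sin (w - of_real pi * z) + 2 * cos w * sin (of_real pi * z) = sin (w + of_real pi * z)"
    by (simp add: sin_add sin_diff)
  also have "w + of_real pi * z = of_real ((2 * real (Suc K) + 1) * pi) * z"
    by (simp add: w_def algebra_simps)
  finally show ?case .
qed (simp add: char_exp_def)

lemma integral_char_exp:
  "((\<lambda>x. char_exp k (of_real x)) has_integral (if k = 0 then 1 else 0)) {-1/2..1/2}"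
proof (cases "k = 0")
  case True
  have "((\<lambda>x::real. 1::complex) has_integral measure lborel {-1/2..1/2::real} *\<^sub>R 1) {-1/2..1/2}"
    by (rule has_integral_const_real)
  then show ?thesis using True by (simp add: char_exp_def)
next
  case False
  let ?H = "\<lambda>z. char_exp k z / (2 * of_real pi * \<i> * of_int k)"
  have "((\<lambda>x. char_exp k (of_real x)) has_integral (?H (of_real (1/2)) - ?H (of_real (-1/2)))) {-1/2..1/2}"
    using False by (intro has_integral_complex_FTC) (auto intro!: derivative_eq_intros)
  moreover have "char_exp k (of_real (1/2)) = char_exp k (of_real (-1/2))"
    using char_exp_of_real_shift[of k "of_real (-1/2)" 1] by simp
  ultimately show ?thesis using False by simp
qed

text \<open>
  Dirichlet's argument.  The \<open>K\<close>-th partial sum is the integral of \<open>\<phi>\<close> against the Dirichlet kernel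
  \<open>sin ((2 K + 1) \<pi>x) / sin \<pi>x\<close>, which has integral 1.  As \<open>(\<phi>(x) - \<phi>(0)) / sin \<pi>x\<close> extends
  holomorphically across 0, the difference from \<open>\<phi>(0)\<close> is an oscillating integral tending to 0.
\<close>
lemma fourier_series_tendsto_at_0:
  assumes hol: "\<phi> holomorphic_on UNIV"
  shows "(\<lambda>K::nat. \<Sum>k=-int K..int K. integral {-1/2..1/2} (\<lambda>x. \<phi> (of_real x) * char_exp k (of_real x))) \<longlonglongrightarrow> \<phi> 0"
proof -
  define q where "q = (\<lambda>z. if z = 0 then deriv \<phi> 0 else (\<phi> z - \<phi> 0) / (z - 0))"
  define g where "g = (\<lambda>z. q z / (of_real pi * csinc z))"
  have holg: "g holomorphic_on ball 0 1"
    unfolding g_def q_def using csinc_nonzero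
    by (intro holomorphic_intros pole_lemma_open holomorphic_on_subset[OF hol]) auto
  have qz: "\<phi> z - \<phi> 0 = z * q z" for z by (simp add: q_def)
  have key: "(\<phi> z - \<phi> 0) * (\<Sum>k=-int K..int K. char_exp k z) = g z * sin (of_real ((2 * real K + 1) * pi) * z)"
    if "z \<in> ball 0 1" for z K
  proof -
    have "\<phi> z - \<phi> 0 = g z * sin (of_real pi * z)"
      using csinc_nonzero[OF that] by (simp add: g_def qz sin_pi_eq_csinc)
    then show ?thesis by (simp only: mult.assoc mult.commute[of "sin _"] dirichlet_kernel)
  qed
  have cont\<phi>: "continuous_on A (\<lambda>x. \<phi> (of_real x))" for A
    by (intro continuous_on_compose2[OF holomorphic_on_imp_continuous_on[OF hol]] continuous_intros) auto
  have contc: "continuous_on A (\<lambda>x. char_exp k (of_real x))" for A k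
    unfolding char_exp_def by (intro continuous_intros)
  have eq: "(\<Sum>k=-int K..int K. integral {-1/2..1/2} (\<lambda>x. \<phi> (of_real x) * char_exp k (of_real x)))
     = \<phi> 0 + integral {-1/2..1/2} (\<lambda>x. g (of_real x) * sin (of_real ((2 * real K + 1) * pi * x)))" for K
  proof -
    have "((\<lambda>x. \<Sum>k=-int K..int K. char_exp k (of_real x)) has_integral (\<Sum>k=-int K..int K. if k = 0 then 1 else 0)) {-1/2..1/2}"
      by (intro has_integral_sum integral_char_exp) auto
    then have D: "((\<lambda>x. \<phi> 0 * (\<Sum>k=-int K..int K. char_exp k (of_real x))) has_integral \<phi> 0 * 1) {-1/2..1/2}"
      by (intro has_integral_mult_right) simp
    let ?d = "\<lambda>x. (\<phi> (of_real x) - \<phi> 0) * (\<Sum>k=-int K..int K. char_exp k (of_real x))"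
    have "?d integrable_on {-1/2..1/2}"
      by (intro integrable_continuous_real continuous_intros cont\<phi> contc)
    then have I: "(?d has_integral integral {-1/2..1/2} ?d) {-1/2..1/2}"
      by (rule integrable_integral)
    have "(\<Sum>k=-int K..int K. integral {-1/2..1/2} (\<lambda>x. \<phi> (of_real x) * char_exp k (of_real x)))
      = integral {-1/2..1/2} (\<lambda>x. \<Sum>k=-int K..int K. \<phi> (of_real x) * char_exp k (of_real x))"
      by (intro integral_sum [symmetric] integrable_continuous_real continuous_intros cont\<phi> contc) auto
    also have "\<dots> = integral {-1/2..1/2} (\<lambda>x. \<phi> 0 * (\<Sum>k=-int K..int K. char_exp k (of_real x)) + ?d x)"
      unfolding sum_distrib_left [symmetric] by (simp add: left_diff_distrib)
    also have "\<dots> = \<phi> 0 * 1 + integral {-1/2..1/2} ?d"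
      by (rule integral_unique[OF has_integral_add[OF D I]])
    also have "integral {-1/2..1/2} ?d = integral {-1/2..1/2} (\<lambda>x. g (of_real x) * sin (of_real ((2 * real K + 1) * pi * x)))"
    proof (rule Henstock_Kurzweil_Integration.integral_cong)
      fix x :: real assume "x \<in> {-1/2..1/2}"
      then have "complex_of_real x \<in> ball 0 1" by (auto simp: abs_le_iff)
      from key[OF this] show "?d x = g (of_real x) * sin (of_real ((2 * real K + 1) * pi * x))"
        by (simp only: of_real_mult)
    qed
    finally show ?thesis by simp
  qed
  have "(\<lambda>K. \<phi> 0 + integral {-1/2..1/2} (\<lambda>x. g (of_real x) * sin (of_real ((2 * real K + 1) * pi * x)))) \<longlonglongrightarrow> \<phi> 0 + 0"
    by (intro tendsto_intros riemann_lebesgue_sin[OF holg]) (auto simp: abs_le_iff)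
  then show ?thesis unfolding eq by simp
qed

lemma norm_gaussian: "norm (gaussian lam z) = exp (- (pi * lam) * ((Re z)\<^sup>2 - (Im z)\<^sup>2))"
  by (simp add: gaussian_def Re_power2)

lemma gaussian_of_real: "gaussian lam (of_real x) = of_real (exp (- (pi * lam) * x\<^sup>2))"
  by (simp add: gaussian_def exp_of_real [symmetric])

lemma holomorphic_gaussian: "gaussian lam holomorphic_on UNIV"
  unfolding gaussian_def by (intro holomorphic_intros)

text \<open>
  By \<open>(x + n)\<^sup>2 \<ge> n\<^sup>2 / 2 - x\<^sup>2\<close>.  The right side is an instance of the one summable family that
  also dominates the Hermite terms.
\<close>
lemma norm_gaussian_shift_le:
  assumes "lam > 0" "norm z \<le> R"
  shows "norm (gaussian lam (z + of_int n))
    \<le> exp (pi * lam * R\<^sup>2) * ((1 + \<bar>real_of_int n\<bar> ^ 3) * exp (- (pi * lam / 2) * (real_of_int n)\<^sup>2))"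
proof -
  have "(Re z)\<^sup>2 + (Im z)\<^sup>2 \<le> R\<^sup>2"
    using power_mono[OF assms(2), of 2] by (simp add: cmod_power2)
  moreover have "0 \<le> (2 * Re z + real_of_int n)\<^sup>2" by simp
  ultimately have "(Re z + real_of_int n)\<^sup>2 - (Im z)\<^sup>2 \<ge> (real_of_int n)\<^sup>2 / 2 - R\<^sup>2"
    by (simp add: power2_eq_square algebra_simps)
  then have "pi * lam * ((Re z + real_of_int n)\<^sup>2 - (Im z)\<^sup>2) \<ge> pi * lam * ((real_of_int n)\<^sup>2 / 2 - R\<^sup>2)"
    using assms by (intro mult_left_mono) auto
  then have "norm (gaussian lam (z + of_int n)) \<le> exp (pi * lam * R\<^sup>2 - (pi * lam / 2) * (real_of_int n)\<^sup>2)"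
    by (simp add: norm_gaussian algebra_simps)
  also have "\<dots> = exp (pi * lam * R\<^sup>2) * (1 * exp (- (pi * lam / 2) * (real_of_int n)\<^sup>2))"
    by (simp flip: exp_add)
  also have "\<dots> \<le> exp (pi * lam * R\<^sup>2) * ((1 + \<bar>real_of_int n\<bar> ^ 3) * exp (- (pi * lam / 2) * (real_of_int n)\<^sup>2))"
    by (intro mult_left_mono mult_right_mono) auto
  finally show ?thesis .
qed

lemma summable_gaussian_bound:
  "lam > 0 \<Longrightarrow> (\<lambda>n::int. exp (pi * lam * R\<^sup>2) *
     ((1 + \<bar>real_of_int n\<bar> ^ 3) * exp (- (pi * lam / 2) * (real_of_int n)\<^sup>2))) summable_on UNIV"
  by (intro summable_on_cmult_right summable_on_cubic_gaussian) simp

lemma integrable_gaussian_char_exp: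
  assumes "lam > 0"
  shows "integrable lborel (\<lambda>x. gaussian lam (of_real x) * char_exp k (of_real x))"
proof (rule Bochner_Integration.integrable_bound)
  show "integrable lborel (\<lambda>x. (1 + 1 / (pi * lam)) * inverse (1 + x\<^sup>2))"
    by (intro integrable_mult_right integrable_inverse_1_plus_square_lborel)
  show "(\<lambda>x. gaussian lam (of_real x) * char_exp k (of_real x)) \<in> borel_measurable lborel"
    unfolding gaussian_def char_exp_def by measurable
  have "norm (gaussian lam (of_real x) * char_exp k (of_real x)) \<le> norm ((1 + 1 / (pi * lam)) * inverse (1 + x\<^sup>2))" for x :: real
    using exp_neg_square_le[of "pi * lam" x] assms
    by (simp add: norm_mult norm_gaussian abs_mult)
  then show "AE x in lborel. norm (gaussian lam (of_real x) * char_exp k (of_real x)) \<le> norm ((1 + 1 / (pi * lam)) * inverse (1 + x\<^sup>2))"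
    by (rule AE_I2)
qed

text \<open>
  The characteristic function of the standard normal distribution, after rescaling.
\<close>
lemma fourier_transform_gaussian:
  assumes "lam > 0"
  shows "(LINT x|lborel. gaussian lam (of_real x) * char_exp k (of_real x))
    = of_real (lam powr (-1/2) * exp (- pi * (real_of_int k)\<^sup>2 / lam))"
proof -
  \<comment> \<open>With \<open>u = c x\<close> the density \<open>exp (- u\<^sup>2 / 2)\<close> becomes \<open>exp (- \<pi> \<lambda> x\<^sup>2)\<close>, and the frequency \<open>t\<close> becomes
    \<open>t c = 2 \<pi> k\<close>.\<close>
  define c where "c = sqrt (2 * pi * lam)"
  have c: "c > 0" "c\<^sup>2 = 2 * pi * lam" using assms by (simp_all add: c_def)
  define t where "t = 2 * pi * real_of_int k / c"
  have "char std_normal_distribution t = (LINT x|lborel. std_normal_density x *\<^sub>R iexp (t * x))"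
    unfolding char_def by (subst integral_density) auto
  also have "\<dots> = \<bar>c\<bar> *\<^sub>R (LINT x|lborel. std_normal_density (0 + c * x) *\<^sub>R iexp (t * (0 + c * x)))"
    using c by (intro lborel_integral_real_affine) auto
  also have "(\<lambda>x. std_normal_density (0 + c * x) *\<^sub>R iexp (t * (0 + c * x)))
     = (\<lambda>x. of_real (1 / sqrt (2 * pi)) * (gaussian lam (of_real x) * char_exp k (of_real x)))"
  proof
    fix x :: real
    have "(c * x)\<^sup>2 / 2 = pi * lam * x\<^sup>2" using c by (simp add: power_mult_distrib)
    then have std: "std_normal_density (c * x) = 1 / sqrt (2 * pi) * exp (- (pi * lam) * x\<^sup>2)"
      by (simp add: std_normal_density_def)
    have tc: "t * (c * x) = 2 * pi * real_of_int k * x" using c by (simp add: t_def)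
    have "iexp (t * (c * x)) = char_exp k (of_real x)"
      unfolding tc char_exp_def by (simp add: mult_ac)
    with std show "std_normal_density (0 + c * x) *\<^sub>R iexp (t * (0 + c * x))
      = of_real (1 / sqrt (2 * pi)) * (gaussian lam (of_real x) * char_exp k (of_real x))"
      by (simp only: gaussian_of_real scaleR_conv_of_real of_real_mult mult.assoc add_0_left)
  qed
  also have "\<bar>c\<bar> *\<^sub>R (LINT x|lborel. of_real (1 / sqrt (2 * pi)) * (gaussian lam (of_real x) * char_exp k (of_real x)))
     = of_real (c / sqrt (2 * pi)) * (LINT x|lborel. gaussian lam (of_real x) * char_exp k (of_real x))"
    using c by (simp only: integral_mult_right_zero) (simp add: scaleR_conv_of_real)
  also have "c / sqrt (2 * pi) = sqrt lam" by (simp add: c_def real_sqrt_mult)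
  finally have "of_real (sqrt lam) * (LINT x|lborel. gaussian lam (of_real x) * char_exp k (of_real x)) = of_real (exp (- t\<^sup>2 / 2))"
    by (simp add: char_std_normal_distribution)
  also have "- t\<^sup>2 / 2 = - pi * (real_of_int k)\<^sup>2 / lam"
  proof -
    have "t\<^sup>2 = (2 * pi * real_of_int k)\<^sup>2 / (2 * pi * lam)"
      by (simp only: t_def power_divide c(2))
    then show ?thesis using assms by (simp add: power_mult_distrib power2_eq_square)
  qed
  finally have eq: "of_real (sqrt lam) * (LINT x|lborel. gaussian lam (of_real x) * char_exp k (of_real x))
      = of_real (exp (- pi * (real_of_int k)\<^sup>2 / lam))" .
  have "lam powr (-1/2) * sqrt lam = 1"
    using assms by (simp add: powr_minus powr_half_sqrt)
  then have cancel: "of_real (lam powr (-1/2)) * (of_real (sqrt lam) * u) = u" for u :: complex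
    by (metis mult.assoc mult_1 of_real_1 of_real_mult)
  show ?thesis using arg_cong[OF eq, of "\<lambda>u. of_real (lam powr (-1/2)) * u"]
    unfolding cancel by (simp only: of_real_mult)
qed

text \<open>
  Unfolding: the integrals of the translates over \<open>[-1/2, 1/2]\<close> are integrals over consecutive unit
  intervals, because \<open>e(k x)\<close> has period 1.  With an entire primitive of the integrand they telescope.
\<close>
lemma fourier_coefficient_periodized_gaussian:
  assumes "lam > 0"
  shows "integral {-1/2..1/2} (\<lambda>x. (\<Sum>\<^sub>\<infinity>n::int. gaussian lam (of_real x + of_int n)) * char_exp k (of_real x))
    = (LINT x|lborel. gaussian lam (of_real x) * char_exp k (of_real x))"
proof -
  define h where "h = (\<lambda>z. gaussian lam z * char_exp k z)"
  have holh: "h holomorphic_on UNIV"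
    unfolding h_def gaussian_def char_exp_def by (intro holomorphic_intros)
  obtain H where H: "\<And>z. (H has_field_derivative h z) (at z)"
    using holomorphic_convex_primitive'[OF _ _ holh] by auto
  have conth: "continuous_on A (\<lambda>x. h (of_real x))" for A
    unfolding h_def gaussian_def char_exp_def by (intro continuous_intros)
  define b where "b = (\<lambda>N::nat. real N + 1 / 2)"

  have "uniform_limit {-1/2..1/2} (\<lambda>X x. \<Sum>n\<in>X. gaussian lam (of_real x + of_int n) * char_exp k (of_real x))
      (\<lambda>x. \<Sum>\<^sub>\<infinity>n. gaussian lam (of_real x + of_int n) * char_exp k (of_real x)) (finite_subsets_at_top UNIV)"
  proof (rule Weierstrass_m_test_general[OF _ summable_gaussian_bound[OF assms, of 1]])
    fix n :: int and x :: real
    assume "x \<in> {-1/2..1/2}"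
    then have "norm (complex_of_real x) \<le> 1" by (simp add: abs_le_iff)
    from norm_gaussian_shift_le[OF assms this, of n]
    show "norm (gaussian lam (of_real x + of_int n) * char_exp k (of_real x))
      \<le> exp (pi * lam * 1\<^sup>2) * ((1 + \<bar>real_of_int n\<bar> ^ 3) * exp (- (pi * lam / 2) * (real_of_int n)\<^sup>2))"
      by (simp only: norm_mult norm_char_exp_of_real mult_1_right)
  qed
  then have "uniform_limit {-1/2..1/2} (\<lambda>N x. \<Sum>n=-int N..int N. h (of_real x + of_int n))
      (\<lambda>x. (\<Sum>\<^sub>\<infinity>n::int. gaussian lam (of_real x + of_int n)) * char_exp k (of_real x)) sequentially"
    using filterlim_compose[OF _ filterlim_symmetric_intervals]
    by (simp add: h_def char_exp_of_real_shift infsum_cmult_left')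
  then obtain I J where IJ:
    "\<And>N. ((\<lambda>x. \<Sum>n=-int N..int N. h (of_real x + of_int n)) has_integral I N) {-1/2..1/2}"
    "((\<lambda>x. (\<Sum>\<^sub>\<infinity>n::int. gaussian lam (of_real x + of_int n)) * char_exp k (of_real x)) has_integral J) {-1/2..1/2}"
    "I \<longlonglongrightarrow> J"
  proof (rule uniform_limit_integral)
    show "continuous_on {-1/2..1/2} (\<lambda>x. \<Sum>n=-int N..int N. h (of_real x + of_int n))" for N
      unfolding h_def gaussian_def char_exp_def by (intro continuous_intros)
  qed auto
  have I: "I N = H (of_real (b N)) - H (of_real (- b N))" for N
  proof -
    have "((\<lambda>x. \<Sum>n=-int N..int N. h (of_real x + of_int n)) has_integral
       (\<Sum>n=-int N..int N. H (of_real (1/2) + of_int n) - H (of_real (-1/2) + of_int n))) {-1/2..1/2}"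
    proof (intro has_integral_sum)
      fix n :: int
      have "((\<lambda>z. H (z + of_int n)) has_field_derivative h (z + of_int n) * 1) (at z)" for z
        by (rule DERIV_chain2[OF H]) (auto intro!: derivative_eq_intros)
      then show "((\<lambda>x. h (of_real x + of_int n)) has_integral (H (of_real (1/2) + of_int n) - H (of_real (-1/2) + of_int n))) {-1/2..1/2}"
        by (intro has_integral_complex_FTC) auto
    qed auto
    also have "(\<Sum>n=-int N..int N. H (of_real (1/2) + of_int n) - H (of_real (-1/2) + of_int n)) = H (of_real (b N)) - H (of_real (- b N))"
    proof (induction N)
      case (Suc N)
      have shifts: "of_real (-1/2) + of_int (int (Suc N)) = (of_real (b N) :: complex)"
        "of_real (1/2) + of_int (int (Suc N)) = (of_real (b (Suc N)) :: complex)"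
        "of_real (1/2) + of_int (- int (Suc N)) = (of_real (- b N) :: complex)"
        "of_real (-1/2) + of_int (- int (Suc N)) = (of_real (- b (Suc N)) :: complex)"
        by (simp_all add: b_def)
      show ?case
        by (simp only: sum_symmetric_Suc Suc shifts) simp
    qed (simp add: b_def)
    finally show ?thesis by (rule has_integral_unique[OF IJ(1)])
  qed
  have "(\<lambda>N. LINT x|lborel. indicator {- b N..b N} x *\<^sub>R h (of_real x)) \<longlonglongrightarrow> (LINT x|lborel. 1 *\<^sub>R h (of_real x))"
  proof (rule integral_dominated_convergence[where w = "\<lambda>x. norm (h (of_real x))"])
    show "AE x in lborel. (\<lambda>N. indicator {- b N..b N} x *\<^sub>R h (of_real x)) \<longlonglongrightarrow> 1 *\<^sub>R h (of_real x)"
    proof (intro AE_I2 tendsto_intros tendsto_eventually)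
      fix x :: real
      show "\<forall>\<^sub>F N in sequentially. indicator {- b N..b N} x = (1 :: real)"
        using eventually_ge_at_top[of "nat \<lceil>\<bar>x\<bar>\<rceil>"]
        by eventually_elim (auto simp: b_def indicator_def nat_le_iff ceiling_le_iff abs_le_iff)
    qed
    show "integrable lborel (\<lambda>x. norm (h (of_real x)))"
      unfolding h_def by (intro integrable_norm integrable_gaussian_char_exp assms)
  qed (use borel_measurable_continuous_onI[OF conth] in \<open>auto simp: indicator_def\<close>)
  moreover have "(LINT x|lborel. indicator {- b N..b N} x *\<^sub>R h (of_real x)) = I N" for N
    unfolding I
  proof (rule integral_FTC_atLeastAtMost[OF _ _ conth])
    show "((\<lambda>x. H (of_real x)) has_vector_derivative h (of_real x)) (at x within {- b N..b N})" for x
      using has_vector_derivative_real_field[OF H] by (rule has_vector_derivative_at_within)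
  qed (simp add: b_def)
  ultimately have "I \<longlonglongrightarrow> (LINT x|lborel. h (of_real x))" by simp
  then have "J = (LINT x|lborel. h (of_real x))"
    using IJ(3) LIMSEQ_unique by blast
  then show ?thesis using integral_unique[OF IJ(2)] by (simp add: h_def)
qed

lemma has_sum_gaussian_int:
  assumes "lam > 0"
  shows "((\<lambda>n::int. gaussian lam (of_int n)) has_sum (\<Sum>\<^sub>\<infinity>n::int. gaussian lam (of_int n))) UNIV"
proof -
  have "(\<lambda>n::int. norm (gaussian lam (of_int n))) summable_on UNIV"
    by (rule summable_on_comparison_test[OF summable_gaussian_bound[OF assms, of 0]])
       (use norm_gaussian_shift_le[OF assms, of 0 0] in auto)
  then show ?thesis by (rule has_sum_infsum[OF abs_summable_summable])
qed

text \<open>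
  Poisson summation for the Gaussian: the periodisation at 0 is the sum of its Fourier coefficients.
\<close>
theorem theta_transformation:
  assumes "lam > 0"
  shows "((\<lambda>n::int. exp (- (pi * lam) * (real_of_int n)\<^sup>2)) has_sum
           lam powr (-1/2) * Re (theta3 0 (\<i> * of_real (inverse lam)))) UNIV"
proof -
  define \<phi> where "\<phi> = (\<lambda>z. \<Sum>\<^sub>\<infinity>n::int. gaussian lam (z + of_int n))"
  have hol: "\<phi> holomorphic_on UNIV"
    unfolding \<phi>_def
  proof (rule entire_infsum(1))
    show "(\<lambda>z. gaussian lam (z + of_int n)) holomorphic_on UNIV" for n
      unfolding gaussian_def by (intro holomorphic_intros)
    fix R :: real
    show "\<exists>M. M summable_on UNIV \<and> (\<forall>n z. norm z \<le> R \<longrightarrow> norm (gaussian lam (z + of_int n)) \<le> M n)"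
      using norm_gaussian_shift_le[OF assms] summable_gaussian_bound[OF assms, of R] by blast
  qed
  define d where "d = (\<lambda>k::int. complex_of_real (exp (- pi * (real_of_int k)\<^sup>2 / lam)))"
  have "(\<lambda>K::nat. \<Sum>k=-int K..int K. of_real (lam powr (-1/2)) * d k) \<longlonglongrightarrow> \<phi> 0"
    using fourier_series_tendsto_at_0[OF hol] fourier_coefficient_periodized_gaussian[OF assms]
    by (simp add: \<phi>_def fourier_transform_gaussian[OF assms] d_def)
  moreover have "(d has_sum theta3 0 (\<i> * of_real (inverse lam))) UNIV"
  proof -
    have "exp (of_real pi * \<i> * (\<i> * of_real (inverse lam))) powi (k\<^sup>2) * exp (2 * of_real pi * \<i> * (of_int k * 0)) = d k" for k
    proof -
      have "exp (of_real pi * \<i> * (\<i> * of_real (inverse lam))) powi (k\<^sup>2) = exp (of_int (k\<^sup>2) * (of_real pi * \<i> * (\<i> * of_real (inverse lam))))"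
        by (simp add: exp_power_int)
      also have "of_int (k\<^sup>2) * (of_real pi * \<i> * (\<i> * of_real (inverse lam))) = complex_of_real (- pi * (real_of_int k)\<^sup>2 / lam)"
        by (simp add: field_simps flip: mult.assoc)
      finally show ?thesis by (simp only: d_def exp_of_real) simp
    qed
    then have "theta3 0 (\<i> * of_real (inverse lam)) = infsum d UNIV"
      by (simp only: theta3_def)
    moreover have "((\<lambda>k::int. gaussian (inverse lam) (of_int k)) has_sum (\<Sum>\<^sub>\<infinity>k::int. gaussian (inverse lam) (of_int k))) UNIV"
      using assms by (intro has_sum_gaussian_int) simp
    moreover have "gaussian (inverse lam) (of_int k) = d k" for k
      using gaussian_of_real[of "inverse lam" "real_of_int k"] by (simp add: d_def field_simps)
    ultimately show ?thesis by simp
  qed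
  then have "((\<lambda>k. of_real (lam powr (-1/2)) * d k) has_sum of_real (lam powr (-1/2)) * theta3 0 (\<i> * of_real (inverse lam))) UNIV"
    by (rule has_sum_cmult_right)
  then have "(\<lambda>K::nat. \<Sum>k=-int K..int K. of_real (lam powr (-1/2)) * d k) \<longlonglongrightarrow> of_real (lam powr (-1/2)) * theta3 0 (\<i> * of_real (inverse lam))"
    by (rule has_sum_imp_symmetric_limit)
  ultimately have "\<phi> 0 = of_real (lam powr (-1/2)) * theta3 0 (\<i> * of_real (inverse lam))"
    by (rule LIMSEQ_unique)
  then have "((\<lambda>n::int. gaussian lam (of_int n)) has_sum of_real (lam powr (-1/2)) * theta3 0 (\<i> * of_real (inverse lam))) UNIV"
    using has_sum_gaussian_int[OF assms] by (simp add: \<phi>_def)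
  then have "((\<lambda>n::int. Re (gaussian lam (of_int n))) has_sum Re (of_real (lam powr (-1/2)) * theta3 0 (\<i> * of_real (inverse lam)))) UNIV"
    by (rule has_sum_Re)
  moreover have "Re (gaussian lam (of_int n)) = exp (- (pi * lam) * (real_of_int n)\<^sup>2)" for n
    using gaussian_of_real[of lam "real_of_int n"] by simp
  ultimately show ?thesis by simp
qed

section \<open>The majorant as a Hermite interpolant\<close>

lemma norm_infsum_le_infsum:
  fixes f :: "'i \<Rightarrow> complex"
  assumes "\<And>i. norm (f i) \<le> g i" "g summable_on UNIV"
  shows "f summable_on UNIV" "norm (infsum f UNIV) \<le> infsum g UNIV"
proof -
  have "(\<lambda>i. norm (f i)) summable_on UNIV"
    by (rule summable_on_comparison_test[OF assms(2)]) (use assms(1) in auto)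
  then show "f summable_on UNIV" by (rule abs_summable_summable)
  then show "norm (infsum f UNIV) \<le> infsum g UNIV"
    by (intro norm_infsum_le[OF has_sum_infsum has_sum_infsum[OF assms(2)]] assms(1))
qed

lemma deriv_gaussian: "deriv (gaussian lam) z = - 2 * of_real (pi * lam) * z * gaussian lam z"
  unfolding gaussian_def by (rule DERIV_imp_deriv) (auto intro!: derivative_eq_intros)

text \<open>
  The kernels \<open>csinc\<^sup>2\<close> and \<open>w csinc\<^sup>2\<close> are the Hermite basis for the integers: at 0 they have value and
  derivative \<open>(1, 0)\<close> and \<open>(0, 1)\<close>, and at all other integers both vanish doubly.
\<close>
definition hermite_term :: "real \<Rightarrow> int \<Rightarrow> complex \<Rightarrow> complex" where
  "hermite_term lam m z = gaussian lam (of_int m) * (csinc (z - of_int m))\<^sup>2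
     + deriv (gaussian lam) (of_int m) * ((z - of_int m) * (csinc (z - of_int m))\<^sup>2)"

definition hermite_interpolant :: "real \<Rightarrow> complex \<Rightarrow> complex" where
  "hermite_interpolant lam z = (\<Sum>\<^sub>\<infinity>m. hermite_term lam m z)"

text \<open>
  One weight for all the estimates: it dominates \<open>|m|\<^sup>k G(m)\<close> for \<open>k \<le> 3\<close>, where the third power comes from
  \<open>m\<^sup>2 G'(m)\<close> in the decay estimate.
\<close>
definition gaussian_weight :: "real \<Rightarrow> int \<Rightarrow> real" where
  "gaussian_weight lam m = (1 + \<bar>real_of_int m\<bar> ^ 3) * exp (- (pi * lam) * (real_of_int m)\<^sup>2)"

lemma summable_gaussian_weight: "lam > 0 \<Longrightarrow> gaussian_weight lam summable_on UNIV"
  unfolding gaussian_weight_def by (intro summable_on_cubic_gaussian) simp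

lemma gaussian_weight_bounds:
  fixes m :: int
  shows "norm (gaussian lam (of_int m)) = exp (- (pi * lam) * (real_of_int m)\<^sup>2)"
    and "lam > 0 \<Longrightarrow> norm (deriv (gaussian lam) (of_int m)) = 2 * pi * lam * \<bar>real_of_int m\<bar> * exp (- (pi * lam) * (real_of_int m)\<^sup>2)"
  by (simp_all add: norm_gaussian deriv_gaussian norm_mult)

lemma abs_powers_le_cube:
  fixes x :: real
  assumes "x \<ge> 0"
  shows "x \<le> 1 + x ^ 3" "x\<^sup>2 \<le> 1 + x ^ 3"
proof -
  show "x\<^sup>2 \<le> 1 + x ^ 3"
  proof (cases "x \<le> 1")
    case True
    then have "x\<^sup>2 \<le> 1" using assms by (simp add: power_le_one)
    then show ?thesis using assms by (simp add: add_increasing2)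
  next
    case False
    then have "x\<^sup>2 \<le> x ^ 3" by (intro power_increasing) auto
    then show ?thesis by simp
  qed
  show "x \<le> 1 + x ^ 3"
  proof (cases "x \<le> 1")
    case True
    then show ?thesis using assms by (simp add: add_increasing2)
  next
    case False
    then have "x ^ 1 \<le> x ^ 3" by (intro power_increasing) auto
    then show ?thesis by simp
  qed
qed

lemma gaussian_le_weight:
  fixes m :: int
  shows "norm (gaussian lam (of_int m)) \<le> gaussian_weight lam m"
    and "lam > 0 \<Longrightarrow> norm (deriv (gaussian lam) (of_int m)) \<le> 2 * pi * lam * gaussian_weight lam m"
proof -
  show "norm (gaussian lam (of_int m)) \<le> gaussian_weight lam m"
    unfolding gaussian_weight_bounds gaussian_weight_def by simp
  assume "lam > 0"
  have "\<bar>real_of_int m\<bar> * exp (- (pi * lam) * (real_of_int m)\<^sup>2) \<le> gaussian_weight lam m"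
    unfolding gaussian_weight_def by (intro mult_right_mono abs_powers_le_cube) auto
  with \<open>lam > 0\<close> show "norm (deriv (gaussian lam) (of_int m)) \<le> 2 * pi * lam * gaussian_weight lam m"
    unfolding gaussian_weight_bounds(2)[OF \<open>lam > 0\<close>] by simp
qed

lemma hermite_kernel_bounds:
  obtains A where "A > 0" "\<And>w. norm ((csinc w)\<^sup>2) \<le> A * exp (2 * pi * \<bar>Im w\<bar>)"
    "\<And>w. norm (w * (csinc w)\<^sup>2) \<le> A * exp (2 * pi * \<bar>Im w\<bar>)"
proof -
  obtain C where C: "C > 0" "\<And>z. norm (csinc z) \<le> C * exp (pi * \<bar>Im z\<bar>)" by (rule csinc_bound) auto
  define A where "A = C\<^sup>2 + C"
  have ee: "exp (pi * \<bar>Im w\<bar>) * exp (pi * \<bar>Im w\<bar>) = exp (2 * pi * \<bar>Im w\<bar>)" for w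
    by (simp flip: exp_add)
  have 1: "norm ((csinc w)\<^sup>2) \<le> A * exp (2 * pi * \<bar>Im w\<bar>)" for w
  proof -
    have "norm ((csinc w)\<^sup>2) \<le> (C * exp (pi * \<bar>Im w\<bar>))\<^sup>2"
      unfolding norm_power by (rule power_mono[OF C(2) norm_ge_zero])
    also have "\<dots> = C\<^sup>2 * exp (2 * pi * \<bar>Im w\<bar>)"
      unfolding power_mult_distrib ee [symmetric] by (simp only: power2_eq_square)
    also have "\<dots> \<le> A * exp (2 * pi * \<bar>Im w\<bar>)"
      using C(1) by (intro mult_right_mono) (auto simp: A_def)
    finally show ?thesis .
  qed
  have 2: "norm (w * (csinc w)\<^sup>2) \<le> A * exp (2 * pi * \<bar>Im w\<bar>)" for w
  proof -
    have "norm (w * csinc w) \<le> norm (of_real pi * w * csinc w)"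
      using pi_gt3 mult_right_mono[of 1 pi "norm (w * csinc w)"] by (simp add: norm_mult mult.assoc)
    also have "\<dots> \<le> exp (pi * \<bar>Im w\<bar>)"
      using norm_sin_pi_le[of w] by (simp add: sin_pi_eq_csinc)
    finally have "norm (w * csinc w) * norm (csinc w) \<le> exp (pi * \<bar>Im w\<bar>) * (C * exp (pi * \<bar>Im w\<bar>))"
      using C(2)[of w] by (intro mult_mono) auto
    also have "\<dots> = C * exp (2 * pi * \<bar>Im w\<bar>)"
      unfolding ee [symmetric] by (simp only: mult_ac)
    also have "\<dots> \<le> A * exp (2 * pi * \<bar>Im w\<bar>)"
      by (intro mult_right_mono) (auto simp: A_def)
    finally show ?thesis by (simp only: norm_mult [symmetric] power2_eq_square mult.assoc)
  qed
  have "A > 0" using C(1) by (auto simp: A_def intro!: add_pos_pos)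
  with 1 2 show ?thesis by (intro that)
qed

lemma norm_hermite_term_le:
  assumes "lam > 0"
  obtains A where "A > 0" "\<And>m z. norm (hermite_term lam m z) \<le> A * exp (2 * pi * \<bar>Im z\<bar>) * gaussian_weight lam m"
proof -
  obtain A where A: "A > 0" "\<And>w. norm ((csinc w)\<^sup>2) \<le> A * exp (2 * pi * \<bar>Im w\<bar>)"
    "\<And>w. norm (w * (csinc w)\<^sup>2) \<le> A * exp (2 * pi * \<bar>Im w\<bar>)" by (rule hermite_kernel_bounds) blast
  have "norm (hermite_term lam m z) \<le> (A + A * (2 * pi * lam)) * exp (2 * pi * \<bar>Im z\<bar>) * gaussian_weight lam m" for m z
  proof -
    define w where "w = z - of_int m"
    have Im: "Im w = Im z" by (simp add: w_def)
    have "norm (hermite_term lam m z) \<le> norm (gaussian lam (of_int m)) * norm ((csinc w)\<^sup>2)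
        + norm (deriv (gaussian lam) (of_int m)) * norm (w * (csinc w)\<^sup>2)"
      unfolding hermite_term_def w_def [symmetric] norm_mult [symmetric] by (rule norm_triangle_ineq)
    also have "\<dots> \<le> gaussian_weight lam m * (A * exp (2 * pi * \<bar>Im z\<bar>))
        + (2 * pi * lam * gaussian_weight lam m) * (A * exp (2 * pi * \<bar>Im z\<bar>))"
      unfolding Im [symmetric]
      using assms A(1) by (intro add_mono mult_mono A gaussian_le_weight) (auto simp: gaussian_weight_def)
    finally show ?thesis by (simp add: algebra_simps)
  qed
  then show ?thesis
    using A(1) assms by (intro that[of "A + A * (2 * pi * lam)"]) (auto intro!: add_pos_pos)
qed

lemma holomorphic_hermite_term: "hermite_term lam m holomorphic_on A"
  unfolding hermite_term_def by (intro holomorphic_intros)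

lemma hermite_interpolant_dominated:
  assumes "lam > 0" "R > 0"
  shows "\<exists>M. M summable_on UNIV \<and> (\<forall>m z. norm z \<le> R \<longrightarrow> norm (hermite_term lam m z) \<le> M m)"
proof -
  obtain A where A: "A > 0" "\<And>m z. norm (hermite_term lam m z) \<le> A * exp (2 * pi * \<bar>Im z\<bar>) * gaussian_weight lam m"
    using norm_hermite_term_le[OF assms(1)] by blast
  have "norm (hermite_term lam m z) \<le> A * exp (2 * pi * R) * gaussian_weight lam m" if "norm z \<le> R" for m z
  proof -
    have "exp (2 * pi * \<bar>Im z\<bar>) \<le> exp (2 * pi * R)"
      using that abs_Im_le_cmod[of z] by simp
    then have "A * exp (2 * pi * \<bar>Im z\<bar>) * gaussian_weight lam m \<le> A * exp (2 * pi * R) * gaussian_weight lam m"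
      using A(1) by (intro mult_right_mono mult_left_mono) (auto simp: gaussian_weight_def)
    with A(2)[of m z] show ?thesis by linarith
  qed
  moreover have "(\<lambda>m. A * exp (2 * pi * R) * gaussian_weight lam m) summable_on UNIV"
    by (intro summable_on_cmult_right summable_gaussian_weight assms)
  ultimately show ?thesis by blast
qed

lemma holomorphic_hermite_interpolant:
  "lam > 0 \<Longrightarrow> hermite_interpolant lam holomorphic_on UNIV"
  unfolding hermite_interpolant_def
  by (rule entire_infsum(1)[OF holomorphic_hermite_term hermite_interpolant_dominated])

lemma norm_hermite_interpolant_le:
  assumes "lam > 0"
  obtains A where "A > 0" "\<And>z. norm (hermite_interpolant lam z) \<le> A * exp (2 * pi * \<bar>Im z\<bar>)"
proof -
  obtain A where A: "A > 0" "\<And>m z. norm (hermite_term lam m z) \<le> A * exp (2 * pi * \<bar>Im z\<bar>) * gaussian_weight lam m"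
    using norm_hermite_term_le[OF assms(1)] by blast
  define W where "W = infsum (gaussian_weight lam) UNIV"
  have "W \<ge> 0" unfolding W_def by (rule infsum_nonneg) (simp add: gaussian_weight_def)
  have "norm (hermite_interpolant lam z) \<le> A * (W + 1) * exp (2 * pi * \<bar>Im z\<bar>)" for z
  proof -
    have "norm (hermite_interpolant lam z) \<le> (\<Sum>\<^sub>\<infinity>m. A * exp (2 * pi * \<bar>Im z\<bar>) * gaussian_weight lam m)"
      unfolding hermite_interpolant_def
      by (intro norm_infsum_le_infsum A summable_on_cmult_right summable_gaussian_weight assms)
    also have "\<dots> = A * exp (2 * pi * \<bar>Im z\<bar>) * W"
      unfolding W_def by (rule infsum_cmult_right')
    also have "\<dots> \<le> A * exp (2 * pi * \<bar>Im z\<bar>) * (W + 1)"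
      using A(1) by (intro mult_left_mono) auto
    finally show ?thesis by (simp only: mult_ac)
  qed
  then show ?thesis using \<open>W \<ge> 0\<close> A(1) by (intro that[of "A * (W + 1)"]) auto
qed

lemma hermite_interpolant_of_int:
  "hermite_interpolant lam (of_int n) = gaussian lam (of_int n)"
proof -
  have "hermite_term lam m (of_int n) = (if m = n then gaussian lam (of_int n) else 0)" for m
    using csinc_of_int[of "n - m"] by (auto simp: hermite_term_def)
  then have "((\<lambda>m. hermite_term lam m (of_int n)) has_sum gaussian lam (of_int n)) UNIV"
    by (intro has_sum_finite_neutralI[of "{n}"]) auto
  then show ?thesis unfolding hermite_interpolant_def by (rule infsumI)
qed

lemma deriv_hermite_interpolant_of_int:
  assumes "lam > 0"
  shows "deriv (hermite_interpolant lam) (of_int n) = deriv (gaussian lam) (of_int n)"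
proof -
  have D: "deriv (hermite_term lam m) (of_int n) = (if m = n then deriv (gaussian lam) (of_int n) else 0)" for m
  proof (rule DERIV_imp_deriv)
    define s' where "s' = deriv csinc (of_int n - of_int m)"
    have s': "m = n \<Longrightarrow> s' = 0" using DERIV_imp_deriv[OF DERIV_csinc_0] by (simp add: s'_def)
    have s: "m \<noteq> n \<Longrightarrow> csinc (of_int n - of_int m) = 0" using csinc_of_int[of "n - m"] by simp
    have "((\<lambda>z. csinc (z - of_int m)) has_field_derivative s' * 1) (at (of_int n))"
      unfolding s'_def
      by (rule DERIV_chain2[OF holomorphic_derivI[OF holomorphic_csinc]]) (auto intro!: derivative_eq_intros)
    then show "(hermite_term lam m has_field_derivative (if m = n then deriv (gaussian lam) (of_int n) else 0)) (at (of_int n))"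
      unfolding hermite_term_def using s s'
      by (auto intro!: derivative_eq_intros)
  qed
  have "((\<lambda>m. deriv (hermite_term lam m) (of_int n)) has_sum deriv (hermite_interpolant lam) (of_int n)) UNIV"
    unfolding hermite_interpolant_def
    by (rule entire_infsum(2)[OF holomorphic_hermite_term hermite_interpolant_dominated[OF assms]])
  moreover have "((\<lambda>m. deriv (hermite_term lam m) (of_int n)) has_sum deriv (gaussian lam) (of_int n)) UNIV"
    unfolding D by (intro has_sum_finite_neutralI[of "{n}"]) auto
  ultimately show ?thesis by (rule has_sum_unique)
qed

lemma summable_hermite_parts:
  assumes "lam > 0"
  shows "(\<lambda>m. gaussian lam (of_int m) * (csinc (z - of_int m))\<^sup>2) summable_on UNIV"
    and "(\<lambda>m. deriv (gaussian lam) (of_int m) * ((z - of_int m) * (csinc (z - of_int m))\<^sup>2)) summable_on UNIV"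
proof -
  obtain A where A: "A > 0" "\<And>w. norm ((csinc w)\<^sup>2) \<le> A * exp (2 * pi * \<bar>Im w\<bar>)"
    "\<And>w. norm (w * (csinc w)\<^sup>2) \<le> A * exp (2 * pi * \<bar>Im w\<bar>)" by (rule hermite_kernel_bounds) blast
  define e where "e = A * exp (2 * pi * \<bar>Im z\<bar>)"
  have e: "e \<ge> 0" "\<And>m::int. norm ((csinc (z - of_int m))\<^sup>2) \<le> e"
    "\<And>m::int. norm ((z - of_int m) * (csinc (z - of_int m))\<^sup>2) \<le> e"
    using A(1) A(2,3)[of "z - of_int _"] by (simp_all add: e_def)
  have W: "(\<lambda>m. c * gaussian_weight lam m * e) summable_on UNIV" for c
    by (intro summable_on_cmult_left summable_on_cmult_right summable_gaussian_weight assms)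
  show "(\<lambda>m. gaussian lam (of_int m) * (csinc (z - of_int m))\<^sup>2) summable_on UNIV"
  proof (rule norm_infsum_le_infsum(1)[OF _ W])
    show "norm (gaussian lam (of_int m) * (csinc (z - of_int m))\<^sup>2) \<le> 1 * gaussian_weight lam m * e" for m
      unfolding norm_mult[of "gaussian lam _"] mult_1
      by (intro mult_mono gaussian_le_weight e) (auto simp: gaussian_weight_def)
  qed
  show "(\<lambda>m. deriv (gaussian lam) (of_int m) * ((z - of_int m) * (csinc (z - of_int m))\<^sup>2)) summable_on UNIV"
  proof (rule norm_infsum_le_infsum(1)[OF _ W])
    show "norm (deriv (gaussian lam) (of_int m) * ((z - of_int m) * (csinc (z - of_int m))\<^sup>2)) \<le> (2 * pi * lam) * gaussian_weight lam m * e" for m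
      unfolding norm_mult[of "deriv (gaussian lam) _"] using assms
      by (intro mult_mono gaussian_le_weight e) (auto simp: gaussian_weight_def)
  qed
qed

text \<open>
  Off the integers \<open>(sin \<pi>z)\<^sup>2 / \<pi>\<^sup>2\<close> can be moved into the two series, by periodicity of the squared
  sine.  Since the resulting series is entire, removing the singularities produces it everywhere.
\<close>
lemma gaussian_majorant_eq_hermite_interpolant:
  assumes "lam > 0"
  shows "gaussian_majorant lam = hermite_interpolant lam"
proof
  fix c :: complex
  let ?f = "\<lambda>z. (sin (of_real pi * z) / of_real pi)\<^sup>2 *
     ((\<Sum>\<^sub>\<infinity>m::int. gaussian lam (of_int m) / (z - of_int m)\<^sup>2) +
      (\<Sum>\<^sub>\<infinity>n::int. deriv (gaussian lam) (of_int n) / (z - of_int n)))"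
  have eq: "?f z = hermite_interpolant lam z" if z: "z \<notin> range of_int" for z
  proof -
    define q where "q = (sin (of_real pi * z) / of_real pi)\<^sup>2"
    have nz: "z - of_int m \<noteq> 0" for m using z by auto
    have qs: "(csinc (z - of_int m))\<^sup>2 = q / (z - of_int m)\<^sup>2" for m
    proof -
      have "(sin (of_real pi * z))\<^sup>2 = (of_real pi * (z - of_int m) * csinc (z - of_int m))\<^sup>2"
        by (metis sin_pi_shift_squared sin_pi_eq_csinc)
      then show ?thesis using nz[of m] by (simp add: q_def power_divide power_mult_distrib)
    qed
    have "hermite_interpolant lam z
      = (\<Sum>\<^sub>\<infinity>m. gaussian lam (of_int m) * (csinc (z - of_int m))\<^sup>2)
        + (\<Sum>\<^sub>\<infinity>m. deriv (gaussian lam) (of_int m) * ((z - of_int m) * (csinc (z - of_int m))\<^sup>2))"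
      unfolding hermite_interpolant_def hermite_term_def by (intro infsum_add summable_hermite_parts assms)
    also have "\<dots> = (\<Sum>\<^sub>\<infinity>m. q * (gaussian lam (of_int m) / (z - of_int m)\<^sup>2))
        + (\<Sum>\<^sub>\<infinity>m. q * (deriv (gaussian lam) (of_int m) / (z - of_int m)))"
      using nz unfolding qs by (intro arg_cong2[where f = "(+)"] infsum_cong) (auto simp: power2_eq_square)
    also have "\<dots> = ?f z"
      unfolding infsum_cmult_right' q_def by (simp only: distrib_left)
    finally show ?thesis by simp
  qed
  have "closed (of_int ` {n. of_int n \<noteq> c} :: complex set)" by (rule closed_of_int_image)
  then have "\<forall>\<^sub>F z in at c. z \<in> - (of_int ` {n. of_int n \<noteq> c}) - {c}"
    by (intro eventually_at_in_open) auto
  then have "\<forall>\<^sub>F z in at c. hermite_interpolant lam z = ?f z"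
  proof (rule eventually_mono)
    fix z assume "z \<in> - (of_int ` {n. of_int n \<noteq> c}) - {c}"
    then have "z \<notin> range of_int" by auto
    from eq[OF this] show "hermite_interpolant lam z = ?f z" by (rule sym)
  qed
  moreover have "hermite_interpolant lam \<midarrow>c\<rightarrow> hermite_interpolant lam c"
    using holomorphic_hermite_interpolant[OF assms]
    by (metis continuous_on_eq_continuous_at holomorphic_on_imp_continuous_on isCont_def open_UNIV UNIV_I)
  ultimately have "?f \<midarrow>c\<rightarrow> hermite_interpolant lam c"
    by (rule Lim_transform_eventually[rotated])
  then show "gaussian_majorant lam c = hermite_interpolant lam c"
    unfolding gaussian_majorant_def by (rule remove_sings_eqI)
qed

text \<open>
  The derivative of the Gaussian is odd.
\<close>
lemma infsum_deriv_gaussian_eq_0: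
  "(\<Sum>\<^sub>\<infinity>m::int. deriv (gaussian lam) (of_int m)) = 0"
proof -
  have "(\<Sum>\<^sub>\<infinity>m::int. deriv (gaussian lam) (of_int m)) = (\<Sum>\<^sub>\<infinity>m::int. deriv (gaussian lam) (of_int (- m)))"
    by (rule infsum_reindex_bij_betw [symmetric]) (auto intro!: bij_betwI[where g = uminus])
  also have "\<dots> = (\<Sum>\<^sub>\<infinity>m::int. - deriv (gaussian lam) (of_int m))"
    by (simp add: deriv_gaussian gaussian_def)
  also have "\<dots> = - (\<Sum>\<^sub>\<infinity>m::int. deriv (gaussian lam) (of_int m))"
    by (rule infsum_uminus)
  finally show ?thesis by simp
qed

text \<open>
  The terms with the squared sinc decay quadratically, but those with \<open>G'(m)\<close> only like \<open>1 / x\<close>.  Their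
  leading parts \<open>(sin \<pi>x)\<^sup>2 G'(m) / (\<pi>\<^sup>2 x)\<close> cancel in the sum because the \<open>G'(m)\<close> add up to 0; subtracting
  them termwise leaves a series that is bounded after multiplication by \<open>x\<^sup>2\<close>.
\<close>
lemma hermite_interpolant_decay:
  assumes "lam > 0"
  obtains B where "\<And>x::real. norm (hermite_interpolant lam (of_real x)) \<le> B * inverse (1 + x\<^sup>2)"
proof -
  obtain C0 where C0: "C0 > 0" "\<And>z. norm (csinc z) \<le> C0 * exp (pi * \<bar>Im z\<bar>)" by (rule csinc_bound) auto
  define C where "C = max C0 1"
  have C: "C \<ge> 1" "\<And>x::real. norm (csinc (of_real x)) \<le> C"
    using C0(2)[of "of_real _"] by (auto simp: C_def le_max_iff_disj)
  obtain A where A: "A > 0" "\<And>z. norm (hermite_interpolant lam z) \<le> A * exp (2 * pi * \<bar>Im z\<bar>)"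
    using norm_hermite_interpolant_le[OF assms] by blast
  define B1 where "B1 = 4 * C\<^sup>2 + 2 * pi * lam * (2 * C)"
  define W where "W = infsum (gaussian_weight lam) UNIV"
  have x2: "x\<^sup>2 * norm (hermite_interpolant lam (of_real x)) \<le> B1 * W" for x :: real
  proof -
    define \<tau> where "\<tau> = ((sin (of_real pi * of_real x) / of_real pi)\<^sup>2 :: complex)"
    \<comment> \<open>The subtracted terms have sum 0.  Writing \<open>x = w + m\<close> with \<open>w = x - m\<close> and \<open>t = w csinc w\<close>, so that
      \<open>\<tau> = t\<^sup>2\<close> for every \<open>m\<close>, removes all positive powers of \<open>x\<close> from what remains.\<close>
    define r where "r = (\<lambda>m::int. (of_real x)\<^sup>2 * hermite_term lam m (of_real x) - of_real x * \<tau> * deriv (gaussian lam) (of_int m))"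
    have rle: "norm (r m) \<le> B1 * gaussian_weight lam m" for m
    proof -
      define w :: complex where "w = of_real x - of_int m"
      define s where "s = csinc w"
      define t where "t = w * s"
      have w: "w = of_real (x - of_int m)" by (simp add: w_def)
      have xw: "of_real x = w + of_int m" by (simp add: w_def)
      have s: "norm s \<le> C" unfolding s_def w by (rule C(2))
      have t: "norm t \<le> 1"
      proof -
        have "norm t \<le> norm (of_real pi * t)" 
          using pi_gt3 mult_right_mono[of 1 pi "norm t"] by (simp add: norm_mult)
        also have "of_real pi * t = sin (of_real pi * w)" by (simp add: sin_pi_eq_csinc t_def s_def)
        also have "norm \<dots> \<le> 1" using norm_sin_pi_le[of w] by (simp add: w)
        finally show ?thesis .
      qed
      have \<tau>: "\<tau> = t\<^sup>2"
      proof -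
        have "(sin (of_real pi * of_real x))\<^sup>2 = (of_real pi * w * csinc w)\<^sup>2"
          unfolding w_def by (metis sin_pi_shift_squared sin_pi_eq_csinc)
        then show ?thesis by (simp add: \<tau>_def t_def s_def power_divide power_mult_distrib)
      qed
      define m' :: complex where "m' = of_int m"
      define a where "a = \<bar>real_of_int m\<bar>"
      have nm': "norm m' = a" by (simp add: m'_def a_def)
      have r_eq: "r m = gaussian lam (of_int m) * (t\<^sup>2 + 2 * m' * (t * s) + m'\<^sup>2 * s\<^sup>2)
          + deriv (gaussian lam) (of_int m) * (m' * t\<^sup>2 + m'\<^sup>2 * (t * s))"
        unfolding r_def hermite_term_def w_def [symmetric] \<tau> xw m'_def [symmetric] t_def s_def
        by (simp add: power2_eq_square algebra_simps)
      have "a \<ge> 0" by (simp add: a_def)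
      have ts: "norm (t * s) \<le> C" "norm (t\<^sup>2) \<le> 1" "norm (s\<^sup>2) \<le> C\<^sup>2"
        using mult_mono[OF t s] power_mono[OF t, of 2] power_mono[OF s, of 2] by (simp_all add: norm_mult norm_power)
      define b where "b = 1 + a ^ 3"
      have ab: "a \<le> b" "a\<^sup>2 \<le> b" "1 \<le> b" "a ^ 3 \<le> b"
        using abs_powers_le_cube[OF \<open>a \<ge> 0\<close>] \<open>a \<ge> 0\<close> by (auto simp: b_def)
      have CC: "C \<le> C\<^sup>2" "1 \<le> C\<^sup>2" using C(1) by (simp_all add: self_le_power one_le_power)
      define E where "E = exp (- (pi * lam) * (real_of_int m)\<^sup>2)"
      have "norm (t\<^sup>2 + 2 * m' * (t * s) + m'\<^sup>2 * s\<^sup>2) \<le> 1 + 2 * a * C + a\<^sup>2 * C\<^sup>2"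
      proof -
        have "norm (2 * m' * (t * s)) \<le> 2 * a * C" 
          unfolding norm_mult[of "2 * m'"] using ts(1) \<open>a \<ge> 0\<close> by (simp add: norm_mult[of 2] nm' mult_left_mono)
        moreover have "norm (m'\<^sup>2 * s\<^sup>2) \<le> a\<^sup>2 * C\<^sup>2"
          unfolding norm_mult using ts(3) by (simp add: norm_power nm' mult_left_mono)
        ultimately show ?thesis
          using ts(2) norm_triangle_ineq[of "t\<^sup>2 + 2 * m' * (t * s)" "m'\<^sup>2 * s\<^sup>2"] norm_triangle_ineq[of "t\<^sup>2" "2 * m' * (t * s)"]
          by linarith
      qed
      also have "\<dots> \<le> b * C\<^sup>2 + 2 * b * C\<^sup>2 + b * C\<^sup>2"
        using ab CC C(1) \<open>a \<ge> 0\<close> mult_mono[of 1 b 1 "C\<^sup>2"] by (intro add_mono mult_mono) auto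
      finally have T1: "norm (t\<^sup>2 + 2 * m' * (t * s) + m'\<^sup>2 * s\<^sup>2) \<le> 4 * C\<^sup>2 * b" by (simp add: mult_ac)
      have "norm (m' * t\<^sup>2 + m'\<^sup>2 * (t * s)) \<le> a * 1 + a\<^sup>2 * C"
      proof -
        have "norm (m' * t\<^sup>2) \<le> a * 1"
          unfolding norm_mult nm' using ts(2) \<open>a \<ge> 0\<close> by (intro mult_left_mono) auto
        moreover have "norm (m'\<^sup>2 * (t * s)) \<le> a\<^sup>2 * C"
          unfolding norm_mult[of "m'\<^sup>2"] norm_power nm' using ts(1) by (intro mult_left_mono) auto
        ultimately show ?thesis using norm_triangle_ineq[of "m' * t\<^sup>2" "m'\<^sup>2 * (t * s)"] by linarith
      qed
      then have "a * norm (m' * t\<^sup>2 + m'\<^sup>2 * (t * s)) \<le> a * (a * 1 + a\<^sup>2 * C)"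
        using \<open>a \<ge> 0\<close> by (rule mult_left_mono)
      also have "\<dots> = a\<^sup>2 * 1 + a ^ 3 * C" by (simp add: power2_eq_square power3_eq_cube algebra_simps)
      also have "\<dots> \<le> b * C + b * C"
        using ab C(1) \<open>a \<ge> 0\<close> by (intro add_mono mult_mono) auto
      finally have T2: "a * norm (m' * t\<^sup>2 + m'\<^sup>2 * (t * s)) \<le> 2 * C * b" by (simp add: mult_ac)
      have "norm (r m) \<le> norm (gaussian lam (of_int m)) * norm (t\<^sup>2 + 2 * m' * (t * s) + m'\<^sup>2 * s\<^sup>2)
          + norm (deriv (gaussian lam) (of_int m)) * norm (m' * t\<^sup>2 + m'\<^sup>2 * (t * s))"
        unfolding r_eq norm_mult [symmetric] by (rule norm_triangle_ineq)
      also have "\<dots> = E * norm (t\<^sup>2 + 2 * m' * (t * s) + m'\<^sup>2 * s\<^sup>2)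
          + 2 * pi * lam * E * (a * norm (m' * t\<^sup>2 + m'\<^sup>2 * (t * s)))"
        unfolding gaussian_weight_bounds(1) gaussian_weight_bounds(2)[OF assms] E_def a_def by (simp only: mult_ac)
      also have "\<dots> \<le> E * (4 * C\<^sup>2 * b) + 2 * pi * lam * E * (2 * C * b)"
        using assms by (intro add_mono mult_left_mono T1 T2) (auto simp: E_def)
      also have "\<dots> = B1 * gaussian_weight lam m"
        unfolding B1_def gaussian_weight_def E_def [symmetric] a_def [symmetric] b_def [symmetric]
        by (simp add: algebra_simps)
      finally show ?thesis .
    qed
    have sumd: "(\<lambda>m::int. deriv (gaussian lam) (of_int m)) summable_on UNIV"
      by (rule norm_infsum_le_infsum(1)[OF gaussian_le_weight(2)[OF assms]])
         (intro summable_on_cmult_right summable_gaussian_weight assms)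
    have sumh: "(\<lambda>m. hermite_term lam m (of_real x)) summable_on UNIV"
      unfolding hermite_term_def by (intro summable_on_add summable_hermite_parts assms)
    have "((\<lambda>m. (of_real x)\<^sup>2 * hermite_term lam m (of_real x)) has_sum (of_real x)\<^sup>2 * hermite_interpolant lam (of_real x)) UNIV"
      unfolding hermite_interpolant_def by (intro has_sum_cmult_right has_sum_infsum sumh)
    moreover have "((\<lambda>m::int. - (of_real x * \<tau>) * deriv (gaussian lam) (of_int m)) has_sum - (of_real x * \<tau>) * 0) UNIV"
      using has_sum_infsum[OF sumd] unfolding infsum_deriv_gaussian_eq_0 by (rule has_sum_cmult_right)
    ultimately have "((\<lambda>m. (of_real x)\<^sup>2 * hermite_term lam m (of_real x) + - (of_real x * \<tau>) * deriv (gaussian lam) (of_int m))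
      has_sum (of_real x)\<^sup>2 * hermite_interpolant lam (of_real x) + - (of_real x * \<tau>) * 0) UNIV"
      by (rule has_sum_add)
    then have "(r has_sum (of_real x)\<^sup>2 * hermite_interpolant lam (of_real x)) UNIV"
      by (simp add: r_def)
    then have "(of_real x)\<^sup>2 * hermite_interpolant lam (of_real x) = infsum r UNIV"
      by (rule infsumI [symmetric])
    moreover have "norm (infsum r UNIV) \<le> (\<Sum>\<^sub>\<infinity>m. B1 * gaussian_weight lam m)"
      by (rule norm_infsum_le_infsum(2)[OF rle]) (intro summable_on_cmult_right summable_gaussian_weight assms)
    ultimately have "norm ((of_real x)\<^sup>2 * hermite_interpolant lam (of_real x)) \<le> B1 * W"
      by (simp add: W_def infsum_cmult_right')
    then show ?thesis by (simp add: norm_mult norm_power)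
  qed
  show ?thesis
  proof (rule that)
    fix x :: real
    have pos: "1 + x\<^sup>2 > 0" by (simp add: add_pos_nonneg)
    have "(1 + x\<^sup>2) * norm (hermite_interpolant lam (of_real x)) \<le> A + B1 * W"
      using x2[of x] A(2)[of "of_real x"] by (simp add: distrib_right)
    then show "norm (hermite_interpolant lam (of_real x)) \<le> (A + B1 * W) * inverse (1 + x\<^sup>2)"
      using pos by (simp add: divide_inverse [symmetric] pos_le_divide_eq mult.commute)
  qed
qed

section \<open>Entire functions with double zeros at the integers\<close>

text \<open>
  The quotient \<open>T / (sin \<pi>z)\<^sup>2\<close> extends to an entire function.  It is bounded for \<open>|Im z| \<ge> 1\<close> and on
  the vertical lines through the half-integers, hence by the maximum principle also inside the
  rectangles that these lines cut out of the strip \<open>|Im z| \<le> 1\<close>.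
\<close>
lemma entire_double_zeros_eq_sin_squared:
  assumes hol: "T holomorphic_on UNIV"
    and bnd: "\<And>z. norm (T z) \<le> C * exp (2 * pi * \<bar>Im z\<bar>)" and "0 \<le> C"
    and zero: "\<And>n::int. T (of_int n) = 0" "\<And>n::int. deriv T (of_int n) = 0"
  obtains A where "\<And>z. T z = A * (sin (of_real pi * z))\<^sup>2"
proof -
  \<comment> \<open>Dividing out the zero at \<open>c\<close> twice: \<open>T(z) = (z - n)\<^sup>2 T2(z)\<close> with \<open>T2\<close> entire.\<close>
  define T1 where "T1 = (\<lambda>c z. if z = c then deriv T c else (T z - T c) / (z - c))"
  define T2 where "T2 = (\<lambda>c z. if z = c then deriv (T1 c) c else (T1 c z - T1 c c) / (z - c))"
  have hol1: "T1 c holomorphic_on UNIV" for c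
    unfolding T1_def by (intro pole_lemma_open hol) auto
  have hol2: "T2 c holomorphic_on UNIV" for c
    unfolding T2_def by (intro pole_lemma_open hol1) auto
  have T: "T z = (z - of_int n)\<^sup>2 * T2 (of_int n) z" for z n
  proof (cases "z = of_int n")
    case False
    then have "T1 (of_int n) z = (z - of_int n) * T2 (of_int n) z"
      by (simp add: T2_def) (simp add: T1_def zero)
    moreover have "T z = (z - of_int n) * T1 (of_int n) z"
      using False by (simp add: T1_def zero)
    ultimately show ?thesis by (simp add: power2_eq_square)
  qed (simp add: zero)
  \<comment> \<open>At an integer the value is the limit of the quotient there.\<close>
  define D where "D = (\<lambda>z. if sin (of_real pi * z) = 0 then T2 z z / (of_real pi)\<^sup>2 else T z / (sin (of_real pi * z))\<^sup>2)"
  have Dball: "D z = T2 (of_int n) z / (of_real pi * csinc (z - of_int n))\<^sup>2" if "z \<in> ball (of_int n) 1" for z n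
  proof -
    have nz: "csinc (z - of_int n) \<noteq> 0"
      using that by (intro csinc_nonzero) (simp add: dist_norm norm_minus_commute)
    have sq: "(sin (of_real pi * z))\<^sup>2 = (of_real pi * (z - of_int n) * csinc (z - of_int n))\<^sup>2"
      by (metis sin_pi_shift_squared sin_pi_eq_csinc)
    show ?thesis
    proof (cases "z = of_int n")
      case True
      with sq show ?thesis by (simp add: D_def)
    next
      case False
      with sq nz have "sin (of_real pi * z) \<noteq> 0" by auto
      then have "D z = T z / (of_real pi * (z - of_int n) * csinc (z - of_int n))\<^sup>2"
        unfolding D_def sq [symmetric] by simp
      also have "\<dots> = T2 (of_int n) z / (of_real pi * csinc (z - of_int n))\<^sup>2"
        unfolding T[of z n] using False by (simp add: power_mult_distrib)
      finally show ?thesis .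
    qed
  qed
  have holD: "D holomorphic_on UNIV"
    unfolding holomorphic_on_def
  proof
    fix z :: complex
    show "D field_differentiable at z"
    proof (cases "sin (of_real pi * z) = 0")
      case True
      then obtain n where z: "z = of_int n" using sin_pi_eq_0_imp_int by blast
      have "(\<lambda>z. T2 (of_int n) z / (of_real pi * csinc (z - of_int n))\<^sup>2) holomorphic_on ball (of_int n) 1"
        using csinc_nonzero
        by (intro holomorphic_intros holomorphic_on_subset[OF hol2]) (auto simp: dist_norm norm_minus_commute)
      then have "D holomorphic_on ball (of_int n) 1"
        by (rule holomorphic_transform) (simp add: Dball)
      then show ?thesis unfolding z by (rule holomorphic_on_imp_differentiable_at) auto
    next
      case False
      have op: "open {z. sin (of_real pi * z) \<noteq> (0::complex)}"
        by (intro open_Collect_neq continuous_intros)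
      have "(\<lambda>z. T z / (sin (of_real pi * z))\<^sup>2) holomorphic_on {z. sin (of_real pi * z) \<noteq> 0}"
        by (intro holomorphic_intros holomorphic_on_subset[OF hol]) auto
      then have "D holomorphic_on {z. sin (of_real pi * z) \<noteq> 0}"
        by (rule holomorphic_transform) (simp add: D_def)
      then show ?thesis using op False by (intro holomorphic_on_imp_differentiable_at) auto
    qed
  qed
  have edge: "norm (D z) \<le> 8 * C" if z: "1 \<le> \<bar>Im z\<bar> \<or> cos (2 * pi * Re z) = -1" for z
  proof -
    have le: "exp (2 * pi * \<bar>Im z\<bar>) / 8 \<le> (norm (sin (of_real pi * z)))\<^sup>2"
      by (rule norm_sin_pi_ge[OF z])
    have pos: "0 < (norm (sin (of_real pi * z)))\<^sup>2"
      using le exp_gt_zero[of "2 * pi * \<bar>Im z\<bar>"] by linarith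
    then have "norm (D z) = norm (T z) / (norm (sin (of_real pi * z)))\<^sup>2"
      by (auto simp: D_def norm_divide norm_power)
    also have "\<dots> \<le> (C * exp (2 * pi * \<bar>Im z\<bar>)) / (exp (2 * pi * \<bar>Im z\<bar>) / 8)"
      using \<open>0 \<le> C\<close> by (intro frac_le bnd le) auto
    also have "\<dots> = 8 * C" by simp
    finally show ?thesis .
  qed
  have cosh: "cos (2 * pi * (real_of_int k + 1 / 2)) = -1" for k
  proof -
    have "cos (2 * pi * (real_of_int k + 1 / 2)) = cos (2 * pi * real_of_int k + pi)"
      by (simp add: algebra_simps)
    then show ?thesis by (simp add: cos_add)
  qed
  have Dle: "norm (D z) \<le> 8 * C" for z
  proof (cases "1 \<le> \<bar>Im z\<bar>")
    case True
    then show ?thesis using edge by blast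
  next
    case False
    \<comment> \<open>The nearest integer to \<open>Re z\<close>, so that \<open>z\<close> lies in the box of width 1 around it.\<close>
    define k where "k = \<lfloor>Re z + 1 / 2\<rfloor>"
    define a where "a = Complex (of_int (k - 1) + 1 / 2) (- 1)"
    define b where "b = Complex (of_int k + 1 / 2) 1"
    have k: "real_of_int k \<le> Re z + 1 / 2" "Re z + 1 / 2 < real_of_int k + 1"
      unfolding k_def by linarith+
    show ?thesis
    proof (rule maximum_modulus_frontier[where f = D and S = "cbox a b" and \<xi> = z])
      show "D holomorphic_on interior (cbox a b)" "continuous_on (closure (cbox a b)) D"
        by (auto intro: holomorphic_on_subset[OF holD] holomorphic_on_imp_continuous_on)
      show "z \<in> cbox a b"
        using k False by (auto simp: in_cbox_complex_iff a_def b_def)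
      fix w assume "w \<in> frontier (cbox a b)"
      then have "w \<in> cbox a b" "w \<notin> box a b"
        by (auto simp: frontier_def)
      then have "\<bar>Im w\<bar> = 1 \<or> Re w = of_int (k - 1) + 1 / 2 \<or> Re w = of_int k + 1 / 2"
        by (auto simp: in_cbox_complex_iff in_box_complex_iff a_def b_def)
      then show "norm (D w) \<le> 8 * C"
        using cosh[of "k - 1"] cosh[of k] by (intro edge) auto
    qed auto
  qed
  have "D constant_on UNIV"
    by (rule Liouville_theorem[OF holD]) (use Dle in \<open>auto intro!: boundedI\<close>)
  then obtain A where A: "\<And>z. D z = A" by (auto simp: constant_on_def)
  have "T z = A * (sin (of_real pi * z))\<^sup>2" for z
  proof (cases "sin (of_real pi * z) = 0")
    case True
    then show ?thesis using sin_pi_eq_0_imp_int[OF True] zero by auto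
  next
    case False
    then show ?thesis using A[of z] by (simp add: D_def field_simps)
  qed
  then show ?thesis by (rule that)
qed

lemma not_integrable_sin_squared: "\<not> integrable lborel (\<lambda>x. (sin (pi * x))\<^sup>2)"
proof
  assume int: "integrable lborel (\<lambda>x. (sin (pi * x))\<^sup>2)"
  have le: "real N / 2 \<le> (LINT x|lborel. (sin (pi * x))\<^sup>2)" for N
  proof -
    have "(LINT x|lborel. indicator {0..real N} x *\<^sub>R (sin (pi * x))\<^sup>2)
      = (real N / 2 - sin (2 * pi * real N) / (4 * pi)) - (0 / 2 - sin (2 * pi * 0) / (4 * pi))"
    proof (rule integral_FTC_atLeastAtMost)
      fix x :: real
      have "((\<lambda>x. x / 2 - sin (2 * pi * x) / (4 * pi)) has_real_derivative 1 / 2 - cos (2 * (pi * x)) / 2) (at x)"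
        by (auto intro!: derivative_eq_intros simp: field_simps)
      also have "1 / 2 - cos (2 * (pi * x)) / 2 = (sin (pi * x))\<^sup>2"
        unfolding cos_double_sin by (simp add: field_simps)
      finally show "((\<lambda>x. x / 2 - sin (2 * pi * x) / (4 * pi)) has_vector_derivative (sin (pi * x))\<^sup>2) (at x within {0..real N})"
        by (simp add: has_real_derivative_iff_has_vector_derivative has_vector_derivative_at_within)
    qed (auto intro!: continuous_intros)
    also have "\<dots> = real N / 2"
      using sin_npi_complex'[of "2 * N"] sin_npi[of "2 * N"] by (simp add: mult_ac)
    finally have "real N / 2 = (LINT x|lborel. indicator {0..real N} x *\<^sub>R (sin (pi * x))\<^sup>2)" ..
    also have "\<dots> \<le> (LINT x|lborel. (sin (pi * x))\<^sup>2)"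
      by (intro integral_mono integrable_mult_indicator int) (auto simp: indicator_def)
    finally show ?thesis .
  qed
  obtain N :: nat where "real N > 2 * (LINT x|lborel. (sin (pi * x))\<^sup>2)"
    using reals_Archimedean2 by blast
  with le[of N] show False by linarith
qed

lemma integrable_double_zeros_eq_0:
  assumes hol: "T holomorphic_on UNIV"
    and bnd: "\<And>z. norm (T z) \<le> C * exp (2 * pi * \<bar>Im z\<bar>)" and "0 \<le> C"
    and zero: "\<And>n::int. T (of_int n) = 0" "\<And>n::int. deriv T (of_int n) = 0"
    and int: "integrable lborel (\<lambda>x. T (of_real x))"
  shows "T z = 0"
proof -
  obtain A where A: "\<And>z. T z = A * (sin (of_real pi * z))\<^sup>2"
    using entire_double_zeros_eq_sin_squared[OF hol bnd \<open>0 \<le> C\<close> zero] by blast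
  have "A = 0"
  proof (rule ccontr)
    assume "A \<noteq> 0"
    have "norm (T (of_real x)) = norm A * (sin (pi * x))\<^sup>2" for x :: real
    proof -
      have "sin (of_real pi * of_real x) = complex_of_real (sin (pi * x))"
        by (simp add: sin_of_real [symmetric])
      then show ?thesis by (simp only: A norm_mult norm_power norm_of_real power2_abs)
    qed
    with integrable_norm[OF int] have "integrable lborel (\<lambda>x. norm A * (sin (pi * x))\<^sup>2)" by simp
    then have "integrable lborel (\<lambda>x. inverse (norm A) * (norm A * (sin (pi * x))\<^sup>2))"
      by (rule integrable_mult_right)
    then show False using \<open>A \<noteq> 0\<close> not_integrable_sin_squared by (simp flip: mult.assoc)
  qed
  with A show ?thesis by simp
qed

section \<open>The extremal theorem\<close>

text \<open>
  The difference has a minimum at the point where the graphs touch; its imaginary part vanishes on the whole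
  real line.
\<close>
lemma touching_imp_deriv_eq:
  fixes f g :: "complex \<Rightarrow> complex"
  assumes hol: "f holomorphic_on UNIV" "g holomorphic_on UNIV"
    and real: "\<And>x::real. f (of_real x) \<in> \<real>" "\<And>x::real. g (of_real x) \<in> \<real>"
    and le: "\<And>x::real. Re (g (of_real x)) \<le> Re (f (of_real x))"
    and eq: "f (of_real a) = g (of_real a)"
  shows "deriv f (of_real a) = deriv g (of_real a)"
proof -
  define h where "h = (\<lambda>z. f z - g z)"
  define d where "d = deriv f (of_real a) - deriv g (of_real a)"
  have "(h has_field_derivative d) (at (of_real a))"
    unfolding h_def d_def by (intro derivative_intros holomorphic_derivI[OF hol(1)] holomorphic_derivI[OF hol(2)]) auto
  then have D: "((\<lambda>x. h (of_real x)) has_vector_derivative d) (at a)"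
    by (rule has_vector_derivative_real_field)
  have "((\<lambda>x. Re (h (of_real x))) has_real_derivative Re d) (at a)"
    using bounded_linear.has_vector_derivative[OF bounded_linear_Re D]
    by (simp add: has_real_derivative_iff_has_vector_derivative)
  then have "Re d = 0"
    by (rule DERIV_local_min[of _ _ _ 1]) (use le eq in \<open>auto simp: h_def\<close>)
  moreover have "((\<lambda>x. Im (h (of_real x))) has_real_derivative Im d) (at a)"
    using bounded_linear.has_vector_derivative[OF bounded_linear_Im D]
    by (simp add: has_real_derivative_iff_has_vector_derivative)
  moreover have "(\<lambda>x. Im (h (of_real x))) = (\<lambda>x. 0)"
    using real by (auto simp: h_def complex_is_Real_iff)
  ultimately have "Re d = 0" "Im d = 0"
    using DERIV_unique[OF _ DERIV_const] by auto
  then have "d = 0" by (simp add: complex_eq_iff)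
  then show ?thesis by (simp add: d_def)
qed

lemma integrable_hermite_interpolant:
  assumes "lam > 0"
  shows "integrable lborel (\<lambda>x. hermite_interpolant lam (of_real x))"
proof -
  obtain B where B: "\<And>x::real. norm (hermite_interpolant lam (of_real x)) \<le> B * inverse (1 + x\<^sup>2)"
    using hermite_interpolant_decay[OF assms] by blast
  show ?thesis
  proof (rule Bochner_Integration.integrable_bound)
    show "integrable lborel (\<lambda>x. B * inverse (1 + x\<^sup>2))"
      by (intro integrable_mult_right integrable_inverse_1_plus_square_lborel)
    have "continuous_on UNIV (\<lambda>x. hermite_interpolant lam (of_real x))"
      by (intro continuous_on_compose2[OF holomorphic_on_imp_continuous_on[OF holomorphic_hermite_interpolant[OF assms]]]
          continuous_intros) auto
    then show "(\<lambda>x. hermite_interpolant lam (of_real x)) \<in> borel_measurable lborel"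
      by (simp add: borel_measurable_continuous_onI)
    show "AE x in lborel. norm (hermite_interpolant lam (of_real x)) \<le> norm (B * inverse (1 + x\<^sup>2))"
      by (intro AE_I2 order_trans[OF B]) simp
  qed
qed

theorem theorem3:
  fixes lam :: real and F :: "complex \<Rightarrow> complex"
  assumes "lam > 0"
    and "real_entire F"
    and "exp_type_at_most (2 * pi) F"
    and "\<And>x::real. Re (gaussian lam (of_real x)) \<le> Re (F (of_real x))"
  shows "ennreal (lam powr (- 1 / 2) * Re (theta3 0 (\<i> * of_real (inverse lam))))
             \<le> (\<integral>\<^sup>+x. ennreal (Re (F (of_real x))) \<partial>lborel) \<and>
         (ennreal (lam powr (- 1 / 2) * Re (theta3 0 (\<i> * of_real (inverse lam))))
             = (\<integral>\<^sup>+x. ennreal (Re (F (of_real x))) \<partial>lborel)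
           \<longleftrightarrow> F = gaussian_majorant lam)"
proof -
  define S where "S = lam powr (- 1 / 2) * Re (theta3 0 (\<i> * of_real (inverse lam)))"
  define g where "g = (\<lambda>n::int. exp (- (pi * lam) * (real_of_int n)\<^sup>2))"
  let ?I = "\<integral>\<^sup>+x. ennreal (Re (F (of_real x))) \<partial>lborel"
  have hol: "F holomorphic_on UNIV" and real: "\<And>x::real. F (of_real x) \<in> \<real>"
    using assms(2) by (auto simp: real_entire_def)
  have gauss: "gaussian lam (of_real x) = of_real (exp (- (pi * lam) * x\<^sup>2))" for x
    by (rule gaussian_of_real)
  have ge: "exp (- (pi * lam) * x\<^sup>2) \<le> Re (F (of_real x))" for x :: real
    using assms(4)[of x] by (simp add: gauss)
  then have pos: "0 \<le> Re (F (of_real x))" for x :: real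
    by (meson exp_ge_zero order_trans)
  have gint: "gaussian lam (of_int n) = of_real (g n)" for n
    using gauss[of "real_of_int n"] by (simp add: g_def)
  have gsum: "(g has_sum S) UNIV"
    using theta_transformation[OF assms(1)] by (simp add: g_def S_def)
  have glim: "(\<lambda>N::nat. \<Sum>n=-int N..int N. g n) \<longlonglongrightarrow> S"
    by (rule has_sum_imp_symmetric_limit[OF gsum])
  have "S \<ge> 0" by (rule has_sum_nonneg[OF gsum]) (simp add: g_def)
  have Freal: "F (of_real x) = of_real (Re (F (of_real x)))" for x :: real
    using real[of x] by (simp add: of_real_Re)
  have contF: "continuous_on UNIV (\<lambda>x. F (of_real x))"
    by (intro continuous_on_compose2[OF holomorphic_on_imp_continuous_on[OF hol]] continuous_intros) auto
  then have measF: "(\<lambda>x. Re (F (of_real x))) \<in> borel_measurable lborel"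
    by (simp add: borel_measurable_continuous_onI continuous_intros)
  show ?thesis
    unfolding S_def [symmetric]
  proof (cases "?I = \<infinity>")
    case True
    \<comment> \<open>The integral of \<open>F\<close> is infinite here, whereas the majorant is integrable.\<close>
    have "F \<noteq> gaussian_majorant lam"
    proof
      assume "F = gaussian_majorant lam"
      then have "integrable lborel (\<lambda>x. Re (F (of_real x)))"
        using integrable_hermite_interpolant[OF assms(1)]
        by (simp add: gaussian_majorant_eq_hermite_interpolant[OF assms(1)])
      then have "?I = ennreal (LINT x|lborel. Re (F (of_real x)))"
        by (intro nn_integral_eq_integral) (use pos in auto)
      then show False using True by simp
    qed
    then show "ennreal S \<le> ?I \<and> (ennreal S = ?I \<longleftrightarrow> F = gaussian_majorant lam)"
      using True by simp
  next
    case False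
    have intR: "integrable lborel (\<lambda>x. Re (F (of_real x)))"
    proof (rule integrableI_nonneg[OF measF])
      show "?I < \<infinity>" using False by (simp add: less_top)
    qed (use pos in auto)
    then have int: "integrable lborel (\<lambda>x. F (of_real x))"
      using integrable_of_real[OF intR, where 'a = complex] by (simp only: Freal [symmetric])
    define J where "J = (LINT x|lborel. Re (F (of_real x)))"
    have IJ: "?I = ennreal J"
      unfolding J_def by (rule nn_integral_eq_integral[OF intR]) (use pos in auto)
    have "J \<ge> 0" unfolding J_def by (rule integral_nonneg_AE) (use pos in auto)
    have FJ: "(LINT x|lborel. F (of_real x)) = of_real J"
      using integral_of_real[OF intR, where 'a = complex]
      by (simp only: Freal [symmetric] J_def)
    have sumF: "(\<Sum>n=-int N..int N. Re (F (of_int n))) \<le> J" for N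
      unfolding J_def by (rule sum_le_integral[OF hol assms(3) int pos])
    have gF: "g n \<le> Re (F (of_int n))" for n
      using ge[of "real_of_int n"] by (simp add: g_def)
    have "S \<le> J"
    proof (rule LIMSEQ_le_const2[OF glim])
      have "(\<Sum>n=-int N..int N. g n) \<le> J" for N
        by (rule order_trans[OF sum_mono sumF]) (rule gF)
      then show "\<exists>N. \<forall>n\<ge>N. (\<Sum>n=-int n..int n. g n) \<le> J" by blast
    qed
    have "S = J \<longleftrightarrow> F = hermite_interpolant lam"
    proof
      assume "S = J"
      have Fn: "F (of_int n) = gaussian lam (of_int n)" for n
      proof -
        have le: "Re (F (of_int n)) - g n \<le> J - (\<Sum>k=-int N..int N. g k)" if "N \<ge> nat \<bar>n\<bar>" for N
        proof -
          have "Re (F (of_int n)) - g n \<le> (\<Sum>k=-int N..int N. Re (F (of_int k)) - g k)"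
            using gF that by (intro member_le_sum[of n _ "\<lambda>k. Re (F (of_int k)) - g k"]) auto
          then show ?thesis using sumF[of N] by (simp add: sum_subtractf)
        qed
        have "(\<lambda>N. J - (\<Sum>k=-int N..int N. g k)) \<longlonglongrightarrow> J - S"
          by (intro tendsto_intros glim)
        \<comment> \<open>The excess at one integer is part of the total excess, which is 0 when \<open>S = J\<close>.\<close>
        then have "Re (F (of_int n)) - g n \<le> J - S"
          by (rule LIMSEQ_le_const) (use le in blast)
        then have "Re (F (of_int n)) = g n" using gF[of n] \<open>S = J\<close> by simp
        then show ?thesis using Freal[of "real_of_int n"] by (simp add: gint)
      qed
      have dFn: "deriv F (of_int n) = deriv (gaussian lam) (of_int n)" for n
        using touching_imp_deriv_eq[OF hol holomorphic_gaussian real _ assms(4), of "real_of_int n"] Fn[of n]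
        by (simp add: gauss)
      obtain P C a b where P: "\<And>z. (P has_field_derivative F z) (at z)" "C > 0"
        "\<And>z. norm (P z) \<le> C * exp (2 * pi * \<bar>Im z\<bar>)"
        by (rule integrable_exp_type_primitive[OF hol assms(3) _ int]) auto
      have Fbnd: "norm (F z) \<le> C * exp (2 * pi) * exp (2 * pi * \<bar>Im z\<bar>)" for z
        by (rule bounded_primitive_imp_bounded[OF P(1,3)]) (use P(2) in auto)
      obtain A where A: "A > 0" "\<And>z. norm (hermite_interpolant lam z) \<le> A * exp (2 * pi * \<bar>Im z\<bar>)"
        using norm_hermite_interpolant_le[OF assms(1)] by blast
      note holM = holomorphic_hermite_interpolant[OF assms(1)]
      have "F z - hermite_interpolant lam z = 0" for z
      proof (rule integrable_double_zeros_eq_0[where T = "\<lambda>z. F z - hermite_interpolant lam z"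
            and C = "C * exp (2 * pi) + A"])
        show "(\<lambda>z. F z - hermite_interpolant lam z) holomorphic_on UNIV"
          by (intro holomorphic_intros hol holM)
        show "norm (F z - hermite_interpolant lam z) \<le> (C * exp (2 * pi) + A) * exp (2 * pi * \<bar>Im z\<bar>)" for z
          using norm_triangle_ineq4[of "F z" "hermite_interpolant lam z"] Fbnd[of z] A(2)[of z]
          unfolding distrib_right by linarith
        show "F (of_int n) - hermite_interpolant lam (of_int n) = 0" for n
          by (simp add: Fn hermite_interpolant_of_int)
        show "deriv (\<lambda>z. F z - hermite_interpolant lam z) (of_int n) = 0" for n
          using hol holM dFn[of n]
          by (subst deriv_diff) (auto simp: holomorphic_on_imp_differentiable_at deriv_hermite_interpolant_of_int[OF assms(1)])
        show "integrable lborel (\<lambda>x. F (of_real x) - hermite_interpolant lam (of_real x))"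
          by (intro Bochner_Integration.integrable_diff int integrable_hermite_interpolant assms)
      qed (use P(2) A(1) in auto)
      then show "F = hermite_interpolant lam" by auto
    next
      assume F: "F = hermite_interpolant lam"
      obtain B where B: "\<And>x::real. norm (F (of_real x)) \<le> B * inverse (1 + x\<^sup>2)"
        using hermite_interpolant_decay[OF assms(1)] unfolding F by blast
      have "(\<lambda>N::nat. \<Sum>n=-int N..int N. F (of_int n)) \<longlonglongrightarrow> of_real J"
        using integral_eq_sum_of_decay[OF hol assms(3) int B] by (simp only: FJ)
      moreover have "(\<Sum>n=-int N..int N. F (of_int n)) = of_real (\<Sum>n=-int N..int N. g n)" for N
        by (simp add: F hermite_interpolant_of_int gint)
      ultimately have "(\<lambda>N::nat. \<Sum>n=-int N..int N. g n) \<longlonglongrightarrow> J"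
        by (simp only: tendsto_of_real_iff)
      with glim show "S = J" by (rule LIMSEQ_unique)
    qed
    with \<open>S \<le> J\<close> \<open>S \<ge> 0\<close> \<open>J \<ge> 0\<close>
    show "ennreal S \<le> ?I \<and> (ennreal S = ?I \<longleftrightarrow> F = gaussian_majorant lam)"
      by (simp add: IJ ennreal_leI gaussian_majorant_eq_hermite_interpolant[OF assms(1)])
  qed
qed

end
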